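(* Let $\Omega$, $N$, $j$, $b$ satisfy the standing assumptions listed in the context, and let $f \in L^2(\Omega)$. Then there exists $u \in W_0^{1,1}(\Omega)\cap L^2(\Omega)$ such that $$ \int_\Omega \frac{j(x,\nabla u)}{[1+b(x)|u|]^{2}}+\frac12\int_\Omega |u|^2-\int_\Omega f\,u \;\leq\; \int_\Omega \frac{j(x,\nabla v)}{[1+b(x)|v|]^{2}}+\frac12\int_\Omega |v|^2-\int_\Omega f\,v $$ for every $v \in H_0^1(\Omega)$. Moreover, $T_k(u)$ belongs to $H_0^1(\Omega)$ for every $k>0$.
   Context: Standing assumptions: $\Omega$ is a bounded open subset of $\mathbb{R}^N$ with $N>2$. The function $j:\Omega\times\mathbb{R}^N\to\mathbb{R}$ is such that $j(\cdot,\xi)$ is measurable on $\Omega$ for every $\xi\in\mathbb{R}^N$, $j(x,\cdot)$ is convex and belongs to $C^1(\mathbb{R}^N)$ for almost every $x\in\Omega$, and there are positive constants $\alpha,\beta,\gamma$ such that, for almost every $x\in\Omega$ and every $\xi\in\mathbb{R}^N$, $$\alpha|\xi|^2\le j(x,\xi)\le\beta|\xi|^2,\qquad |j_\xi(x,\xi)|\le\gamma|\xi|,$$ where $j_\xi$ denotes the gradient of $j$ with respect to $\xi$. The function $b$ is measurable on $\Omega$ with $0\le b(x)\le B$ for almost every $x\in\Omega$, where $B>0$ is a constant. Notation: for $k>0$ and $s\in\mathbb{R}$, $T_k(s)=\max(-k,\min(s,k))$. Integrals are with respect to Lebesgue measure. *)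

theory Defs
  imports "HOL-Analysis.Analysis"
begin

definition grad :: "('a::euclidean_space \<Rightarrow> real) \<Rightarrow> 'a \<Rightarrow> 'a" where
  "grad f x = (\<Sum>i\<in>Basis. frechet_derivative f (at x) i *\<^sub>R i)"

primrec Ck :: "nat \<Rightarrow> ('a::euclidean_space \<Rightarrow> real) \<Rightarrow> bool" where
  "Ck 0 f \<longleftrightarrow> continuous_on UNIV f"
| "Ck (Suc k) f \<longleftrightarrow>
     (\<forall>x. f differentiable at x) \<and> (\<forall>i\<in>Basis. Ck k (\<lambda>x. frechet_derivative f (at x) i))"

text \<open>The space of test functions on \<open>\<Omega>\<close>: smooth functions on the whole space whose support
  is a compact subset of \<open>\<Omega>\<close>.\<close>

definition test_functions :: "'a::euclidean_space set \<Rightarrow> ('a \<Rightarrow> real) set" where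
  "test_functions \<Omega> =
     {\<phi>. (\<forall>k. Ck k \<phi>) \<and> compact (closure {x. \<phi> x \<noteq> 0}) \<and> closure {x. \<phi> x \<noteq> 0} \<subseteq> \<Omega>}"

text \<open>Functions on \<open>\<Omega>\<close> are represented by total functions, whose values outside \<open>\<Omega>\<close> play no role,
  and membership in the spaces below is invariant under change on a null set; no quotient is taken.
  \<open>Lp_norm\<close> is meaningful only for elements of \<open>Lp\<close>, since the Bochner integral of a
  non-integrable function is \<open>0\<close>.\<close>

definition Lp :: "real \<Rightarrow> 'a::euclidean_space set \<Rightarrow> ('a \<Rightarrow> 'b::euclidean_space) set" where
  "Lp p \<Omega> = {f \<in> borel_measurable (lebesgue_on \<Omega>).
               integrable (lebesgue_on \<Omega>) (\<lambda>x. norm (f x) powr p)}"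

definition Lp_norm :: "real \<Rightarrow> 'a::euclidean_space set \<Rightarrow> ('a \<Rightarrow> 'b::euclidean_space) \<Rightarrow> real" where
  "Lp_norm p \<Omega> f = (LINT x|lebesgue_on \<Omega>. norm (f x) powr p) powr (1 / p)"

definition locally_integrable_on ::
    "'a::euclidean_space set \<Rightarrow> ('a \<Rightarrow> 'b::euclidean_space) \<Rightarrow> bool" where
  "locally_integrable_on \<Omega> f \<longleftrightarrow> (\<forall>K. compact K \<longrightarrow> K \<subseteq> \<Omega> \<longrightarrow> integrable (lebesgue_on K) f)"

definition has_weak_grad ::
    "'a::euclidean_space set \<Rightarrow> ('a \<Rightarrow> real) \<Rightarrow> ('a \<Rightarrow> 'a) \<Rightarrow> bool" where
  "has_weak_grad \<Omega> u g \<longleftrightarrow>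
     locally_integrable_on \<Omega> u \<and> locally_integrable_on \<Omega> g \<and>
     (\<forall>\<phi>\<in>test_functions \<Omega>. \<forall>i\<in>Basis.
        (LINT x|lebesgue_on \<Omega>. u x * (grad \<phi> x \<bullet> i)) =
        - (LINT x|lebesgue_on \<Omega>. (g x \<bullet> i) * \<phi> x))"

text \<open>A weak gradient is determined only up to a null subset of (the open set) \<open>\<Omega>\<close>; \<open>weak_grad\<close>
  selects a representative.\<close>

definition weak_grad :: "'a::euclidean_space set \<Rightarrow> ('a \<Rightarrow> real) \<Rightarrow> 'a \<Rightarrow> 'a" where
  "weak_grad \<Omega> u = (SOME g. has_weak_grad \<Omega> u g)"

definition W1 :: "real \<Rightarrow> 'a::euclidean_space set \<Rightarrow> ('a \<Rightarrow> real) set" where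
  "W1 p \<Omega> = {u \<in> Lp p \<Omega>. \<exists>g\<in>Lp p \<Omega>. has_weak_grad \<Omega> u g}"

definition W1_norm :: "real \<Rightarrow> 'a::euclidean_space set \<Rightarrow> ('a \<Rightarrow> real) \<Rightarrow> real" where
  "W1_norm p \<Omega> u = Lp_norm p \<Omega> u + Lp_norm p \<Omega> (weak_grad \<Omega> u)"

text \<open>The closure of the test functions in \<open>W1 p \<Omega>\<close>.\<close>

definition W1_0 :: "real \<Rightarrow> 'a::euclidean_space set \<Rightarrow> ('a \<Rightarrow> real) set" where
  "W1_0 p \<Omega> = {u \<in> W1 p \<Omega>. \<forall>\<epsilon>>0. \<exists>\<phi>\<in>test_functions \<Omega>. W1_norm p \<Omega> (\<lambda>x. u x - \<phi> x) < \<epsilon>}"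

abbreviation H1_0 :: "'a::euclidean_space set \<Rightarrow> ('a \<Rightarrow> real) set" where
  "H1_0 \<equiv> W1_0 2"

definition trunc :: "real \<Rightarrow> real \<Rightarrow> real" where
  "trunc k s = max (- k) (min s k)"

text \<open>The first term of the functional is a \<open>[0, \<infinity>]\<close>-valued integral: it may be infinite for
  \<open>u\<close> in \<open>W1_0 1 \<Omega> \<inter> Lp 2 \<Omega>\<close>, where a Bochner integral would read \<open>0\<close>. The truncation of negative
  values by \<open>ennreal\<close> is harmless because \<open>j x \<xi> \<ge> 0\<close> for almost every \<open>x\<close>. The other two terms
  are finite for \<open>u, f \<in> Lp 2 \<Omega>\<close>.\<close>

definition energy ::
    "('a::euclidean_space \<Rightarrow> 'a \<Rightarrow> real) \<Rightarrow> ('a \<Rightarrow> real) \<Rightarrow> ('a \<Rightarrow> real) \<Rightarrow> 'a set \<Rightarrow> ('a \<Rightarrow> real) \<Rightarrow> ereal"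
  where
  "energy j b f \<Omega> u =
     enn2ereal (\<integral>\<^sup>+x. ennreal (j x (weak_grad \<Omega> u x) / (1 + b x * \<bar>u x\<bar>)\<^sup>2) \<partial>lebesgue_on \<Omega>)
     + ereal (1 / 2 * (LINT x|lebesgue_on \<Omega>. \<bar>u x\<bar>\<^sup>2) - (LINT x|lebesgue_on \<Omega>. f x * u x))"

end

theory Submission
  imports Defs "HOL-Library.Diagonal_Subsequence"
begin

text \<open>
  Take a minimizing sequence \<open>\<phi>\<^sub>n\<close> of test functions. Coercivity only bounds
  \<open>\<nabla>\<phi>\<^sub>n / (1 + B |\<phi>\<^sub>n|)\<close> and \<open>\<phi>\<^sub>n\<close> in \<open>L\<^sup>2\<close>, so for every \<open>K\<close> the functions
  \<open>A\<^sub>K \<phi>\<^sub>n\<close> with \<open>A\<^sub>K s = K arsinh (s / K)\<close> are bounded in \<open>H\<^sup>1\<^sub>0\<close>. By Rellich a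
  subsequence of \<open>arsinh \<phi>\<^sub>n\<close> converges almost everywhere and in \<open>L\<^sup>2\<close> to some \<open>w\<close>; put
  \<open>u = sinh w\<close>. Convex combinations of the tails of \<open>\<nabla> (A\<^sub>K \<phi>\<^sub>n)\<close> converge strongly in \<open>L\<^sup>2\<close>, and the
  chain rule together with uniqueness of weak gradients identifies the limit as
  \<open>A\<^sub>K' (u) g\<close> with one field \<open>g = cosh w \<nabla>w\<close> for all \<open>K\<close>. Since
  \<open>j x (t \<xi>) \<le> j x \<xi>\<close> for \<open>0 \<le> t \<le> 1\<close>, convexity and Fatou's lemma along these convex
  combinations, followed by \<open>K \<rightarrow> \<infinity>\<close>, show that \<open>(u, g)\<close> attains the infimum.
  Truncations of \<open>u\<close> are Lipschitz functions of \<open>w \<in> H\<^sup>1\<^sub>0\<close>, and \<open>u\<close> is their limit in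
  \<open>W\<^sup>1\<^sup>,\<^sup>1\<close>, because \<open>|g| \<le> |g|\<^sup>2 / (1 + B |u|)\<^sup>2 + (1 + B |u|)\<^sup>2\<close> is integrable.
\<close>

section \<open>Smooth functions\<close>

text \<open>The weight \<open>1 / (1 + b |u|)^2\<close> degenerates where \<open>|u|\<close> is
  large, so a bound on the functional gives no \<open>L^2\<close> bound on gradients, and the
  minimizer is found only in \<open>W_0^{1,1}\<close>. The function \<open>arsinh\<close> is chosen
  because \<open>A_K' s = K / sqrt (s^2 + K^2)\<close> decays like \<open>1 / (1 + B |s|)\<close>,
  while \<open>A_K\<close> is smooth, fixes 0 and is invertible: it maps test functions to test
  functions and, unlike a truncation, loses no information about \<open>u\<close>.

  Weak compactness enters only through convex combinations, whose weights depend on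
  \<open>K\<close>. The limits for different \<open>K\<close> are therefore unrelated at first, and
  uniqueness of weak gradients is what ties them to one field. Moreover the integrand is convex in
  the gradient but not jointly in \<open>u\<close> and its gradient. Since the weights converge
  almost everywhere, they exceed a constant just below their limit on a late tail, and convexity in
  the gradient then suffices.

  The infimum is taken over test functions. It bounds the functional on all of \<open>H_0^1\<close>
  because the quadratic growth of \<open>j\<close> permits passing to the limit along approximating
  test functions.\<close>

definition smooth :: "('a::euclidean_space \<Rightarrow> real) \<Rightarrow> bool" where
  "smooth f \<longleftrightarrow> (\<forall>k. Ck k f)"

text \<open>\<open>Ck\<close> is phrased with the choice-based \<open>frechet_derivative\<close>.
  Uniqueness of derivatives lets any exhibited derivative \<open>D\<close> take its place.\<close>

lemma Ck_SucI:
  assumes "\<And>x. (f has_derivative D x) (at x)" "\<And>i. i \<in> Basis \<Longrightarrow> Ck k (\<lambda>x. D x i)"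
  shows "Ck (Suc k) f"
proof -
  have "frechet_derivative f (at x) = D x" for x
    using assms(1) by (metis frechet_derivative_at)
  then show ?thesis
    using assms by (auto simp: differentiable_def)
qed

lemma Ck_SucD:
  assumes "Ck (Suc k) f"
  shows "(f has_derivative frechet_derivative f (at x)) (at x)"
    "i \<in> Basis \<Longrightarrow> Ck k (\<lambda>x. frechet_derivative f (at x) i)"
  using assms by (auto simp: frechet_derivative_works)

lemma Ck_continuous: "Ck k f \<Longrightarrow> continuous_on UNIV f"
  by (cases k) (auto simp: continuous_on_eq_continuous_within differentiable_imp_continuous_within)

lemma Ck_Suc_imp: "Ck (Suc k) f \<Longrightarrow> Ck k f"
proof (induction k arbitrary: f)
  case 0
  then show ?case using Ck_continuous[of "Suc 0" f] by simp
qed auto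

lemma Ck_const [simp]: "Ck k (\<lambda>x. c)"
proof (induction k arbitrary: c)
  case (Suc k)
  show ?case by (rule Ck_SucI[OF has_derivative_const]) (rule Suc.IH)
qed simp

lemma Ck_linear:
  assumes "bounded_linear f" shows "Ck k f"
proof (cases k)
  case 0
  then show ?thesis using assms by (simp add: linear_continuous_on)
next
  case (Suc l)
  show ?thesis unfolding Suc
    by (rule Ck_SucI[of f "\<lambda>x. f"]) (auto intro: bounded_linear_imp_has_derivative assms)
qed

lemma Ck_add: "Ck k f \<Longrightarrow> Ck k g \<Longrightarrow> Ck k (\<lambda>x. f x + g x)"
proof (induction k arbitrary: f g)
  case 0
  then show ?case by (auto intro: continuous_intros)
next
  case (Suc k)
  show ?case
    by (rule Ck_SucI[OF has_derivative_add[OF Ck_SucD(1)[OF Suc.prems(1)] Ck_SucD(1)[OF Suc.prems(2)]]])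
      (intro Suc.IH Ck_SucD(2)[OF Suc.prems(1)] Ck_SucD(2)[OF Suc.prems(2)])
qed

lemma Ck_mult: "Ck k f \<Longrightarrow> Ck k g \<Longrightarrow> Ck k (\<lambda>x. f x * g x)"
proof (induction k arbitrary: f g)
  case 0
  then show ?case by (auto intro: continuous_intros)
next
  case (Suc k)
  show ?case
    by (rule Ck_SucI[OF has_derivative_mult[OF Ck_SucD(1)[OF Suc.prems(1)] Ck_SucD(1)[OF Suc.prems(2)]]])
      (intro Ck_add Suc.IH Ck_SucD(2)[OF Suc.prems(1)] Ck_SucD(2)[OF Suc.prems(2)]
         Ck_Suc_imp[OF Suc.prems(1)] Ck_Suc_imp[OF Suc.prems(2)])
qed

lemma Ck_scaled: "Ck k f \<Longrightarrow> Ck k (\<lambda>x. c * f x)"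
  by (intro Ck_mult Ck_const)

lemma Ck_sum: "(\<And>i. i \<in> I \<Longrightarrow> Ck k (f i)) \<Longrightarrow> Ck k (\<lambda>x. \<Sum>i\<in>I. f i x)"
  by (induction I rule: infinite_finite_induct) (auto intro: Ck_add)

lemma Ck_prod: "(\<And>i. i \<in> I \<Longrightarrow> Ck k (f i)) \<Longrightarrow> Ck k (\<lambda>x. \<Prod>i\<in>I. f i x)"
  by (induction I rule: infinite_finite_induct) (auto intro: Ck_mult)

lemma Ck_real_SucI:
  fixes f :: "real \<Rightarrow> real"
  assumes "\<And>x. (f has_real_derivative f' x) (at x)" "Ck k f'"
  shows "Ck (Suc k) f"
  by (rule Ck_SucI[where D = "\<lambda>x h. f' x * h"]) (use assms in \<open>auto simp: has_field_derivative_def\<close>)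

text \<open>On the reals \<open>Basis\<close> is \<open>{1}\<close> and a linear map is
  multiplication by its value at 1, which turns the directional derivatives in \<open>Ck\<close>
  into the ordinary \<open>deriv\<close>.\<close>

lemma Ck_real_SucD:
  fixes f :: "real \<Rightarrow> real"
  assumes "Ck (Suc k) f"
  shows "(f has_real_derivative deriv f x) (at x)" "Ck k (deriv f)"
proof -
  have D: "(f has_real_derivative frechet_derivative f (at x) 1) (at x)" for x
  proof -
    have f: "(f has_derivative frechet_derivative f (at x)) (at x)"
      using Ck_SucD(1)[OF assms] .
    then have lin: "linear (frechet_derivative f (at x))" by (rule has_derivative_linear)
    have "frechet_derivative f (at x) = (*) (frechet_derivative f (at x) 1)"
    proof
      fix h
      show "frechet_derivative f (at x) h = frechet_derivative f (at x) 1 * h"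
        using linear_scale[OF lin, of h 1] by simp
    qed
    with f show ?thesis by (metis has_field_derivative_def)
  qed
  then have eq: "deriv f = (\<lambda>x. frechet_derivative f (at x) 1)"
    by (auto intro: DERIV_imp_deriv)
  show "(f has_real_derivative deriv f x) (at x)" unfolding eq by (rule D)
  show "Ck k (deriv f)" unfolding eq by (rule Ck_SucD(2)[OF assms]) simp
qed

text \<open>The derivative is a product whose first factor composes the derivative of
  \<open>R\<close> with \<open>f\<close>, both of lower order; the induction therefore runs over all
  \<open>R\<close> and \<open>f\<close> at once.\<close>

lemma Ck_compose:
  fixes R :: "real \<Rightarrow> real"
  shows "Ck k R \<Longrightarrow> Ck k f \<Longrightarrow> Ck k (\<lambda>x. R (f x))"
proof (induction k arbitrary: R f)
  case 0
  then show ?case by (auto intro: continuous_on_compose2)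
next
  case (Suc k)
  have *: "((\<lambda>x. R (f x)) has_derivative (\<lambda>h. deriv R (f x) * frechet_derivative f (at x) h)) (at x)" for x
    using has_derivative_compose[OF Ck_SucD(1)[OF Suc.prems(2)]
        Ck_real_SucD(1)[OF Suc.prems(1), unfolded has_field_derivative_def]] .
  show ?case
    by (rule Ck_SucI[OF *])
      (rule Ck_mult[OF Suc.IH[OF Ck_real_SucD(2)[OF Suc.prems(1)] Ck_Suc_imp[OF Suc.prems(2)]]
          Ck_SucD(2)[OF Suc.prems(2)]])
qed

lemma Ck_exp: "Ck k (exp :: real \<Rightarrow> real)"
proof (induction k)
  case 0
  show ?case by (simp add: continuous_on_exp)
next
  case (Suc k)
  then show ?case by (rule Ck_real_SucI[OF DERIV_exp])
qed

lemma Ck_ident [simp]: "Ck k (\<lambda>x::real. x)"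
  by (rule Ck_linear) simp

lemma Ck_minus: "Ck k f \<Longrightarrow> Ck k (\<lambda>x. - f x)"
  using Ck_scaled[of k f "-1"] by simp

text \<open>Writing the derivative \<open>2 s / (s^2 + 1)\<close> as
  \<open>2 s exp (- ln (s^2 + 1))\<close> brings back the function itself, so the induction
  hypothesis closes the step. The purpose is \<open>smooth_inverse_sqrt\<close>, the smoothness of
  the derivative of \<open>arsinh\<close>.\<close>

lemma Ck_ln_one_plus_square: "Ck k (\<lambda>s::real. ln (s\<^sup>2 + 1))"
proof (induction k)
  case 0
  show ?case
    by (auto intro!: continuous_intros simp: add_nonneg_eq_0_iff)
next
  case (Suc k)
  have pos: "s\<^sup>2 + 1 > 0" for s :: real
    by (simp add: add_nonneg_pos)
  show ?case
  proof (rule Ck_real_SucI)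
    show "((\<lambda>s. ln (s\<^sup>2 + 1)) has_real_derivative 2 * s * exp (- ln (s\<^sup>2 + 1))) (at s)" for s :: real
      using pos[of s] by (auto intro!: derivative_eq_intros simp: exp_minus field_simps)
    show "Ck k (\<lambda>s::real. 2 * s * exp (- ln (s\<^sup>2 + 1)))"
      by (intro Ck_mult Ck_const Ck_ident Ck_compose[OF Ck_exp] Ck_minus Suc.IH)
  qed
qed

lemma smooth_inverse_sqrt: "smooth (\<lambda>s::real. 1 / sqrt (s\<^sup>2 + 1))"
proof -
  have "(\<lambda>s::real. 1 / sqrt (s\<^sup>2 + 1)) = (\<lambda>s. exp ((-1/2) * ln (s\<^sup>2 + 1)))"
  proof
    fix s :: real
    have "s\<^sup>2 + 1 > 0" by (simp add: add_nonneg_pos)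
    then have "exp ((-1/2) * ln (s\<^sup>2 + 1)) = (s\<^sup>2 + 1) powr (-1/2)"
      by (simp add: powr_def)
    also have "\<dots> = 1 / sqrt (s\<^sup>2 + 1)"
      using \<open>s\<^sup>2 + 1 > 0\<close> by (simp add: powr_minus powr_half_sqrt field_simps)
    finally show "1 / sqrt (s\<^sup>2 + 1) = exp ((-1/2) * ln (s\<^sup>2 + 1))" by simp
  qed
  then show ?thesis
    unfolding smooth_def by (simp only:) (intro allI Ck_compose[OF Ck_exp] Ck_scaled Ck_ln_one_plus_square)
qed

lemma smooth_realI:
  fixes f :: "real \<Rightarrow> real"
  assumes "\<And>x. (f has_real_derivative f' x) (at x)" "smooth f'"
  shows "smooth f"
  unfolding smooth_def
proof
  fix k show "Ck k f"
    using Ck_real_SucI[OF assms(1)] assms(2) Ck_Suc_imp unfolding smooth_def by blast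
qed

lemma smooth_arsinh: "smooth (arsinh :: real \<Rightarrow> real)"
  by (rule smooth_realI[OF arsinh_real_has_field_derivative smooth_inverse_sqrt])

lemma smooth_const [simp]: "smooth (\<lambda>x. c)"
  and smooth_ident [simp]: "smooth (\<lambda>x::real. x)"
  and smooth_exp: "smooth (exp :: real \<Rightarrow> real)"
  by (simp_all add: smooth_def Ck_exp)

lemma smooth_inner: "smooth (\<lambda>x. x \<bullet> a)"
  unfolding smooth_def by (auto intro!: Ck_linear bounded_linear_intros)

lemma smooth_add: "smooth f \<Longrightarrow> smooth g \<Longrightarrow> smooth (\<lambda>x. f x + g x)"
  and smooth_mult: "smooth f \<Longrightarrow> smooth g \<Longrightarrow> smooth (\<lambda>x. f x * g x)"
  and smooth_minus: "smooth f \<Longrightarrow> smooth (\<lambda>x. - f x)"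
  by (simp_all add: smooth_def Ck_add Ck_mult Ck_minus)

lemma smooth_diff: "smooth f \<Longrightarrow> smooth g \<Longrightarrow> smooth (\<lambda>x. f x - g x)"
  using smooth_add[of f "\<lambda>x. - g x"] smooth_minus[of g] by simp

lemma smooth_sum: "(\<And>i. i \<in> I \<Longrightarrow> smooth (f i)) \<Longrightarrow> smooth (\<lambda>x. \<Sum>i\<in>I. f i x)"
  and smooth_prod: "(\<And>i. i \<in> I \<Longrightarrow> smooth (f i)) \<Longrightarrow> smooth (\<lambda>x. \<Prod>i\<in>I. f i x)"
  by (simp_all add: smooth_def Ck_sum Ck_prod)

lemma smooth_compose:
  fixes R :: "real \<Rightarrow> real"
  shows "smooth R \<Longrightarrow> smooth f \<Longrightarrow> smooth (\<lambda>x. R (f x))"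
  by (simp add: smooth_def Ck_compose)

lemma smooth_continuous: "smooth f \<Longrightarrow> continuous_on A f"
  using Ck_continuous[of 0 f] continuous_on_subset unfolding smooth_def by blast

lemma smooth_real_derivative:
  fixes f :: "real \<Rightarrow> real"
  assumes "smooth f"
  shows "(f has_real_derivative deriv f x) (at x)" "smooth (deriv f)"
  using assms Ck_real_SucD unfolding smooth_def by blast+

lemma smooth_sinh: "smooth (sinh :: real \<Rightarrow> real)" and smooth_cosh: "smooth (cosh :: real \<Rightarrow> real)"
proof -
  have "sinh = (\<lambda>x::real. (1/2) * (exp x - exp (- x)))" "cosh = (\<lambda>x::real. (1/2) * (exp x + exp (- x)))"
    by (auto simp: sinh_field_def cosh_field_def)
  moreover have "smooth (\<lambda>x::real. (1/2) * (exp x - exp (- x)))" "smooth (\<lambda>x::real. (1/2) * (exp x + exp (- x)))"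
    by (intro smooth_mult smooth_const smooth_add smooth_diff smooth_exp
        smooth_compose[OF smooth_exp] smooth_minus smooth_ident)+
  ultimately show "smooth (sinh :: real \<Rightarrow> real)" "smooth (cosh :: real \<Rightarrow> real)"
    by simp_all
qed

section \<open>A smooth function vanishing to infinite order at the origin\<close>

definition flat :: "real \<Rightarrow> real" where
  "flat t = (if t > 0 then exp (- (1 / t)) else 0)"

lemma poly_inverse_exp_tendsto_0:
  "((\<lambda>t. (1/t) ^ m * exp (- (1/t))) \<longlongrightarrow> 0) (at_right (0::real))"
proof -
  have "((\<lambda>x::real. x ^ m / exp x) \<longlongrightarrow> 0) at_top"
    by (rule tendsto_power_div_exp_0)
  from filterlim_compose[OF this filterlim_inverse_at_top_right]
  show ?thesis by (simp add: exp_minus field_simps inverse_eq_divide)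
qed

text \<open>The functions \<open>(1/t)^m exp (-1/t)\<close> are closed under differentiation up to
  linear combinations, so \<open>smooth_flat\<close> is an induction on the order for all
  \<open>m\<close> simultaneously. At the origin the difference quotient from the right is the
  member with exponent \<open>m + 1\<close>, which tends to 0.\<close>

lemma flat_power_has_derivative:
  "((\<lambda>t. if t > 0 then (1/t)^m * exp (- (1/t)) else 0) has_real_derivative
     ((if t > 0 then (1/t)^(m+2) * exp (- (1/t)) else 0)
      - of_nat m * (if t > 0 then (1/t)^(m+1) * exp (- (1/t)) else 0))) (at t)"
proof -
  consider "t > 0" | "t < 0" | "t = 0" by linarith
  then show ?thesis
  proof cases
    case 1
    have inv: "((\<lambda>t. 1/t) has_real_derivative - ((1/t)\<^sup>2)) (at t)"
      using 1 by (auto intro!: derivative_eq_intros simp: power2_eq_square)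
    have pw: "((\<lambda>t. (1/t)^m) has_real_derivative - (of_nat m * (1/t)^(m+1))) (at t)"
      by (rule DERIV_cong[OF DERIV_power[OF inv, of m]])
        (cases m; simp only: power_Suc power_add power2_eq_square diff_Suc_1; simp add: algebra_simps)
    have "((\<lambda>t. exp (- (1/t))) has_real_derivative (1/t)^2 * exp (- (1/t))) (at t)"
      using DERIV_fun_exp[OF DERIV_minus[OF inv]] by (simp add: mult.commute)
    from DERIV_mult[OF pw this]
    have "((\<lambda>t. (1/t)^m * exp (- (1/t))) has_real_derivative
       ((1/t)^(m+2) * exp (- (1/t)) - of_nat m * ((1/t)^(m+1) * exp (- (1/t))))) (at t)"
      by (rule DERIV_cong) (simp add: power_add algebra_simps power2_eq_square)
    then have "((\<lambda>t. if t > 0 then (1/t)^m * exp (- (1/t)) else 0) has_real_derivative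
       ((1/t)^(m+2) * exp (- (1/t)) - of_nat m * ((1/t)^(m+1) * exp (- (1/t))))) (at t)"
      by (rule has_field_derivative_transform_within_open[where S = "{0<..}"]) (use 1 in auto)
    then show ?thesis using 1 by (simp only: if_True)
  next
    case 2
    show ?thesis
      by (rule has_field_derivative_transform_within_open[where S = "{..<0}" and f = "\<lambda>_. 0"]) (use 2 in auto)
  next
    case 3
    have "((\<lambda>h::real. (if h > 0 then (1/h)^m * exp (- (1/h)) else 0) / h) \<longlongrightarrow> 0) (at 0)"
      unfolding filterlim_at_split
    proof
      show "((\<lambda>h::real. (if h > 0 then (1/h)^m * exp (- (1/h)) else 0) / h) \<longlongrightarrow> 0) (at_left 0)"
        by (rule tendsto_eventually) (auto simp: eventually_at_filter)
      have "\<forall>\<^sub>F h::real in at_right 0. (1/h) ^ Suc m * exp (- (1/h)) = (if h > 0 then (1/h)^m * exp (- (1/h)) else 0) / h"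
        by (auto simp: eventually_at_filter)
      from Lim_transform_eventually[OF poly_inverse_exp_tendsto_0 this]
      show "((\<lambda>h::real. (if h > 0 then (1/h)^m * exp (- (1/h)) else 0) / h) \<longlongrightarrow> 0) (at_right 0)" .
    qed
    then show ?thesis unfolding 3 DERIV_def by (simp only: add_0 less_irrefl if_False diff_zero mult_zero_right)
  qed
qed

lemma smooth_flat: "smooth flat"
proof -
  have "Ck k (\<lambda>t::real. if t > 0 then (1/t)^m * exp (- (1/t)) else 0)" for k m
  proof (induction k arbitrary: m)
    case 0
    show ?case
      using DERIV_isCont[OF flat_power_has_derivative[of m]]
      by (simp add: continuous_on_eq_continuous_at)
  next
    case (Suc k)
    show ?case
      by (rule Ck_real_SucI[OF flat_power_has_derivative])
        (use Ck_add[OF Suc.IH[of "m+2"] Ck_minus[OF Ck_scaled[OF Suc.IH[of "m+1"]]]] in simp)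
  qed
  from this[of _ 0] show ?thesis by (simp add: smooth_def flat_def[abs_def] cong: if_cong)
qed

lemma flat_nonneg: "flat t \<ge> 0"
  and flat_eq_0_iff: "flat t = 0 \<longleftrightarrow> t \<le> 0"
  by (auto simp: flat_def)

section \<open>Test functions\<close>

lemma test_functions_iff:
  "\<phi> \<in> test_functions \<Omega> \<longleftrightarrow>
    smooth \<phi> \<and> compact (closure {x. \<phi> x \<noteq> 0}) \<and> closure {x. \<phi> x \<noteq> 0} \<subseteq> \<Omega>"
  by (simp add: test_functions_def smooth_def)

text \<open>Multiplication, scaling and composition with \<open>R 0 = 0\<close> all create no new
  nonzero points, and a closed subset of a compact support is compact; each of these closure
  properties is an instance.\<close>

lemma test_functions_support:
  assumes "smooth \<psi>" "\<phi> \<in> test_functions \<Omega>" "\<And>x. \<phi> x = 0 \<Longrightarrow> \<psi> x = 0"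
  shows "\<psi> \<in> test_functions \<Omega>"
proof -
  have sub: "closure {x. \<psi> x \<noteq> 0} \<subseteq> closure {x. \<phi> x \<noteq> 0}"
    by (rule closure_mono) (use assms(3) in auto)
  have "compact (closure {x. \<phi> x \<noteq> 0} \<inter> closure {x. \<psi> x \<noteq> 0})"
    using assms(2) by (intro compact_Int_closed) (auto simp: test_functions_iff)
  with sub show ?thesis
    using assms by (auto simp: test_functions_iff Int_absorb1)
qed

lemma test_functions_zero: "(\<lambda>x. 0) \<in> test_functions \<Omega>"
  by (simp add: test_functions_iff)

lemma test_functions_add:
  assumes "\<phi> \<in> test_functions \<Omega>" "\<psi> \<in> test_functions \<Omega>"
  shows "(\<lambda>x. \<phi> x + \<psi> x) \<in> test_functions \<Omega>"
proof -
  have sub: "closure {x. \<phi> x + \<psi> x \<noteq> 0} \<subseteq> closure {x. \<phi> x \<noteq> 0} \<union> closure {x. \<psi> x \<noteq> 0}"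
    unfolding closure_Un[symmetric] by (rule closure_mono) auto
  have "compact ((closure {x. \<phi> x \<noteq> 0} \<union> closure {x. \<psi> x \<noteq> 0}) \<inter> closure {x. \<phi> x + \<psi> x \<noteq> 0})"
    using assms by (intro compact_Int_closed compact_Un) (auto simp: test_functions_iff)
  with sub show ?thesis
    using assms by (auto simp: test_functions_iff Int_absorb1 intro: smooth_add)
qed

lemma test_functions_scale: "\<phi> \<in> test_functions \<Omega> \<Longrightarrow> (\<lambda>x. c * \<phi> x) \<in> test_functions \<Omega>"
  by (rule test_functions_support[of _ \<phi>]) (auto simp: test_functions_iff intro: smooth_mult)

lemma test_functions_mult: "\<phi> \<in> test_functions \<Omega> \<Longrightarrow> smooth \<psi> \<Longrightarrow> (\<lambda>x. \<phi> x * \<psi> x) \<in> test_functions \<Omega>"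
  by (rule test_functions_support[of _ \<phi>]) (auto simp: test_functions_iff intro: smooth_mult)

lemma test_functions_compose:
  "\<phi> \<in> test_functions \<Omega> \<Longrightarrow> smooth R \<Longrightarrow> R 0 = 0 \<Longrightarrow> (\<lambda>x. R (\<phi> x)) \<in> test_functions \<Omega>"
  by (rule test_functions_support[of _ \<phi>]) (auto simp: test_functions_iff intro: smooth_compose)

lemma test_functions_sum:
  "(\<And>i. i \<in> I \<Longrightarrow> \<phi> i \<in> test_functions \<Omega>) \<Longrightarrow> (\<lambda>x. \<Sum>i\<in>I. c i * \<phi> i x) \<in> test_functions \<Omega>"
proof (induction I rule: infinite_finite_induct)
  case (insert i I)
  then have "(\<lambda>x. c i * \<phi> i x + (\<Sum>i\<in>I. c i * \<phi> i x)) \<in> test_functions \<Omega>"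
    by (intro test_functions_add test_functions_scale[of "\<phi> i"]) auto
  with insert show ?case by simp
qed (simp_all add: test_functions_zero)

lemma test_functions_zero_outside: "\<phi> \<in> test_functions \<Omega> \<Longrightarrow> x \<notin> \<Omega> \<Longrightarrow> \<phi> x = 0"
  using closure_subset[of "{x. \<phi> x \<noteq> 0}"] by (auto simp: test_functions_iff)

lemma has_derivative_imp_grad:
  assumes "(f has_derivative (\<lambda>h. D \<bullet> h)) (at x)"
  shows "grad f x = D"
  unfolding grad_def frechet_derivative_at[OF assms, symmetric] by (rule euclidean_representation)

lemma frechet_derivative_eq_grad:
  assumes "f differentiable (at x)"
  shows "frechet_derivative f (at x) h = grad f x \<bullet> h"
proof -
  have lin: "linear (frechet_derivative f (at x))"
    using assms linear_frechet_derivative by blast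
  have "frechet_derivative f (at x) h = frechet_derivative f (at x) (\<Sum>i\<in>Basis. (h \<bullet> i) *\<^sub>R i)"
    by (simp add: euclidean_representation)
  also have "\<dots> = (\<Sum>i\<in>Basis. (h \<bullet> i) * frechet_derivative f (at x) i)"
    using lin by (simp add: linear_sum linear_scale)
  also have "\<dots> = grad f x \<bullet> h"
    unfolding grad_def inner_sum_left inner_scaleR_left
    by (intro sum.cong refl) (simp add: inner_commute mult.commute)
  finally show ?thesis .
qed

lemma smooth_has_derivative:
  assumes "smooth f"
  shows "(f has_derivative (\<lambda>h. grad f x \<bullet> h)) (at x)"
proof -
  have "Ck (Suc 0) f" using assms by (simp add: smooth_def del: Ck.simps)
  then have "(f has_derivative frechet_derivative f (at x)) (at x)" by (rule Ck_SucD)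
  moreover from this have "frechet_derivative f (at x) = (\<lambda>h. grad f x \<bullet> h)"
    using frechet_derivative_eq_grad[of f x] differentiableI by blast
  ultimately show ?thesis by simp
qed

lemma smooth_grad:
  assumes "smooth f" "i \<in> Basis"
  shows "smooth (\<lambda>x. grad f x \<bullet> i)"
proof -
  have "Ck k (\<lambda>x. grad f x \<bullet> i)" for k
  proof -
    have "Ck (Suc k) f" using assms by (simp add: smooth_def del: Ck.simps)
    then have "Ck k (\<lambda>x. frechet_derivative f (at x) i)" using assms(2) by (rule Ck_SucD)
    moreover have "frechet_derivative f (at x) i = grad f x \<bullet> i" for x
      by (rule frechet_derivative_eq_grad) (use smooth_has_derivative[OF assms(1)] differentiableI in blast)
    ultimately show ?thesis by simp
  qed
  then show ?thesis by (simp add: smooth_def)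
qed

lemma continuous_grad: "smooth f \<Longrightarrow> continuous_on A (grad f)"
  by (subst continuous_on_componentwise) (auto intro: smooth_continuous smooth_grad)

lemma grad_compose:
  assumes "smooth R" "smooth f"
  shows "grad (\<lambda>x. R (f x)) x = deriv R (f x) *\<^sub>R grad f x"
proof (rule has_derivative_imp_grad)
  have "((\<lambda>x. R (f x)) has_derivative (\<lambda>h. deriv R (f x) * (grad f x \<bullet> h))) (at x)"
    by (rule has_derivative_compose[OF smooth_has_derivative[OF assms(2)]
          smooth_real_derivative(1)[OF assms(1), unfolded has_field_derivative_def]])
  then show "((\<lambda>x. R (f x)) has_derivative (\<lambda>h. (deriv R (f x) *\<^sub>R grad f x) \<bullet> h)) (at x)"
    by simp
qed

lemma grad_add:
  assumes "smooth f" "smooth g"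
  shows "grad (\<lambda>x. f x + g x) x = grad f x + grad g x"
  by (rule has_derivative_imp_grad)
    (use has_derivative_add[OF assms[THEN smooth_has_derivative]] in \<open>simp add: inner_add_left\<close>)

lemma grad_mult:
  assumes "smooth f" "smooth g"
  shows "grad (\<lambda>x. f x * g x) x = f x *\<^sub>R grad g x + g x *\<^sub>R grad f x"
  by (rule has_derivative_imp_grad)
    (use has_derivative_mult[OF assms[THEN smooth_has_derivative]] in \<open>simp add: inner_add_left mult.commute\<close>)

lemma grad_const [simp]: "grad (\<lambda>x. c) x = 0"
  by (rule has_derivative_imp_grad) simp

lemma grad_scale: "smooth f \<Longrightarrow> grad (\<lambda>x. c * f x) x = c *\<^sub>R grad f x"
  by (simp add: grad_mult)

lemma grad_sum:
  "(\<And>i. i \<in> I \<Longrightarrow> smooth (f i)) \<Longrightarrow> grad (\<lambda>x. \<Sum>i\<in>I. c i * f i x) x = (\<Sum>i\<in>I. c i *\<^sub>R grad (f i) x)"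
proof (induction I rule: infinite_finite_induct)
  case (insert i I)
  have "smooth (\<lambda>x. \<Sum>i\<in>I. c i * f i x)"
    by (intro smooth_sum smooth_mult smooth_const) (use insert in auto)
  with insert show ?case by (simp add: grad_add grad_scale smooth_mult)
qed auto

lemma grad_eq_0_outside:
  assumes "x \<notin> closure {x. f x \<noteq> 0}"
  shows "grad f x = 0"
proof (rule has_derivative_imp_grad)
  have "((\<lambda>x. 0) has_derivative (\<lambda>h. 0)) (at x)" by simp
  then have "(f has_derivative (\<lambda>h. 0)) (at x)"
    by (rule has_derivative_transform_within_open[OF _ open_Compl[OF closed_closure[of "{x. f x \<noteq> 0}"]]])
      (use assms closure_subset[of "{x. f x \<noteq> 0}"] in auto)
  then show "(f has_derivative (\<lambda>h. 0 \<bullet> h)) (at x)" by simp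
qed

lemma test_functions_grad_zero_outside: "\<phi> \<in> test_functions \<Omega> \<Longrightarrow> x \<notin> \<Omega> \<Longrightarrow> grad \<phi> x = 0"
  by (rule grad_eq_0_outside) (auto simp: test_functions_iff)

lemma test_functions_smooth: "\<phi> \<in> test_functions \<Omega> \<Longrightarrow> smooth \<phi>"
  by (simp add: test_functions_iff)

lemma continuous_zero_outside_compact_bounded:
  fixes f :: "'a::euclidean_space \<Rightarrow> 'b::real_normed_vector"
  assumes "continuous_on UNIV f" "compact K" "\<And>x. x \<notin> K \<Longrightarrow> f x = 0"
  obtains C where "C \<ge> 0" "\<And>x. norm (f x) \<le> C"
proof -
  have "compact (f ` K)"
    using assms by (intro compact_continuous_image) (auto intro: continuous_on_subset)
  then obtain C where "\<And>x. x \<in> K \<Longrightarrow> norm (f x) \<le> C"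
    by (metis compact_imp_bounded bounded_iff imageI)
  then have "norm (f x) \<le> max C 0" for x
    using assms(3)[of x] by (cases "x \<in> K") (auto simp: max.coboundedI1)
  then show ?thesis by (rule that[rotated]) simp
qed

lemma test_functions_bounded:
  assumes "\<phi> \<in> test_functions \<Omega>"
  obtains C where "C \<ge> 0" "\<And>x. \<bar>\<phi> x\<bar> \<le> C"
proof -
  let ?K = "closure {x. \<phi> x \<noteq> 0}"
  have out: "\<phi> x = 0" if "x \<notin> ?K" for x using that closure_subset[of "{x. \<phi> x \<noteq> 0}"] by auto
  have "continuous_on UNIV \<phi>" "compact ?K"
    using assms by (auto simp: test_functions_iff smooth_continuous)
  from continuous_zero_outside_compact_bounded[OF this out] show ?thesis
    using that by (metis real_norm_def)
qed

lemma test_functions_grad_bounded: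
  assumes "\<phi> \<in> test_functions \<Omega>"
  obtains C where "C \<ge> 0" "\<And>x. norm (grad \<phi> x) \<le> C"
proof -
  have "continuous_on UNIV (grad \<phi>)" "compact (closure {x. \<phi> x \<noteq> 0})"
    using assms by (auto simp: test_functions_iff continuous_grad)
  from continuous_zero_outside_compact_bounded[OF this grad_eq_0_outside] show ?thesis
    using that by metis
qed

lemma smooth_borel_measurable: "smooth f \<Longrightarrow> f \<in> borel_measurable borel"
  and grad_borel_measurable: "smooth f \<Longrightarrow> grad f \<in> borel_measurable borel"
  by (auto intro: borel_measurable_continuous_onI smooth_continuous continuous_grad)

section \<open>Integration by parts for test functions\<close>

lemma borel_measurable_lebesgue_onI:
  "f \<in> borel_measurable borel \<Longrightarrow> f \<in> borel_measurable (lebesgue_on S)"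
  by (intro measurable_restrict_space1 measurable_completion) (simp add: measurable_lborel1)

text \<open>Once the integrand vanishes outside \<open>S\<close> the domain can be forgotten, and on
  \<open>lborel\<close> translation invariance and Fubini's theorem are at hand.\<close>

lemma integral_lebesgue_on_eq_lborel:
  fixes f :: "'a::euclidean_space \<Rightarrow> 'b::euclidean_space"
  assumes "f \<in> borel_measurable borel" "S \<in> sets lebesgue" "\<And>x. x \<notin> S \<Longrightarrow> f x = 0"
  shows "(LINT x|lebesgue_on S. f x) = (LINT x|lborel. f x)"
proof -
  have "(LINT x|lebesgue_on S. f x) = (LINT x|lebesgue. indicator S x *\<^sub>R f x)"
    using assms(2) by (subst integral_restrict_space) auto
  also have "(\<lambda>x. indicator S x *\<^sub>R f x) = f"
    using assms(3) by (auto simp: indicator_def)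
  also have "(LINT x|lebesgue. f x) = (LINT x|lborel. f x)"
    using assms(1) by (intro integral_completion) simp
  finally show ?thesis .
qed

lemma integral_lborel_translate:
  fixes f :: "'a::euclidean_space \<Rightarrow> 'b::euclidean_space"
  assumes "f \<in> borel_measurable borel"
  shows "(LINT x|lborel. f (a + x)) = (LINT x|lborel. f x)"
proof -
  have "(LINT x|lborel. f (a + x)) = (LINT x|distr lborel borel ((+) a). f x)"
    using assms by (subst integral_distr) auto
  then show ?thesis by (simp add: lborel_distr_plus)
qed

lemma smooth_Lipschitz:
  assumes "smooth f" "\<And>x. norm (grad f x) \<le> C"
  shows "\<bar>f y - f x\<bar> \<le> C * norm (y - x)"
proof -
  have "onorm (\<lambda>h. grad f x \<bullet> h) \<le> C" for x
  proof (rule onorm_le)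
    show "norm (grad f x \<bullet> h) \<le> C * norm h" for h
      using Cauchy_Schwarz_ineq2[of "grad f x" h] assms(2)[of x]
      by (smt (verit) mult_right_mono norm_ge_zero real_norm_def)
  qed
  then show ?thesis
    using differentiable_bound[of UNIV f "\<lambda>x h. grad f x \<bullet> h" C y x] smooth_has_derivative[OF assms(1)]
    by simp
qed

lemma integrable_cball_indicator: "integrable lborel (\<lambda>x. C * indicator (cball a R) x :: real)"
  by (intro integrable_mult_right integrable_real_indicator)
    (use emeasure_lborel_cball_finite[of a R] in \<open>auto simp: infinity_ennreal_def\<close>)

lemma bounded_support_integrable:
  fixes f :: "'a::euclidean_space \<Rightarrow> 'b::euclidean_space"
  assumes "f \<in> borel_measurable borel" "\<And>x. norm (f x) \<le> C" "\<And>x. x \<notin> K \<Longrightarrow> f x = 0" "bounded K"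
  shows "integrable lborel f"
proof -
  obtain R where R: "K \<subseteq> cball 0 R" using bounded_subset_ballD[OF assms(4), of 0] ball_subset_cball by blast
  have C: "C \<ge> 0" using assms(2)[of 0] norm_ge_zero[of "f 0"] by linarith
  show ?thesis
  proof (rule Bochner_Integration.integrable_bound)
    show "integrable lborel (\<lambda>x. C * indicator (cball 0 R) x :: real)"
      by (rule integrable_cball_indicator)
    show "AE x in lborel. norm (f x) \<le> norm (C * indicator (cball 0 R) x :: real)"
    proof (rule AE_I2)
      fix x show "norm (f x) \<le> norm (C * indicator (cball 0 R) x :: real)"
        using R C assms(2)[of x] assms(3)[of x] by (cases "x \<in> K") (auto simp: indicator_def)
    qed
  qed (use assms(1) in auto)
qed

text \<open>Translation invariance makes the integral of every difference quotient 0, and dominated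
  convergence passes to the derivative. The Lipschitz bound of \<open>\<phi>\<close> supplies the
  dominating constant.\<close>

lemma integral_partial_derivative_eq_0:
  assumes \<phi>: "\<phi> \<in> test_functions \<Omega>" and i: "i \<in> Basis"
  shows "(LINT x|lborel. grad \<phi> x \<bullet> i) = 0"
proof -
  let ?K = "closure {x. \<phi> x \<noteq> 0}"
  obtain C where C: "C \<ge> 0" "\<And>x. norm (grad \<phi> x) \<le> C" using test_functions_grad_bounded[OF \<phi>] by blast
  have sm: "smooth \<phi>" and K: "bounded ?K"
    using \<phi> by (auto simp: test_functions_iff intro: compact_imp_bounded)
  have out: "\<phi> x = 0" if "x \<notin> ?K" for x using that closure_subset[of "{x. \<phi> x \<noteq> 0}"] by auto
  obtain R where R: "?K \<subseteq> cball 0 R" using bounded_subset_ballD[OF K, of 0] ball_subset_cball by blast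
  have far: "\<phi> y = 0" if "norm y > R" for y
    using out[of y] R that by (meson mem_cball_0 not_less subsetD)
  have meas [measurable]: "\<phi> \<in> borel_measurable borel" by (rule smooth_borel_measurable[OF sm])
  obtain C0 where C0: "\<And>x. \<bar>\<phi> x\<bar> \<le> C0" using test_functions_bounded[OF \<phi>] by blast
  have int: "integrable lborel \<phi>"
    by (rule bounded_support_integrable[OF meas _ out K]) (use C0 in auto)
  \<comment> \<open>Steps of length at most 1 keep all translates supported in the fixed ball of
    radius \<open>R + 1\<close>, which carries the dominating function.\<close>
  define t where "t n = 1 / real (Suc n)" for n
  have t: "t n > 0" "t n \<le> 1" for n by (auto simp: t_def)
  have t0: "t \<longlonglongrightarrow> 0" unfolding t_def by (rule LIMSEQ_inverse_real_of_nat[unfolded inverse_eq_divide])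
  define D where "D n x = (\<phi> (t n *\<^sub>R i + x) - \<phi> x) / t n" for n x
  have "(\<lambda>n. LINT x|lborel. D n x) \<longlonglongrightarrow> (LINT x|lborel. grad \<phi> x \<bullet> i)"
  proof (rule integral_dominated_convergence[where w = "\<lambda>x. C * indicator (cball 0 (R+1)) x"])
    show "(\<lambda>x. grad \<phi> x \<bullet> i) \<in> borel_measurable lborel"
      using grad_borel_measurable[OF sm] by simp
    show "D n \<in> borel_measurable lborel" for n unfolding D_def by measurable
    show "integrable lborel (\<lambda>x. C * indicator (cball 0 (R+1)) x :: real)"
      by (rule integrable_cball_indicator)
    show "AE x in lborel. (\<lambda>n. D n x) \<longlonglongrightarrow> grad \<phi> x \<bullet> i"
    proof (rule AE_I2)
      fix x
      have "((\<lambda>s::real. x + s *\<^sub>R i) has_derivative (\<lambda>s. s *\<^sub>R i)) (at 0)"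
        by (auto intro!: derivative_eq_intros)
      moreover have "(\<phi> has_derivative (\<lambda>h. grad \<phi> x \<bullet> h)) (at (x + 0 *\<^sub>R i))"
        using smooth_has_derivative[OF sm, of x] by simp
      ultimately have "((\<lambda>s. \<phi> (x + s *\<^sub>R i)) has_derivative (\<lambda>s. grad \<phi> x \<bullet> (s *\<^sub>R i))) (at 0)"
        by (rule has_derivative_compose)
      then have "((\<lambda>s. \<phi> (x + s *\<^sub>R i)) has_real_derivative (grad \<phi> x \<bullet> i)) (at 0)"
        unfolding has_field_derivative_def by (rule has_derivative_eq_rhs) (auto simp: mult.commute)
      then have "((\<lambda>h. (\<phi> (x + h *\<^sub>R i) - \<phi> x) / h) \<longlongrightarrow> grad \<phi> x \<bullet> i) (at 0)"
        by (simp add: DERIV_def)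
      moreover have "filterlim t (at 0) sequentially"
        by (rule filterlim_atI[OF t0]) (intro always_eventually allI, metis t(1) less_irrefl)
      ultimately have "(\<lambda>n. (\<phi> (x + t n *\<^sub>R i) - \<phi> x) / t n) \<longlonglongrightarrow> grad \<phi> x \<bullet> i"
        by (rule filterlim_compose)
      then show "(\<lambda>n. D n x) \<longlonglongrightarrow> grad \<phi> x \<bullet> i" by (simp add: D_def add.commute)
    qed
    show "AE x in lborel. norm (D n x) \<le> C * indicator (cball 0 (R+1)) x" for n
    proof (rule AE_I2)
      fix x
      show "norm (D n x) \<le> C * indicator (cball 0 (R+1)) x"
      proof (cases "x \<in> cball 0 (R+1)")
        case True
        have "\<bar>\<phi> (t n *\<^sub>R i + x) - \<phi> x\<bar> \<le> C * t n"
          using smooth_Lipschitz[OF sm C(2), of "t n *\<^sub>R i + x" x] i t(1)[of n] by simp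
        then show ?thesis using True t(1)[of n] by (simp add: D_def field_simps)
      next
        case False
        have "norm (t n *\<^sub>R i) \<le> 1" using i t[of n] by simp
        then have "norm (t n *\<^sub>R i + x) > R"
          using False norm_triangle_ineq4[of "t n *\<^sub>R i + x" "t n *\<^sub>R i"] by simp
        then have "\<phi> (t n *\<^sub>R i + x) = 0" "\<phi> x = 0" using False by (auto intro: far)
        then show ?thesis using False by (simp add: D_def)
      qed
    qed
  qed
  moreover have "(LINT x|lborel. D n x) = 0" for n
  proof -
    have *: "integrable lborel (\<lambda>x. \<phi> (t n *\<^sub>R i + x))"
    proof (rule bounded_support_integrable[where K = "cball 0 (R + norm (t n *\<^sub>R i))"])
      show "\<phi> (t n *\<^sub>R i + x) = 0" if "x \<notin> cball 0 (R + norm (t n *\<^sub>R i))" for x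
      proof -
        have "norm (t n *\<^sub>R i + x) > R"
          using that norm_triangle_ineq4[of "t n *\<^sub>R i + x" "t n *\<^sub>R i"] by (simp del: norm_scaleR)
        then show ?thesis by (rule far)
      qed
    qed (use C0 in auto)
    show ?thesis
      unfolding D_def using integral_lborel_translate[OF meas, of "t n *\<^sub>R i"]
      by (simp add: Bochner_Integration.integral_diff[OF * int])
  qed
  ultimately show ?thesis by (simp add: LIMSEQ_const_iff)
qed

lemma bounded_integrable_lebesgue_on:
  fixes f :: "'a::euclidean_space \<Rightarrow> 'b::euclidean_space"
  assumes "f \<in> borel_measurable borel" "\<And>x. norm (f x) \<le> C" "S \<in> lmeasurable"
  shows "integrable (lebesgue_on S) f"
proof -
  interpret finite_measure "lebesgue_on S" by (rule finite_measure_lebesgue_on[OF assms(3)])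
  show ?thesis
    by (rule integrable_const_bound[where B = C]) (use assms borel_measurable_lebesgue_onI in auto)
qed

lemma test_functions_locally_integrable:
  assumes "\<phi> \<in> test_functions \<Omega>"
  shows "locally_integrable_on \<Omega> \<phi>" "locally_integrable_on \<Omega> (grad \<phi>)"
proof -
  obtain C where C: "\<And>x. \<bar>\<phi> x\<bar> \<le> C" using test_functions_bounded[OF assms] by blast
  obtain D where D: "\<And>x. norm (grad \<phi> x) \<le> D" using test_functions_grad_bounded[OF assms] by blast
  note sm = test_functions_smooth[OF assms]
  show "locally_integrable_on \<Omega> \<phi>" "locally_integrable_on \<Omega> (grad \<phi>)"
    unfolding locally_integrable_on_def
    using bounded_integrable_lebesgue_on[OF smooth_borel_measurable[OF sm], of C]
      bounded_integrable_lebesgue_on[OF grad_borel_measurable[OF sm], of D] C D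
    by (auto intro: lmeasurable_compact)
qed

lemma has_weak_grad_test_function:
  assumes \<phi>: "\<phi> \<in> test_functions \<Omega>" and \<Omega>: "\<Omega> \<in> sets lebesgue"
  shows "has_weak_grad \<Omega> \<phi> (grad \<phi>)"
  unfolding has_weak_grad_def
proof (intro conjI test_functions_locally_integrable[OF \<phi>] ballI)
  fix \<psi> and i :: 'a assume \<psi>: "\<psi> \<in> test_functions \<Omega>" and i: "i \<in> Basis"
  note sm = test_functions_smooth[OF \<phi>] test_functions_smooth[OF \<psi>]
  note [measurable] = smooth_borel_measurable[OF sm(1)] smooth_borel_measurable[OF sm(2)]
    grad_borel_measurable[OF sm(1)] grad_borel_measurable[OF sm(2)]
  obtain C where C: "\<And>x. \<bar>\<phi> x\<bar> \<le> C" "C \<ge> 0" using test_functions_bounded[OF \<phi>] by blast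
  obtain D where D: "\<And>x. norm (grad \<phi> x) \<le> D" "D \<ge> 0" using test_functions_grad_bounded[OF \<phi>] by blast
  obtain C' where C': "\<And>x. \<bar>\<psi> x\<bar> \<le> C'" "C' \<ge> 0" using test_functions_bounded[OF \<psi>] by blast
  obtain D' where D': "\<And>x. norm (grad \<psi> x) \<le> D'" "D' \<ge> 0" using test_functions_grad_bounded[OF \<psi>] by blast
  have b: "\<bar>grad f x \<bullet> i\<bar> \<le> norm (grad f x)" for f :: "'a \<Rightarrow> real" and x
    using i by (rule Basis_le_norm)
  have K: "bounded (closure {x. \<phi> x \<noteq> 0})" using \<phi> by (auto simp: test_functions_iff compact_imp_bounded)
  have out: "\<phi> x = 0" "grad \<phi> x = 0" if "x \<notin> closure {x. \<phi> x \<noteq> 0}" for x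
    using that closure_subset[of "{x. \<phi> x \<noteq> 0}"] grad_eq_0_outside[OF that] by auto
  have bD': "\<bar>grad \<psi> x \<bullet> i\<bar> \<le> D'" for x using b[of \<psi> x] D'(1)[of x] by linarith
  have bD: "\<bar>grad \<phi> x \<bullet> i\<bar> \<le> D" for x using b[of \<phi> x] D(1)[of x] by linarith
  have i1: "integrable lborel (\<lambda>x. \<phi> x * (grad \<psi> x \<bullet> i))"
  proof (rule bounded_support_integrable[OF _ _ _ K, where C = "C * D'"])
    show "norm (\<phi> x * (grad \<psi> x \<bullet> i)) \<le> C * D'" for x
      unfolding real_norm_def abs_mult by (intro mult_mono C bD' abs_ge_zero)
    show "\<phi> x * (grad \<psi> x \<bullet> i) = 0" if "x \<notin> closure {x. \<phi> x \<noteq> 0}" for x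
      using out[OF that] by simp
  qed measurable
  have i2: "integrable lborel (\<lambda>x. (grad \<phi> x \<bullet> i) * \<psi> x)"
  proof (rule bounded_support_integrable[OF _ _ _ K, where C = "D * C'"])
    show "norm ((grad \<phi> x \<bullet> i) * \<psi> x) \<le> D * C'" for x
      unfolding real_norm_def abs_mult by (intro mult_mono C' D bD abs_ge_zero)
    show "(grad \<phi> x \<bullet> i) * \<psi> x = 0" if "x \<notin> closure {x. \<phi> x \<noteq> 0}" for x
      using out[OF that] by simp
  qed measurable
  \<comment> \<open>The product of \<open>\<phi>\<close> and \<open>\<psi>\<close> is again a test
    function, so its partial derivative integrates to 0, and the product rule splits this into the
    two sides.\<close>
  have "0 = (LINT x|lborel. grad (\<lambda>x. \<phi> x * \<psi> x) x \<bullet> i)"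
    using integral_partial_derivative_eq_0[OF test_functions_mult[OF \<phi> sm(2)] i] by simp
  also have "\<dots> = (LINT x|lborel. \<phi> x * (grad \<psi> x \<bullet> i) + (grad \<phi> x \<bullet> i) * \<psi> x)"
    using sm by (simp add: grad_mult inner_add_left mult.commute)
  also have "\<dots> = (LINT x|lborel. \<phi> x * (grad \<psi> x \<bullet> i)) + (LINT x|lborel. (grad \<phi> x \<bullet> i) * \<psi> x)"
    by (rule Bochner_Integration.integral_add[OF i1 i2])
  finally show "(LINT x|lebesgue_on \<Omega>. \<phi> x * (grad \<psi> x \<bullet> i)) = - (LINT x|lebesgue_on \<Omega>. (grad \<phi> x \<bullet> i) * \<psi> x)"
    using test_functions_zero_outside[OF \<phi>] test_functions_zero_outside[OF \<psi>]
    by (subst (1 2) integral_lebesgue_on_eq_lborel) (auto simp: \<Omega>)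
qed

section \<open>Uniqueness of weak gradients\<close>

lemma integrable_lebesgue_on_zero_outside:
  fixes f :: "'a::euclidean_space \<Rightarrow> 'b::euclidean_space"
  assumes "K \<subseteq> \<Omega>" "K \<in> sets lebesgue" "\<Omega> \<in> sets lebesgue" "\<And>x. x \<notin> K \<Longrightarrow> f x = 0"
  shows "integrable (lebesgue_on \<Omega>) f \<longleftrightarrow> integrable (lebesgue_on K) f"
    and "(LINT x|lebesgue_on \<Omega>. f x) = (LINT x|lebesgue_on K. f x)"
proof -
  have eq: "(\<lambda>x. indicator \<Omega> x *\<^sub>R f x) = (\<lambda>x. indicator K x *\<^sub>R f x)"
    using assms(1,4) by (auto simp: indicator_def fun_eq_iff)
  show "integrable (lebesgue_on \<Omega>) f \<longleftrightarrow> integrable (lebesgue_on K) f"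
    using assms(2,3) by (simp add: integrable_restrict_space eq)
  show "(LINT x|lebesgue_on \<Omega>. f x) = (LINT x|lebesgue_on K. f x)"
    using assms(2,3) by (simp add: integral_restrict_space eq)
qed

lemma locally_integrable_mult:
  fixes g :: "'a::euclidean_space \<Rightarrow> real"
  assumes g: "locally_integrable_on \<Omega> g" and \<Omega>: "\<Omega> \<in> sets lebesgue"
    and \<phi>: "\<phi> \<in> borel_measurable borel" "\<And>x. \<bar>\<phi> x\<bar> \<le> C"
    and K: "compact K" "K \<subseteq> \<Omega>" "\<And>x. x \<notin> K \<Longrightarrow> \<phi> x = 0"
  shows "integrable (lebesgue_on \<Omega>) (\<lambda>x. g x * \<phi> x)"
proof -
  have gK: "integrable (lebesgue_on K) g" using g K by (auto simp: locally_integrable_on_def)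
  have "integrable (lebesgue_on K) (\<lambda>x. g x * \<phi> x)"
  proof (rule Bochner_Integration.integrable_bound)
    show "integrable (lebesgue_on K) (\<lambda>x. C * norm (g x))" using gK by simp
    show "(\<lambda>x. g x * \<phi> x) \<in> borel_measurable (lebesgue_on K)"
      using borel_measurable_lebesgue_onI[OF \<phi>(1), of K] gK by simp
    have "norm (g x * \<phi> x) \<le> norm (C * norm (g x))" for x
    proof -
      have "norm (g x * \<phi> x) \<le> C * norm (g x)"
        using mult_left_mono[OF \<phi>(2)[of x], of "\<bar>g x\<bar>"] by (simp add: abs_mult mult.commute)
      then show ?thesis by simp
    qed
    then show "AE x in lebesgue_on K. norm (g x * \<phi> x) \<le> norm (C * norm (g x))" by simp
  qed
  moreover have "K \<in> sets lebesgue" using K(1) by (simp add: compact_imp_closed)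
  ultimately show ?thesis
    using integrable_lebesgue_on_zero_outside(1)[of K \<Omega> "\<lambda>x. g x * \<phi> x"] K \<Omega> by simp
qed

lemma locally_integrable_mult_test_function:
  fixes g :: "'a::euclidean_space \<Rightarrow> real"
  assumes "locally_integrable_on \<Omega> g" "\<Omega> \<in> sets lebesgue" and \<phi>: "\<phi> \<in> test_functions \<Omega>"
  shows "integrable (lebesgue_on \<Omega>) (\<lambda>x. g x * \<phi> x)"
    and "i \<in> Basis \<Longrightarrow> integrable (lebesgue_on \<Omega>) (\<lambda>x. g x * (grad \<phi> x \<bullet> i))"
proof -
  note sm = test_functions_smooth[OF \<phi>]
  have K: "compact (closure {x. \<phi> x \<noteq> 0})" "closure {x. \<phi> x \<noteq> 0} \<subseteq> \<Omega>"
    using \<phi> by (auto simp: test_functions_iff)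
  obtain C where C: "\<And>x. \<bar>\<phi> x\<bar> \<le> C" using test_functions_bounded[OF \<phi>] by blast
  show "integrable (lebesgue_on \<Omega>) (\<lambda>x. g x * \<phi> x)"
  proof (rule locally_integrable_mult[OF assms(1,2) smooth_borel_measurable[OF sm] C K])
    show "\<phi> x = 0" if "x \<notin> closure {x. \<phi> x \<noteq> 0}" for x
      using that closure_subset[of "{x. \<phi> x \<noteq> 0}"] by blast
  qed
  assume i: "i \<in> Basis"
  obtain D where D: "\<And>x. norm (grad \<phi> x) \<le> D" using test_functions_grad_bounded[OF \<phi>] by blast
  show "integrable (lebesgue_on \<Omega>) (\<lambda>x. g x * (grad \<phi> x \<bullet> i))"
  proof (rule locally_integrable_mult[OF assms(1,2) _ _ K])
    show "(\<lambda>x. grad \<phi> x \<bullet> i) \<in> borel_measurable borel"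
      using grad_borel_measurable[OF sm] by simp
    show "\<bar>grad \<phi> x \<bullet> i\<bar> \<le> D" for x
      using Basis_le_norm[OF i, of "grad \<phi> x"] D[of x] by linarith
    show "grad \<phi> x \<bullet> i = 0" if "x \<notin> closure {x. \<phi> x \<noteq> 0}" for x
      using grad_eq_0_outside[OF that] by simp
  qed
qed

lemma locally_integrable_on_component:
  "locally_integrable_on \<Omega> g \<Longrightarrow> locally_integrable_on \<Omega> (\<lambda>x. g x \<bullet> i)"
  by (simp add: locally_integrable_on_def)

lemma locally_integrable_on_diff:
  "locally_integrable_on \<Omega> f \<Longrightarrow> locally_integrable_on \<Omega> g \<Longrightarrow> locally_integrable_on \<Omega> (\<lambda>x. f x - g x)"
  by (simp add: locally_integrable_on_def)

text \<open>With \<open>P\<close> a product of flat functions, positive exactly on the box, the functions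
  \<open>1 - exp (- n P)\<close> increase to the indicator of the box.\<close>

lemma box_bump_functions:
  fixes a b :: "'a::euclidean_space"
  assumes ab: "\<And>i. i \<in> Basis \<Longrightarrow> a \<bullet> i < b \<bullet> i" and sub: "cbox a b \<subseteq> \<Omega>"
  obtains \<phi> where "\<And>n::nat. \<phi> n \<in> test_functions \<Omega>" "\<And>n x. \<bar>\<phi> n x\<bar> \<le> 1"
    "\<And>n x. x \<notin> box a b \<Longrightarrow> \<phi> n x = 0" "\<And>x. (\<lambda>n. \<phi> n x) \<longlonglongrightarrow> indicator (box a b) x"
proof -
  define P where "P x = (\<Prod>i\<in>Basis. flat ((x \<bullet> i - a \<bullet> i) * (b \<bullet> i - x \<bullet> i)))" for x
  have pos: "P x \<ge> 0" for x unfolding P_def by (intro prod_nonneg flat_nonneg)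
  have P0: "P x = 0 \<longleftrightarrow> x \<notin> box a b" for x
  proof -
    have "(x \<bullet> i - a \<bullet> i) * (b \<bullet> i - x \<bullet> i) \<le> 0 \<longleftrightarrow> \<not> (a \<bullet> i < x \<bullet> i \<and> x \<bullet> i < b \<bullet> i)" if "i \<in> Basis" for i
      using ab[OF that] by (auto simp: mult_le_0_iff)
    then show ?thesis by (auto simp: P_def prod_zero_iff flat_eq_0_iff mem_box)
  qed
  have smP: "smooth P"
    unfolding P_def by (intro smooth_prod smooth_compose[OF smooth_flat] smooth_mult smooth_diff smooth_inner smooth_const)
  define \<phi> where "\<phi> n x = 1 - exp (- (real n * P x))" for n x
  have out: "\<phi> n x = 0" if "x \<notin> box a b" for n x using that P0[of x] by (simp add: \<phi>_def)
  have "smooth (\<phi> n)" for n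
    unfolding \<phi>_def by (intro smooth_diff smooth_compose[OF smooth_exp] smooth_minus smooth_mult smooth_const smP)
  moreover have sub': "closure {x. \<phi> n x \<noteq> 0} \<subseteq> cbox a b" for n
    by (rule closure_minimal) (use out box_subset_cbox[of a b] in \<open>auto simp: closed_cbox subset_iff\<close>)
  moreover have "compact (closure {x. \<phi> n x \<noteq> 0})" for n
    using compact_Int_closed[OF compact_cbox closed_closure, of a b "{x. \<phi> n x \<noteq> 0}"] sub'[of n]
    by (simp add: Int_absorb1)
  ultimately have "\<phi> n \<in> test_functions \<Omega>" for n
    using sub by (force simp: test_functions_iff)
  moreover have "\<bar>\<phi> n x\<bar> \<le> 1" for n x
  proof -
    have "real n * P x \<ge> 0" using pos[of x] by simp
    then have "exp (- (real n * P x)) \<le> 1" by simp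
    then show ?thesis using exp_gt_zero[of "- (real n * P x)"] unfolding \<phi>_def by linarith
  qed
  moreover have "(\<lambda>n. \<phi> n x) \<longlonglongrightarrow> indicator (box a b) x" for x
  proof (cases "x \<in> box a b")
    case True
    then have "P x > 0" using pos[of x] P0[of x] by linarith
    have "(\<lambda>n. exp (- P x) ^ n) \<longlonglongrightarrow> 0"
      by (rule LIMSEQ_realpow_zero) (use \<open>P x > 0\<close> in auto)
    from tendsto_diff[OF tendsto_const[of 1] this]
    have "(\<lambda>n. 1 - exp (- P x) ^ n) \<longlonglongrightarrow> 1 - 0" .
    moreover have "exp (- P x) ^ n = exp (- (real n * P x))" for n
      by (simp add: exp_of_nat_mult[symmetric])
    ultimately show ?thesis using True by (simp add: \<phi>_def)
  next
    case False
    then show ?thesis using out by simp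
  qed
  ultimately show ?thesis using out that by blast
qed

text \<open>The bump functions converge to the indicator of the open box, and \<open>|g|\<close>
  dominates. The boundary of the box is a null set, so the closed box gives the same
  integral.\<close>

lemma integral_box_eq_0_if_test_orthogonal:
  fixes g :: "'a::euclidean_space \<Rightarrow> real"
  assumes g: "locally_integrable_on \<Omega> g" and \<Omega>: "\<Omega> \<in> sets lebesgue"
    and orth: "\<And>\<phi>. \<phi> \<in> test_functions \<Omega> \<Longrightarrow> (LINT x|lebesgue_on \<Omega>. g x * \<phi> x) = 0"
    and ab: "\<And>i. i \<in> Basis \<Longrightarrow> a \<bullet> i < b \<bullet> i" and sub: "cbox a b \<subseteq> \<Omega>"
  shows "(LINT x|lebesgue_on (cbox a b). g x) = 0"
proof -
  let ?M = "lebesgue_on (cbox a b)"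
  obtain \<phi> where \<phi>: "\<And>n::nat. \<phi> n \<in> test_functions \<Omega>" "\<And>n x. \<bar>\<phi> n x\<bar> \<le> 1"
    "\<And>n x. x \<notin> box a b \<Longrightarrow> \<phi> n x = 0" "\<And>x. (\<lambda>n. \<phi> n x) \<longlonglongrightarrow> indicator (box a b) x"
    using box_bump_functions[OF ab sub] by metis
  have gi: "integrable ?M g" using g sub by (auto simp: locally_integrable_on_def)
  have meas: "\<phi> n \<in> borel_measurable ?M" for n
    by (intro borel_measurable_lebesgue_onI smooth_borel_measurable test_functions_smooth[OF \<phi>(1)])
  have ind: "(indicator (box a b) :: 'a \<Rightarrow> real) \<in> borel_measurable ?M"
    by (rule borel_measurable_lebesgue_onI) simp
  have "(\<lambda>n. LINT x|?M. g x * \<phi> n x) \<longlonglongrightarrow> (LINT x|?M. g x * indicator (box a b) x)"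
  proof (rule integral_dominated_convergence[where w = "\<lambda>x. \<bar>g x\<bar>"])
    show "(\<lambda>x. g x * indicator (box a b) x) \<in> borel_measurable ?M" using gi ind by simp
    show "(\<lambda>x. g x * \<phi> n x) \<in> borel_measurable ?M" for n using gi meas by simp
    show "integrable ?M (\<lambda>x. \<bar>g x\<bar>)" using gi by simp
    show "AE x in ?M. (\<lambda>n. g x * \<phi> n x) \<longlonglongrightarrow> g x * indicator (box a b) x"
      by (intro AE_I2 tendsto_intros \<phi>(4))
    show "AE x in ?M. norm (g x * \<phi> n x) \<le> \<bar>g x\<bar>" for n
      by (intro AE_I2) (use \<phi>(2) in \<open>simp add: abs_mult mult_left_le\<close>)
  qed
  moreover have "(LINT x|?M. g x * \<phi> n x) = 0" for n
  proof -
    have z: "g x * \<phi> n x = 0" if "x \<notin> cbox a b" for x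
      using that box_subset_cbox[of a b] \<phi>(3)[of x n] by auto
    show ?thesis
      using integrable_lebesgue_on_zero_outside(2)[OF sub _ \<Omega> z] orth[OF \<phi>(1), of n] by simp
  qed
  ultimately have "(LINT x|?M. g x * indicator (box a b) x) = 0" by (simp add: LIMSEQ_const_iff)
  moreover have "(LINT x|?M. g x * indicator (box a b) x) = (LINT x|?M. g x)"
  proof (rule integral_cong_AE)
    have "negligible (cbox a b - box a b)"
      by (rule negligible_frontier_interval)
    then have "AE x in ?M. x \<notin> cbox a b - box a b"
      by (intro AE_I[where N = "cbox a b - box a b"])
        (auto simp: negligible_iff_null_sets null_sets_restrict_space null_sets_def emeasure_restrict_space
            sets_restrict_space_iff)
    moreover have "AE x in ?M. x \<in> cbox a b" using AE_space[of ?M] by simp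
    ultimately show "AE x in ?M. g x * indicator (box a b) x = g x"
      by eventually_elim (auto simp: indicator_def)
  qed (use gi ind in auto)
  ultimately show ?thesis by simp
qed

lemma AE_lebesgue_on_iff_negligible:
  assumes "S \<in> sets lebesgue"
  shows "(AE x in lebesgue_on S. P x) \<longleftrightarrow> negligible {x \<in> S. \<not> P x}"
proof -
  have "(AE x in lebesgue_on S. P x) \<longleftrightarrow> (AE x in lebesgue. x \<in> S \<longrightarrow> P x)"
    using assms by (simp add: AE_restrict_space_iff)
  also have "\<dots> \<longleftrightarrow> (\<exists>N. negligible N \<and> {x \<in> S. \<not> P x} \<subseteq> N)"
    by (auto simp: eventually_ae_filter negligible_iff_null_sets)
  also have "\<dots> \<longleftrightarrow> negligible {x \<in> S. \<not> P x}"
    using negligible_subset by blast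
  finally show ?thesis .
qed

text \<open>By Lebesgue differentiation, off a null set \<open>N\<close> the averages over cubes
  with lower corner \<open>x\<close> converge to \<open>f x\<close>; at a point of the open set
  \<open>U\<close> all sufficiently small cubes have average 0.\<close>

lemma integral_cube_eq_0_imp_zero:
  fixes f :: "'a::euclidean_space \<Rightarrow> real"
  assumes "integrable lebesgue f"
    and "\<And>x h. h > 0 \<Longrightarrow> cbox x (x + h *\<^sub>R One) \<subseteq> U \<Longrightarrow> integral (cbox x (x + h *\<^sub>R One)) f = 0"
    and U: "open U"
  shows "negligible {x \<in> U. f x \<noteq> 0}"
proof -
  have "f integrable_on UNIV"
    using integrable_on_lebesgue[OF assms(1)] .
  then have "f integrable_on cbox a b" for a b
    by (rule integrable_on_subcbox) simp
  then obtain N where N: "negligible N" "\<And>x e. \<lbrakk>x \<notin> N; 0 < e\<rbrakk> \<Longrightarrow>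
      \<exists>d>0. \<forall>h. 0 < h \<and> h < d \<longrightarrow> norm (integral (cbox x (x + h *\<^sub>R One)) f /\<^sub>R h ^ DIM('a) - f x) < e"
    using integrable_ccontinuous_explicit[of f] by metis
  have "x \<in> N" if xU: "x \<in> U" and fx: "f x \<noteq> 0" for x
  proof (rule ccontr)
    assume "x \<notin> N"
    then obtain d where d: "d > 0" "\<And>h. 0 < h \<Longrightarrow> h < d \<Longrightarrow>
        norm (integral (cbox x (x + h *\<^sub>R One)) f /\<^sub>R h ^ DIM('a) - f x) < \<bar>f x\<bar>"
      using N(2)[of x "\<bar>f x\<bar>"] fx by auto
    obtain r where r: "r > 0" "ball x r \<subseteq> U"
      using U \<open>x \<in> U\<close> by (auto simp: open_contains_ball)
    \<comment> \<open>Comparison with the sum norm puts the cube of side \<open>h\<close> within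
      distance \<open>h * DIM('a)\<close> of \<open>x\<close>; halving both admissible sides makes
      the inequalities strict.\<close>
    define h where "h = min (d/2) (r / (2 * DIM('a)))"
    have h: "0 < h" "h < d" "h * DIM('a) < r"
    proof -
      show "0 < h" "h < d" using d r by (auto simp: h_def)
      have "h \<le> r / (2 * DIM('a))" by (simp add: h_def)
      then have "h * (2 * DIM('a)) \<le> r" by (subst (asm) pos_le_divide_eq) auto
      then show "h * DIM('a) < r" using \<open>0 < h\<close> \<open>r > 0\<close> by simp
    qed
    have "cbox x (x + h *\<^sub>R One) \<subseteq> ball x r"
    proof
      fix y assume y: "y \<in> cbox x (x + h *\<^sub>R One)"
      have "norm (y - x) \<le> (\<Sum>i\<in>Basis. \<bar>(y - x) \<bullet> i\<bar>)" by (rule norm_le_l1)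
      also have "\<dots> \<le> (\<Sum>i\<in>(Basis::'a set). h)"
        by (rule sum_mono) (use y in \<open>auto simp: mem_box inner_diff_left inner_add_left\<close>)
      also have "\<dots> < r" using h(3) by (simp add: mult.commute)
      finally show "y \<in> ball x r" by (simp add: dist_norm norm_minus_commute)
    qed
    then have "integral (cbox x (x + h *\<^sub>R One)) f = 0"
      using assms(2)[of h x] h r by auto
    then show False using d(2)[OF h(1,2)] by simp
  qed
  then show ?thesis by (intro negligible_subset[OF N(1)]) auto
qed

text \<open>The fundamental lemma of the calculus of variations. \<open>\<Omega>\<close> is a
  countable union of closed boxes, so it suffices to treat one box, on which local integrability is
  integrability.\<close>

lemma AE_eq_0_if_test_orthogonal:
  fixes g :: "'a::euclidean_space \<Rightarrow> real"
  assumes g: "locally_integrable_on \<Omega> g" and \<Omega>: "open \<Omega>"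
    and orth: "\<And>\<phi>. \<phi> \<in> test_functions \<Omega> \<Longrightarrow> (LINT x|lebesgue_on \<Omega>. g x * \<phi> x) = 0"
  shows "AE x in lebesgue_on \<Omega>. g x = 0"
proof -
  have \<Omega>': "\<Omega> \<in> sets lebesgue" using \<Omega> by simp
  obtain \<D> where \<D>: "countable \<D>" "\<D> \<subseteq> Pow \<Omega>" "\<And>X. X \<in> \<D> \<Longrightarrow> \<exists>a b. X = cbox a b" "\<Union>\<D> = \<Omega>"
    using open_countable_Union_open_cbox[OF \<Omega>] by metis
  have "negligible {x \<in> X. g x \<noteq> 0}" if XD: "X \<in> \<D>" for X
  proof -
    obtain c d where X: "X = cbox c d" "cbox c d \<subseteq> \<Omega>" using \<D>(2) \<D>(3)[OF XD] XD by blast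
    \<comment> \<open>Cutting \<open>g\<close> off outside the box gives a function integrable on
      the whole space, as the differentiation argument requires; it agrees with \<open>g\<close> on
      every cube inside the box.\<close>
    define f where "f x = indicator (cbox c d) x *\<^sub>R g x" for x
    have "integrable (lebesgue_on (cbox c d)) g" using g X by (auto simp: locally_integrable_on_def)
    then have f: "integrable lebesgue f" unfolding f_def by (simp add: integrable_restrict_space)
    have "negligible {x \<in> box c d. f x \<noteq> 0}"
    proof (rule integral_cube_eq_0_imp_zero[OF f _ open_box])
      fix x :: 'a and h :: real assume h: "h > 0" and sub: "cbox x (x + h *\<^sub>R One) \<subseteq> box c d"
      let ?Q = "cbox x (x + h *\<^sub>R One)"
      have sub': "?Q \<subseteq> cbox c d" using sub box_subset_cbox by blast
      have "integrable (lebesgue_on ?Q) g" using g X sub' by (auto simp: locally_integrable_on_def)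
      then have "integral ?Q g = (LINT y|lebesgue_on ?Q. g y)" by (simp add: lebesgue_integral_eq_integral)
      also have "\<dots> = 0"
        by (rule integral_box_eq_0_if_test_orthogonal[OF g \<Omega>' orth]) (use h X sub' in \<open>auto simp: inner_add_left\<close>)
      also have "integral ?Q g = integral ?Q f"
        by (rule integral_cong) (use sub' in \<open>auto simp: f_def\<close>)
      finally show "integral ?Q f = 0" .
    qed
    then have "negligible ({x \<in> box c d. f x \<noteq> 0} \<union> (cbox c d - box c d))"
      by (intro negligible_Un negligible_frontier_interval)
    then show ?thesis
      by (rule negligible_subset) (auto simp: f_def X(1))
  qed
  then have "negligible (\<Union>X\<in>\<D>. {x \<in> X. g x \<noteq> 0})"
    using \<D>(1) by (intro negligible_countable_Union) auto
  also have "(\<Union>X\<in>\<D>. {x \<in> X. g x \<noteq> 0}) = {x \<in> \<Omega>. g x \<noteq> 0}" using \<D>(4) by auto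
  finally show ?thesis using \<Omega>' by (simp add: AE_lebesgue_on_iff_negligible)
qed

lemma has_weak_grad_diff:
  assumes u: "has_weak_grad \<Omega> u g" and v: "has_weak_grad \<Omega> v h" and \<Omega>: "\<Omega> \<in> sets lebesgue"
  shows "has_weak_grad \<Omega> (\<lambda>x. u x - v x) (\<lambda>x. g x - h x)"
  unfolding has_weak_grad_def
proof (intro conjI ballI)
  have li: "locally_integrable_on \<Omega> u" "locally_integrable_on \<Omega> g"
    "locally_integrable_on \<Omega> v" "locally_integrable_on \<Omega> h"
    using u v by (auto simp: has_weak_grad_def)
  show "locally_integrable_on \<Omega> (\<lambda>x. u x - v x)" "locally_integrable_on \<Omega> (\<lambda>x. g x - h x)"
    using li by (auto intro: locally_integrable_on_diff)
  fix \<phi> and i :: 'a assume \<phi>: "\<phi> \<in> test_functions \<Omega>" and i: "i \<in> Basis"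
  note int = locally_integrable_mult_test_function[OF _ \<Omega> \<phi>]
  have "(LINT x|lebesgue_on \<Omega>. (u x - v x) * (grad \<phi> x \<bullet> i)) =
      (LINT x|lebesgue_on \<Omega>. u x * (grad \<phi> x \<bullet> i)) - (LINT x|lebesgue_on \<Omega>. v x * (grad \<phi> x \<bullet> i))"
    unfolding left_diff_distrib
    by (rule Bochner_Integration.integral_diff[OF int(2)[OF li(1) i] int(2)[OF li(3) i]])
  also have "\<dots> = - ((LINT x|lebesgue_on \<Omega>. (g x \<bullet> i) * \<phi> x) - (LINT x|lebesgue_on \<Omega>. (h x \<bullet> i) * \<phi> x))"
    using u v \<phi> i by (simp add: has_weak_grad_def)
  also have "\<dots> = - (LINT x|lebesgue_on \<Omega>. ((g x - h x) \<bullet> i) * \<phi> x)"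
    unfolding inner_diff_left left_diff_distrib
    by (subst Bochner_Integration.integral_diff[OF int(1)[OF locally_integrable_on_component[OF li(2)]]
          int(1)[OF locally_integrable_on_component[OF li(4)]]]) simp
  finally show "(LINT x|lebesgue_on \<Omega>. (u x - v x) * (grad \<phi> x \<bullet> i)) =
     - (LINT x|lebesgue_on \<Omega>. ((g x - h x) \<bullet> i) * \<phi> x)" .
qed

text \<open>The difference \<open>g - h\<close> is a weak gradient of the zero function, so each of
  its components is orthogonal to all test functions.\<close>

lemma has_weak_grad_unique:
  assumes u: "has_weak_grad \<Omega> u g" "has_weak_grad \<Omega> u h" and \<Omega>: "open \<Omega>"
  shows "AE x in lebesgue_on \<Omega>. g x = h x"
proof -
  have \<Omega>': "\<Omega> \<in> sets lebesgue" using \<Omega> by simp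
  have d: "has_weak_grad \<Omega> (\<lambda>x. u x - u x) (\<lambda>x. g x - h x)"
    by (rule has_weak_grad_diff[OF u \<Omega>'])
  have "AE x in lebesgue_on \<Omega>. \<forall>i\<in>Basis. (g x - h x) \<bullet> i = 0"
  proof (rule AE_finite_allI)
    fix i :: 'a assume i: "i \<in> Basis"
    show "AE x in lebesgue_on \<Omega>. (g x - h x) \<bullet> i = 0"
    proof (rule AE_eq_0_if_test_orthogonal[OF _ \<Omega>])
      show "locally_integrable_on \<Omega> (\<lambda>x. (g x - h x) \<bullet> i)"
        using d by (intro locally_integrable_on_component) (simp add: has_weak_grad_def)
      show "(LINT x|lebesgue_on \<Omega>. (g x - h x) \<bullet> i * \<phi> x) = 0" if "\<phi> \<in> test_functions \<Omega>" for \<phi>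
        using d that i by (simp add: has_weak_grad_def)
    qed
  qed simp
  then show ?thesis
    by eventually_elim (auto intro: euclidean_eqI simp: inner_diff_left)
qed

section \<open>Convergence in \<open>L\<^sup>p\<close> and strongly convergent convex combinations\<close>

text \<open>The space \<open>L^p\<close> over an arbitrary measure; \<open>Lp p \<Omega>\<close> is
  the case \<open>M = lebesgue_on \<Omega>\<close>. With the measure abstract, the convergence
  results are independent of the geometry of \<open>\<Omega>\<close>.\<close>

definition power_integrable :: "'a measure \<Rightarrow> real \<Rightarrow> ('a \<Rightarrow> 'b::euclidean_space) \<Rightarrow> bool" where
  "power_integrable M p f \<longleftrightarrow> f \<in> borel_measurable M \<and> integrable M (\<lambda>x. norm (f x) powr p)"

lemma power_integrable_2:
  "power_integrable M 2 f \<longleftrightarrow> f \<in> borel_measurable M \<and> integrable M (\<lambda>x. (norm (f x))\<^sup>2)"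
  by (simp add: power_integrable_def powr_numeral)

text \<open>A crude substitute for Minkowski's inequality, from
  \<open>a + b \<le> 2 * max a b\<close>. The factor \<open>2 powr p\<close> is harmless because
  only membership in \<open>L^p\<close> and convergence to 0 are derived from it.\<close>

lemma powr_add_le:
  fixes a b p :: real
  assumes "a \<ge> 0" "b \<ge> 0" "p > 0"
  shows "(a + b) powr p \<le> 2 powr p * (a powr p + b powr p)"
proof -
  have "(a + b) powr p \<le> (2 * max a b) powr p"
    using assms by (intro powr_mono2) auto
  also have "\<dots> = 2 powr p * max a b powr p" using assms by (simp add: powr_mult)
  also have "\<dots> \<le> 2 powr p * (a powr p + b powr p)"
    by (intro mult_left_mono) (auto simp: max_def)
  finally show ?thesis .
qed

lemma norm_add_powr_le:
  fixes a b :: "'a::real_normed_vector"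
  assumes "p > 0"
  shows "norm (a + b) powr p \<le> 2 powr p * (norm a powr p + norm b powr p)"
proof -
  have "norm (a + b) powr p \<le> (norm a + norm b) powr p"
    using assms by (intro powr_mono2 norm_triangle_ineq) auto
  also have "\<dots> \<le> 2 powr p * (norm a powr p + norm b powr p)"
    using assms by (intro powr_add_le) auto
  finally show ?thesis .
qed

lemma power_integrable_bound:
  assumes "power_integrable M p f" "g \<in> borel_measurable M" "p > 0"
    "AE x in M. norm (g x) \<le> C * norm (f x)"
  shows "power_integrable M p g"
  unfolding power_integrable_def
proof
  have "integrable M (\<lambda>x. \<bar>C\<bar> powr p * norm (f x) powr p)"
    using assms(1) by (auto simp: power_integrable_def)
  then show "integrable M (\<lambda>x. norm (g x) powr p)"
  proof (rule Bochner_Integration.integrable_bound)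
    show "AE x in M. norm (norm (g x) powr p) \<le> norm (\<bar>C\<bar> powr p * norm (f x) powr p)"
      using assms(4)
    proof eventually_elim
      case (elim x)
      have "norm (g x) \<le> \<bar>C\<bar> * norm (f x)"
        using elim mult_right_mono[OF abs_ge_self[of C] norm_ge_zero[of "f x"]] by linarith
      then have "norm (g x) powr p \<le> (\<bar>C\<bar> * norm (f x)) powr p"
        using assms(3) by (intro powr_mono2) auto
      then show ?case by (simp add: powr_mult)
    qed
  qed (use assms(2) in measurable)
qed (fact assms(2))

lemma power_integrable_add:
  assumes "power_integrable M p f" "power_integrable M p g" "p > 0"
  shows "power_integrable M p (\<lambda>x. f x + g x)"
  unfolding power_integrable_def
proof
  have [measurable]: "f \<in> borel_measurable M" "g \<in> borel_measurable M"
    using assms by (auto simp: power_integrable_def)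
  show "(\<lambda>x. f x + g x) \<in> borel_measurable M" by measurable
  have "integrable M (\<lambda>x. 2 powr p * (norm (f x) powr p + norm (g x) powr p))"
    using assms by (auto simp: power_integrable_def)
  then show "integrable M (\<lambda>x. norm (f x + g x) powr p)"
    by (rule Bochner_Integration.integrable_bound) (use norm_add_powr_le[OF assms(3)] in \<open>auto intro!: AE_I2\<close>)
qed

lemma power_integrable_scale:
  "power_integrable M p f \<Longrightarrow> p > 0 \<Longrightarrow> power_integrable M p (\<lambda>x. c *\<^sub>R f x)"
  by (rule power_integrable_bound[where f = f and C = "\<bar>c\<bar>"]) (auto simp: power_integrable_def)

lemma power_integrable_diff:
  assumes "power_integrable M p f" "power_integrable M p g" "p > 0"
  shows "power_integrable M p (\<lambda>x. f x - g x)"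
  using power_integrable_add[OF assms(1) power_integrable_scale[OF assms(2,3), of "-1"] assms(3)] by simp

lemma power_integrable_sum:
  assumes "\<And>i. i \<in> I \<Longrightarrow> power_integrable M p (f i)" "p > 0"
  shows "power_integrable M p (\<lambda>x. \<Sum>i\<in>I. f i x)"
  using assms(1)
proof (induction I rule: infinite_finite_induct)
  case (insert i I)
  then show ?case by (simp add: power_integrable_add assms(2))
qed (simp_all add: power_integrable_def)

section \<open>Dominated subsequences and completeness of \<open>L^2\<close>\<close>

lemma strict_mono_above:
  obtains r :: "nat \<Rightarrow> nat" where "strict_mono r" "\<And>k. N k \<le> r k"
proof
  define r where "r k = (\<Sum>i\<le>k. Suc (N i))" for k
  show "strict_mono r" by (rule strict_mono_Suc_iff[THEN iffD2]) (simp add: r_def)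
  show "N k \<le> r k" for k
    using member_le_sum[of k "{..k}" "\<lambda>i. Suc (N i)"] by (simp add: r_def)
qed

lemma nonneg_tendsto_0_subseq:
  fixes a e :: "nat \<Rightarrow> real"
  assumes "a \<longlonglongrightarrow> 0" "\<And>k. e k > 0"
  obtains r :: "nat \<Rightarrow> nat" where "strict_mono r" "\<And>k n. n \<ge> r k \<Longrightarrow> a n < e k"
proof -
  have "\<exists>N. \<forall>n\<ge>N. a n < e k" for k
    using order_tendstoD(2)[OF assms(1) assms(2)] by (simp add: eventually_sequentially)
  then obtain N where N: "\<And>k n. n \<ge> N k \<Longrightarrow> a n < e k" by metis
  obtain r :: "nat \<Rightarrow> nat" where "strict_mono r" "\<And>k. N k \<le> r k" using strict_mono_above by metis
  with N that show ?thesis using order_trans by metis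
qed

text \<open>Exchanging sum and integral, allowed for nonnegative terms, shows that the pointwise sum
  has a finite integral and is therefore finite almost everywhere.\<close>

lemma summable_integrals_imp_AE_summable:
  fixes f :: "nat \<Rightarrow> 'a \<Rightarrow> real"
  assumes int: "\<And>i. integrable M (f i)" and nn: "\<And>i x. f i x \<ge> 0" and sm: "summable (\<lambda>i. LINT x|M. f i x)"
  shows "AE x in M. summable (\<lambda>i. f i x)" "integrable M (\<lambda>x. \<Sum>i. f i x)"
proof -
  have "(\<integral>\<^sup>+x. (\<Sum>i. ennreal (f i x)) \<partial>M) = (\<Sum>i. \<integral>\<^sup>+x. ennreal (f i x) \<partial>M)"
    using int by (intro nn_integral_suminf) auto
  also have "\<dots> = (\<Sum>i. ennreal (LINT x|M. f i x))"
    using int nn by (simp add: nn_integral_eq_integral)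
  also have "\<dots> \<noteq> \<infinity>"
    using sm nn by (simp add: suminf_ennreal_eq[OF _ summable_sums])
  finally have "AE x in M. (\<Sum>i. ennreal (f i x)) \<noteq> \<infinity>"
    using int by (intro nn_integral_PInf_AE) auto
  then show A: "AE x in M. summable (\<lambda>i. f i x)"
    by eventually_elim (use nn in \<open>auto intro!: summable_suminf_not_top\<close>)
  show "integrable M (\<lambda>x. \<Sum>i. f i x)"
    using int nn A sm by (intro integrable_suminf) auto
qed

text \<open>A partial converse of dominated convergence. Along a subsequence whose integrals stay
  below \<open>(1/2)^k\<close> the error powers are summable almost everywhere: the terms tend to 0,
  and their sum \<open>w\<close> dominates each of them.\<close>

lemma power_conv_imp_dominated_subseq:
  fixes f :: "nat \<Rightarrow> 'a \<Rightarrow> 'b::euclidean_space"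
  assumes f: "\<And>n. power_integrable M p (f n)" and g: "power_integrable M p g" and p: "p > 0"
    and lim: "(\<lambda>n. LINT x|M. norm (f n x - g x) powr p) \<longlonglongrightarrow> 0"
  obtains r :: "nat \<Rightarrow> nat" and w :: "'a \<Rightarrow> real"
  where "strict_mono r" "integrable M w" "AE x in M. (\<lambda>k. f (r k) x) \<longlonglongrightarrow> g x"
    "AE x in M. \<forall>k. norm (f (r k) x - g x) powr p \<le> w x"
proof -
  obtain r :: "nat \<Rightarrow> nat" where r: "strict_mono r"
    "\<And>k n. n \<ge> r k \<Longrightarrow> (LINT x|M. norm (f n x - g x) powr p) < (1/2)^k"
    by (rule nonneg_tendsto_0_subseq[OF lim, of "\<lambda>k. (1/2)^k"]) auto
  let ?d = "\<lambda>k x. norm (f (r k) x - g x) powr p"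
  have int: "integrable M (?d k)" for k
    using power_integrable_diff[OF f g p] by (simp add: power_integrable_def)
  have "summable (\<lambda>k. LINT x|M. ?d k x)"
    by (rule summable_comparison_test[OF _ summable_geometric[of "1/2::real"]])
      (use r(2)[OF order_refl] in \<open>auto simp: less_imp_le\<close>)
  note S = summable_integrals_imp_AE_summable[OF int powr_ge_zero this]
  have "AE x in M. (\<lambda>k. f (r k) x) \<longlonglongrightarrow> g x"
    using S(1)
  proof eventually_elim
    case (elim x)
    then have "(\<lambda>k. norm (f (r k) x - g x) powr p) \<longlonglongrightarrow> 0" by (simp add: summable_LIMSEQ_zero)
    then have "(\<lambda>k. (norm (f (r k) x - g x) powr p) powr (1/p)) \<longlonglongrightarrow> 0 powr (1/p)"
      by (rule tendsto_powr') (use p in auto)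
    then have "(\<lambda>k. norm (f (r k) x - g x)) \<longlonglongrightarrow> 0"
      using p by (simp add: powr_powr)
    then show ?case by (simp add: tendsto_norm_zero_iff LIM_zero_iff)
  qed
  moreover have "AE x in M. \<forall>k. ?d k x \<le> (\<Sum>k. ?d k x)"
    using S(1)
  proof eventually_elim
    case (elim x)
    then have "sum (\<lambda>k. ?d k x) {k} \<le> (\<Sum>k. ?d k x)" for k
      by (intro sum_le_suminf) auto
    then show ?case by simp
  qed
  ultimately show ?thesis using that[OF r(1) S(2)] by auto
qed

lemma power_dominated_convergence:
  fixes f :: "nat \<Rightarrow> 'a \<Rightarrow> 'b::euclidean_space"
  assumes "\<And>n. f n \<in> borel_measurable M" "g \<in> borel_measurable M" "p > 0"
    and "AE x in M. (\<lambda>n. f n x) \<longlonglongrightarrow> g x"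
    and "integrable M w" "\<And>n. AE x in M. norm (f n x - g x) powr p \<le> w x"
  shows "(\<lambda>n. LINT x|M. norm (f n x - g x) powr p) \<longlonglongrightarrow> 0"
proof -
  have "(\<lambda>n. LINT x|M. norm (f n x - g x) powr p) \<longlonglongrightarrow> (LINT x|M. 0)"
  proof (rule integral_dominated_convergence[where w = w])
    show "AE x in M. (\<lambda>n. norm (f n x - g x) powr p) \<longlonglongrightarrow> 0"
      using assms(4)
    proof eventually_elim
      case (elim x)
      then have "(\<lambda>n. norm (f n x - g x)) \<longlonglongrightarrow> 0" by (simp add: LIM_zero tendsto_norm_zero)
      then have "(\<lambda>n. norm (f n x - g x) powr p) \<longlonglongrightarrow> 0 powr p"
        by (rule tendsto_powr') (use assms(3) in auto)
      then show ?case by simp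
    qed
    show "(\<lambda>x. norm (f n x - g x) powr p) \<in> borel_measurable M" for n
      using assms(1,2) by measurable
    show "AE x in M. norm (norm (f n x - g x) powr p) \<le> w x" for n using assms(6)[of n] by simp
  qed (use assms(5) in auto)
  then show ?thesis by simp
qed

text \<open>The estimate \<open>t \<le> 2\<^sup>-\<^sup>k + 2\<^sup>k t\<^sup>2\<close> makes the telescoping series absolutely
  summable almost everywhere without Minkowski's inequality.\<close>

lemma AE_convergent_subseq_if_square_Cauchy:
  fixes h :: "nat \<Rightarrow> 'a \<Rightarrow> 'b::euclidean_space"
  assumes h: "\<And>n. power_integrable M 2 (h n)" and \<epsilon>: "\<epsilon> \<longlonglongrightarrow> 0"
    and fin: "finite_measure M"
    and le: "\<And>n m. n \<le> m \<Longrightarrow> (LINT x|M. (norm (h n x - h m x))\<^sup>2) \<le> \<epsilon> n"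
  obtains r :: "nat \<Rightarrow> nat" and g where "strict_mono r" "g \<in> borel_measurable M"
    "AE x in M. (\<lambda>k. h (r k) x) \<longlonglongrightarrow> g x"
proof -
  interpret finite_measure M by fact
  \<comment> \<open>The rate \<open>(1/4)^k\<close> still leaves \<open>(1/2)^k\<close> after
    multiplication by the weights \<open>2^k\<close>.\<close>
  obtain r :: "nat \<Rightarrow> nat" where r: "strict_mono r" "\<And>k n. n \<ge> r k \<Longrightarrow> \<epsilon> n < (1/4)^k"
    by (rule nonneg_tendsto_0_subseq[OF \<epsilon>, of "\<lambda>k. (1/4)^k"]) auto
  let ?d = "\<lambda>k x. (norm (h (r (Suc k)) x - h (r k) x))\<^sup>2"
  have d: "integrable M (?d k)" for k
    using power_integrable_diff[OF h h, of "r (Suc k)" "r k"] by (simp add: power_integrable_2)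
  have small: "(LINT x|M. 2^k * ?d k x) \<le> (1/2)^k" for k
  proof -
    have "(LINT x|M. ?d k x) \<le> \<epsilon> (r k)"
      using le[of "r k" "r (Suc k)"] strict_monoD[OF r(1), of k "Suc k"] by (simp add: norm_minus_commute)
    also have "\<dots> \<le> (1/4)^k" using r(2)[of k "r k"] by simp
    finally have "2^k * (LINT x|M. ?d k x) \<le> 2^k * (1/4)^k" by (intro mult_left_mono) auto
    also have "(2::real)^k * (1/4)^k = (1/2)^k" by (simp add: power_mult_distrib[symmetric])
    finally show ?thesis by simp
  qed
  have "summable (\<lambda>k. LINT x|M. 2^k * ?d k x)"
    by (rule summable_comparison_test[OF _ summable_geometric[of "1/2::real"]])
      (use small in \<open>auto intro!: exI[of _ 0] simp: abs_of_nonneg integral_nonneg_AE\<close>)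
  then have "AE x in M. summable (\<lambda>k. 2^k * ?d k x)"
    using d by (intro summable_integrals_imp_AE_summable(1)) auto
  then have conv: "AE x in M. convergent (\<lambda>k. h (r k) x)"
  proof eventually_elim
    case (elim x)
    have "summable (\<lambda>k. (1/2)^k + 2^k * ?d k x)"
      by (intro summable_add elim summable_geometric) simp
    moreover have "norm (h (r (Suc k)) x - h (r k) x) \<le> (1/2)^k + 2^k * ?d k x" for k
    proof -
      define t where "t = norm (h (r (Suc k)) x - h (r k) x)"
      have "0 \<le> (1 - 2^k * t)\<^sup>2" by simp
      also have "\<dots> = 1 - 2 * 2^k * t + (2^k)\<^sup>2 * t\<^sup>2" by (simp add: power2_diff power_mult_distrib)
      finally have "2 * 2^k * t \<le> 1 + (2^k)\<^sup>2 * t\<^sup>2" by simp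
      then have "(2 * t) * 2^k \<le> (1 / 2^k + 2^k * t\<^sup>2) * 2^k"
        by (simp add: algebra_simps power2_eq_square)
      then have "2 * t \<le> 1 / 2^k + 2^k * t\<^sup>2" by (subst (asm) mult_le_cancel_right) auto
      moreover have "t \<ge> 0" by (simp add: t_def)
      ultimately have "t \<le> 1 / 2^k + 2^k * t\<^sup>2" by linarith
      then show ?thesis unfolding t_def by (simp add: power_one_over)
    qed
    ultimately have "summable (\<lambda>k. h (r (Suc k)) x - h (r k) x)"
      by (rule summable_comparison_test'[where N = 0])
    then have "convergent (\<lambda>n. \<Sum>k<n. h (r (Suc k)) x - h (r k) x)" by (simp add: summable_iff_convergent)
    then have "convergent (\<lambda>n. h (r n) x - h (r 0) x)"
      using sum_lessThan_telescope[of "\<lambda>k. h (r k) x"] by simp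
    then show ?case by (simp add: convergent_diff_const_right_iff)
  qed
  define g where "g x = lim (\<lambda>k. h (r k) x)" for x
  show ?thesis
  proof (rule that[OF r(1)])
    have "\<And>k. h (r k) \<in> borel_measurable M" using h by (simp add: power_integrable_def)
    then show "g \<in> borel_measurable M" unfolding g_def by (rule borel_measurable_lim_metric)
    show "AE x in M. (\<lambda>k. h (r k) x) \<longlonglongrightarrow> g x"
      using conv unfolding g_def by eventually_elim (simp add: convergent_LIMSEQ_iff)
  qed
qed

text \<open>Completeness of \<open>L^2\<close>. The limit comes from an almost everywhere convergent
  subsequence, and Fatou's lemma in the second index carries the Cauchy bound
  \<open>\<epsilon> n\<close> over to the distance from that limit.\<close>

lemma square_Cauchy_imp_convergent:
  fixes h :: "nat \<Rightarrow> 'a \<Rightarrow> 'b::euclidean_space"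
  assumes h: "\<And>n. power_integrable M 2 (h n)" and \<epsilon>: "\<epsilon> \<longlonglongrightarrow> 0"
    and fin: "finite_measure M"
    and le: "\<And>n m. n \<le> m \<Longrightarrow> (LINT x|M. (norm (h n x - h m x))\<^sup>2) \<le> \<epsilon> n"
  obtains g where "power_integrable M 2 g" "(\<lambda>n. LINT x|M. (norm (h n x - g x))\<^sup>2) \<longlonglongrightarrow> 0"
proof -
  obtain r :: "nat \<Rightarrow> nat" and g where r: "strict_mono r" and g: "g \<in> borel_measurable M"
    and conv: "AE x in M. (\<lambda>k. h (r k) x) \<longlonglongrightarrow> g x"
    by (rule AE_convergent_subseq_if_square_Cauchy[OF h \<epsilon> fin le])
  have [measurable]: "h n \<in> borel_measurable M" for n using h by (simp add: power_integrable_def)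
  note [measurable] = g
  have int: "integrable M (\<lambda>x. (norm (h n x - h m x))\<^sup>2)" for n m
    using power_integrable_diff[OF h h] by (simp add: power_integrable_2)
  have \<epsilon>0: "\<epsilon> n \<ge> 0" for n
    using le[OF order_refl, of n] by simp
  have bnd: "(\<integral>\<^sup>+x. ennreal ((norm (h n x - g x))\<^sup>2) \<partial>M) \<le> ennreal (\<epsilon> n)" for n
  proof -
    have "(\<integral>\<^sup>+x. ennreal ((norm (h n x - g x))\<^sup>2) \<partial>M) =
        (\<integral>\<^sup>+x. liminf (\<lambda>k. ennreal ((norm (h n x - h (r k) x))\<^sup>2)) \<partial>M)"
    proof (rule nn_integral_cong_AE)
      show "AE x in M. ennreal ((norm (h n x - g x))\<^sup>2) = liminf (\<lambda>k. ennreal ((norm (h n x - h (r k) x))\<^sup>2))"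
        using conv
      proof eventually_elim
        case (elim x)
        then have "(\<lambda>k. ennreal ((norm (h n x - h (r k) x))\<^sup>2)) \<longlonglongrightarrow> ennreal ((norm (h n x - g x))\<^sup>2)"
          by (intro tendsto_intros tendsto_ennrealI)
        then show ?case by (rule lim_imp_Liminf[OF sequentially_bot, symmetric])
      qed
    qed
    also have "\<dots> \<le> liminf (\<lambda>k. \<integral>\<^sup>+x. ennreal ((norm (h n x - h (r k) x))\<^sup>2) \<partial>M)"
      by (rule nn_integral_liminf) measurable
    also have "\<dots> \<le> ennreal (\<epsilon> n)"
    proof -
      have "\<forall>\<^sub>F k in sequentially. (\<integral>\<^sup>+x. ennreal ((norm (h n x - h (r k) x))\<^sup>2) \<partial>M) \<le> ennreal (\<epsilon> n)"
        using eventually_ge_at_top[of n]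
      proof eventually_elim
        case (elim k)
        then have "n \<le> r k" using strict_mono_imp_increasing[OF r, of k] by linarith
        then show ?case using int le by (simp add: nn_integral_eq_integral ennreal_leI)
      qed
      then have "limsup (\<lambda>k. \<integral>\<^sup>+x. ennreal ((norm (h n x - h (r k) x))\<^sup>2) \<partial>M) \<le> ennreal (\<epsilon> n)"
        by (rule Limsup_bounded)
      then show ?thesis
        using Liminf_le_Limsup[OF sequentially_bot] order_trans by blast
    qed
    finally show ?thesis .
  qed
  have int_diff: "integrable M (\<lambda>x. (norm (h n x - g x))\<^sup>2)" for n
    by (rule integrableI_bounded) (use bnd[of n] in \<open>auto simp: le_less_trans[OF _ ennreal_less_top]\<close>)
  have le': "(LINT x|M. (norm (h n x - g x))\<^sup>2) \<le> \<epsilon> n" for n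
    using bnd[of n] \<epsilon>0[of n] int_diff[of n] by (simp add: nn_integral_eq_integral)
  show ?thesis
  proof (rule that)
    \<comment> \<open>The limit is recovered as \<open>h 0 - (h 0 - g)\<close>, a difference of two
      square integrable functions.\<close>
    have "power_integrable M 2 (\<lambda>x. h 0 x - g x)" using int_diff[of 0] by (simp add: power_integrable_2)
    from power_integrable_diff[OF h this, of 0] show "power_integrable M 2 g" by simp
    show "(\<lambda>n. LINT x|M. (norm (h n x - g x))\<^sup>2) \<longlonglongrightarrow> 0"
      by (rule tendsto_sandwich[OF _ _ tendsto_const \<epsilon>]) (use le' in auto)
  qed
qed

section \<open>Finite convex combinations of the tails of a sequence\<close>

definition tail_weights :: "nat \<Rightarrow> (nat \<Rightarrow> real) \<Rightarrow> bool" where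
  "tail_weights n c \<longleftrightarrow> finite {m. c m \<noteq> 0} \<and> (\<forall>m. c m \<ge> 0) \<and> (\<forall>m<n. c m = 0) \<and> (\<Sum>m | c m \<noteq> 0. c m) = 1"

definition wavg :: "(nat \<Rightarrow> real) \<Rightarrow> (nat \<Rightarrow> 'b::real_vector) \<Rightarrow> 'b" where
  "wavg c a = (\<Sum>m | c m \<noteq> 0. c m *\<^sub>R a m)"

lemma wavg_superset:
  assumes "finite T" "{m. c m \<noteq> 0} \<subseteq> T"
  shows "wavg c a = (\<Sum>m\<in>T. c m *\<^sub>R a m)"
  unfolding wavg_def by (rule sum.mono_neutral_left) (use assms in auto)

lemma tail_weights_sum:
  assumes "tail_weights n c" "finite T" "{m. c m \<noteq> 0} \<subseteq> T"
  shows "(\<Sum>m\<in>T. c m) = 1"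
proof -
  have "(\<Sum>m | c m \<noteq> 0. c m) = (\<Sum>m\<in>T. c m)"
    by (rule sum.mono_neutral_left) (use assms(2,3) in auto)
  then show ?thesis using assms(1) by (simp add: tail_weights_def)
qed

lemma tail_weights_unit: "tail_weights n (\<lambda>m. if m = n then 1 else 0)"
proof -
  have "{m. (if m = n then 1 else 0 :: real) \<noteq> 0} = {n}" by auto
  then show ?thesis by (simp add: tail_weights_def)
qed

lemma tail_weights_mono: "tail_weights m c \<Longrightarrow> n \<le> m \<Longrightarrow> tail_weights n c"
  by (auto simp: tail_weights_def)

text \<open>The parallelogram law in \<open>convex_combinations_converge\<close> needs the midpoint
  of two averages to be an average again. The two supports may differ, hence the sums over their
  union.\<close>

lemma tail_weights_midpoint:
  assumes "tail_weights n c" "tail_weights n c'"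
  shows "tail_weights n (\<lambda>m. (c m + c' m) / 2)"
    and "wavg (\<lambda>m. (c m + c' m) / 2) a = (1/2) *\<^sub>R (wavg c a + wavg c' a)"
proof -
  let ?T = "{m. c m \<noteq> 0} \<union> {m. c' m \<noteq> 0}"
  have T: "finite ?T" using assms by (auto simp: tail_weights_def)
  have sub: "{m. (c m + c' m) / 2 \<noteq> 0} \<subseteq> ?T" by auto
  have "(\<Sum>m | (c m + c' m) / 2 \<noteq> 0. (c m + c' m) / 2) = (\<Sum>m\<in>?T. (c m + c' m) / 2)"
    by (rule sum.mono_neutral_left) (use T sub in auto)
  also have "\<dots> = 1"
    using tail_weights_sum[OF assms(1) T] tail_weights_sum[OF assms(2) T]
    by (simp add: sum_divide_distrib[symmetric] sum.distrib)
  finally show "tail_weights n (\<lambda>m. (c m + c' m) / 2)"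
    using assms finite_subset[OF sub T] by (simp add: tail_weights_def)
  show "wavg (\<lambda>m. (c m + c' m) / 2) a = (1/2) *\<^sub>R (wavg c a + wavg c' a)"
    using wavg_superset[OF T, of c a] wavg_superset[OF T, of c' a] wavg_superset[OF T sub, of a]
    by (simp add: sum.distrib[symmetric] scaleR_right.sum scaleR_add_left[symmetric] add_divide_distrib scaleR_add_right)
qed

lemma wavg_const: "tail_weights n c \<Longrightarrow> wavg c (\<lambda>m. a) = a"
  by (simp add: wavg_def tail_weights_def scaleR_left.sum[symmetric])

lemma wavg_mono:
  fixes a b :: "nat \<Rightarrow> real"
  assumes "tail_weights n c" "\<And>m. m \<ge> n \<Longrightarrow> a m \<le> b m"
  shows "wavg c a \<le> wavg c b"
  unfolding wavg_def
proof (rule sum_mono)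
  fix m assume "m \<in> {m. c m \<noteq> 0}"
  with assms(1) have "m \<ge> n" "c m \<ge> 0" by (auto simp: tail_weights_def not_less[symmetric])
  then show "c m *\<^sub>R a m \<le> c m *\<^sub>R b m" using assms(2) by (simp add: mult_left_mono)
qed

lemma wavg_le:
  fixes a :: "nat \<Rightarrow> real"
  assumes "tail_weights n c" "\<And>m. m \<ge> n \<Longrightarrow> a m \<le> K"
  shows "wavg c a \<le> K"
  using wavg_mono[OF assms(1), of a "\<lambda>m. K"] assms(2) wavg_const[OF assms(1), of K] by simp

lemma wavg_nonneg:
  fixes a :: "nat \<Rightarrow> real"
  assumes "tail_weights n c" "\<And>m. m \<ge> n \<Longrightarrow> a m \<ge> 0"
  shows "wavg c a \<ge> 0"
  using wavg_mono[OF assms(1), of "\<lambda>m. 0" a] assms(2) wavg_const[OF assms(1), of "0::real"] by simp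

lemma wavg_diff: "wavg c (\<lambda>m. a m - b m) = wavg c a - wavg c b"
  by (simp add: wavg_def scaleR_diff_right sum_subtractf)

lemma wavg_add: "wavg c (\<lambda>m. a m + b m) = wavg c a + wavg c b"
  by (simp add: wavg_def scaleR_add_right sum.distrib)

lemma wavg_mult:
  fixes a :: "nat \<Rightarrow> real"
  shows "wavg c (\<lambda>m. K * a m) = K * wavg c a"
  by (simp add: wavg_def sum_distrib_left mult.left_commute)

text \<open>Jensen's inequality; the support is nonempty because the weights sum to 1.\<close>

lemma wavg_convex:
  fixes J :: "'b::real_vector \<Rightarrow> real"
  assumes "tail_weights n c" "convex_on UNIV J"
  shows "J (wavg c a) \<le> wavg c (\<lambda>m. J (a m))"
  unfolding wavg_def real_scaleR_def
proof (rule convex_on_sum[OF _ _ assms(2)])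
  show "{m. c m \<noteq> 0} \<noteq> {}"
  proof
    assume "{m. c m \<noteq> 0} = {}"
    then have "(\<Sum>m | c m \<noteq> 0. c m) = 0" by (simp only: sum.empty)
    with assms(1) show False by (simp add: tail_weights_def)
  qed
qed (use assms(1) in \<open>auto simp: tail_weights_def\<close>)

lemma norm_wavg_le:
  assumes "tail_weights n c"
  shows "norm (wavg c a) \<le> wavg c (\<lambda>m. norm (a m))"
proof (rule wavg_convex[OF assms])
  show "convex_on UNIV (norm :: 'a \<Rightarrow> real)"
  proof (rule convex_onI)
    fix t :: real and x y :: 'a assume "0 < t" "t < 1"
    then show "norm ((1 - t) *\<^sub>R x + t *\<^sub>R y) \<le> (1 - t) * norm x + t * norm y"
      using norm_triangle_ineq[of "(1 - t) *\<^sub>R x" "t *\<^sub>R y"] by simp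
  qed simp
qed

text \<open>The convexity defect is exactly \<open>t (1 - t) |x - y|^2\<close>.\<close>

lemma convex_on_norm_square: "convex_on UNIV (\<lambda>x::'b::real_inner. (norm x)\<^sup>2)"
proof (rule convex_onI)
  fix t :: real and x y :: 'b assume t: "0 < t" "t < 1"
  have "(1 - t) * (norm x)\<^sup>2 + t * (norm y)\<^sup>2 - (norm ((1 - t) *\<^sub>R x + t *\<^sub>R y))\<^sup>2 = t * (1 - t) * (norm (x - y))\<^sup>2"
    by (simp add: power2_norm_eq_inner inner_add_left inner_add_right inner_diff_left inner_diff_right
        inner_commute algebra_simps)
  moreover have "t * (1 - t) * (norm (x - y))\<^sup>2 \<ge> 0" using t by simp
  ultimately show "(norm ((1 - t) *\<^sub>R x + t *\<^sub>R y))\<^sup>2 \<le> (1 - t) * (norm x)\<^sup>2 + t * (norm y)\<^sup>2" by linarith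
qed simp

lemma norm_square_wavg_le:
  fixes a :: "nat \<Rightarrow> 'b::real_inner"
  assumes "tail_weights n c"
  shows "(norm (wavg c a))\<^sup>2 \<le> wavg c (\<lambda>m. (norm (a m))\<^sup>2)"
  by (rule wavg_convex[OF assms convex_on_norm_square])

text \<open>Here the tail condition pays off: the \<open>n\<close>-th weights charge only indices
  from \<open>n\<close> on, so an average of errors is as small as the errors in that tail.\<close>

lemma wavg_tendsto:
  fixes a :: "nat \<Rightarrow> 'b::real_normed_vector"
  assumes "a \<longlonglongrightarrow> l" "\<And>n. tail_weights n (c n)"
  shows "(\<lambda>n. wavg (c n) a) \<longlonglongrightarrow> l"
proof (rule LIMSEQ_I)
  fix e :: real assume "e > 0"
  then obtain N where N: "\<And>m. m \<ge> N \<Longrightarrow> norm (a m - l) \<le> e / 2"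
    using LIMSEQ_D[OF assms(1), of "e/2"] by (meson half_gt_zero less_imp_le)
  have "norm (wavg (c n) a - l) < e" if "n \<ge> N" for n
  proof -
    have "wavg (c n) a - l = wavg (c n) (\<lambda>m. a m - l)"
      by (simp add: wavg_diff wavg_const[OF assms(2)])
    then have "norm (wavg (c n) a - l) \<le> wavg (c n) (\<lambda>m. norm (a m - l))"
      using norm_wavg_le[OF assms(2)] by metis
    also have "\<dots> \<le> e / 2" by (rule wavg_le[OF assms(2)]) (use N that in auto)
    finally show ?thesis using \<open>e > 0\<close> by simp
  qed
  then show "\<exists>N. \<forall>n\<ge>N. norm (wavg (c n) a - l) < e" by blast
qed

lemma wavg_power_integrable:
  assumes "\<And>m. power_integrable M p (g m)" "p > 0"
  shows "power_integrable M p (\<lambda>x. wavg c (\<lambda>m. g m x))"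
  unfolding wavg_def by (intro power_integrable_sum power_integrable_scale assms)

lemma integral_wavg:
  fixes f :: "nat \<Rightarrow> 'a \<Rightarrow> real"
  assumes "\<And>m. integrable M (f m)"
  shows "(LINT x|M. wavg c (\<lambda>m. f m x)) = wavg c (\<lambda>m. LINT x|M. f m x)"
    "integrable M (\<lambda>x. wavg c (\<lambda>m. f m x))"
  unfolding wavg_def using assms by (simp_all add: integral_sum)

text \<open>Mazur's lemma without weak convergence: near-minimizers of the norm on the convex hulls of
  the tails form a Cauchy sequence by the parallelogram law.\<close>

theorem convex_combinations_converge:
  fixes g :: "nat \<Rightarrow> 'a \<Rightarrow> 'b::euclidean_space"
  assumes fin: "finite_measure M" and g: "\<And>n. power_integrable M 2 (g n)"
    and bnd: "\<And>n. (LINT x|M. (norm (g n x))\<^sup>2) \<le> C"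
  obtains c h where "\<And>n. tail_weights n (c n)" "power_integrable M 2 h"
    "(\<lambda>n. LINT x|M. (norm (wavg (c n) (\<lambda>m. g m x) - h x))\<^sup>2) \<longlonglongrightarrow> 0"
proof -
  define Q where "Q c = (LINT x|M. (norm (wavg c (\<lambda>m. g m x)))\<^sup>2)" for c
  define d where "d n = Inf (Q ` {c. tail_weights n c})" for n
  have Q0: "Q c \<ge> 0" for c by (simp add: Q_def)
  have bb: "bdd_below (Q ` S)" for S by (rule bdd_belowI[of _ 0]) (use Q0 in auto)
  have ne: "Q ` {c. tail_weights n c} \<noteq> {}" for n using tail_weights_unit by blast
  have lower: "d n \<le> Q c" if "tail_weights n c" for n c
    unfolding d_def by (rule cInf_lower[OF _ bb]) (use that in auto)
  have dC: "d n \<le> C" for n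
  proof -
    have "d n \<le> Q (\<lambda>m. if m = n then 1 else 0)" by (rule lower[OF tail_weights_unit])
    also have "\<dots> = (LINT x|M. (norm (g n x))\<^sup>2)" by (simp add: Q_def wavg_def)
    finally show ?thesis using bnd[of n] by simp
  qed
  \<comment> \<open>The convex hulls of the tails shrink, so their infima \<open>d n\<close>
    increase; they stay below \<open>C\<close> because \<open>g n\<close> itself belongs to the
    \<open>n\<close>-th hull.\<close>
  have "mono d"
  proof (rule monoI)
    fix n m :: nat assume "n \<le> m"
    then show "d n \<le> d m"
      unfolding d_def by (intro cInf_superset_mono[OF ne bb] image_mono) (auto intro: tail_weights_mono)
  qed
  then obtain L where L: "d \<longlonglongrightarrow> L" "\<And>n. d n \<le> L"
    using incseq_convergent[of d C] dC by blast
  define e where "e n = 1 / real (Suc n)" for n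
  have e: "e \<longlonglongrightarrow> 0" "\<And>n. e n > 0" "\<And>n m. n \<le> m \<Longrightarrow> e m \<le> e n"
    unfolding e_def by (rule LIMSEQ_inverse_real_of_nat[unfolded inverse_eq_divide]) (auto intro!: divide_left_mono)
  have "\<exists>c. tail_weights n c \<and> Q c < d n + e n" for n
  proof -
    have "Inf (Q ` {c. tail_weights n c}) < d n + e n" using e(2)[of n] by (simp add: d_def)
    from cInf_lessD[OF ne this] show ?thesis by auto
  qed
  then obtain c where c: "\<And>n. tail_weights n (c n)" "\<And>n. Q (c n) < d n + e n" by metis
  define h where "h n x = wavg (c n) (\<lambda>m. g m x)" for n x
  have hint: "power_integrable M 2 (h n)" for n unfolding h_def by (rule wavg_power_integrable[OF g]) simp
  \<comment> \<open>For \<open>n \<le> m\<close> the midpoint of the two averages competes for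
    \<open>d n\<close>, so its square integral is at least \<open>d n\<close>. The parallelogram law
    then bounds the distance by the near-minimality gaps, where \<open>L\<close> is the limit of
    \<open>d\<close>.\<close>
  have le: "(LINT x|M. (norm (h n x - h m x))\<^sup>2) \<le> 4 * (L - d n) + 4 * e n" if "n \<le> m" for n m
  proof -
    have cm: "tail_weights n (c m)" using tail_weights_mono[OF c(1) that] .
    let ?mid = "\<lambda>i. (c n i + c m i) / 2"
    have int: "integrable M (\<lambda>x. (norm (h k x))\<^sup>2)" for k using hint by (simp add: power_integrable_2)
    have int2: "integrable M (\<lambda>x. (norm (h n x + h m x))\<^sup>2)"
      using power_integrable_add[OF hint hint, of n m] by (simp add: power_integrable_2)
    have "d n \<le> Q ?mid" by (rule lower[OF tail_weights_midpoint(1)[OF c(1) cm]])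
    also have "Q ?mid = (LINT x|M. (1/4) * (norm (h n x + h m x))\<^sup>2)"
      by (simp add: Q_def tail_weights_midpoint(2)[OF c(1) cm] h_def power_mult_distrib power2_eq_square)
    finally have mid: "4 * d n \<le> (LINT x|M. (norm (h n x + h m x))\<^sup>2)" by simp
    have "(LINT x|M. (norm (h n x - h m x))\<^sup>2) =
        (LINT x|M. 2 * (norm (h n x))\<^sup>2 + 2 * (norm (h m x))\<^sup>2 - (norm (h n x + h m x))\<^sup>2)"
      by (intro Bochner_Integration.integral_cong refl)
        (simp add: power2_norm_eq_inner inner_add_left inner_add_right inner_diff_left inner_diff_right inner_commute)
    also have "\<dots> = 2 * Q (c n) + 2 * Q (c m) - (LINT x|M. (norm (h n x + h m x))\<^sup>2)"
      using int int2 by (simp add: Q_def h_def)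
    also have "\<dots> \<le> 4 * (L - d n) + 4 * e n"
    proof -
      have "a1 < d1 + e1 \<Longrightarrow> a2 < d2 + e2 \<Longrightarrow> 4 * d1 \<le> I \<Longrightarrow> d2 \<le> l \<Longrightarrow> d1 \<le> l \<Longrightarrow> e2 \<le> e1 \<Longrightarrow>
          2 * a1 + 2 * a2 - I \<le> 4 * (l - d1) + 4 * e1" for a1 a2 d1 d2 e1 e2 I l :: real
        by simp
      from this[OF c(2)[of n] c(2)[of m] mid L(2)[of m] L(2)[of n] e(3)[OF that]] show ?thesis .
    qed
    finally show ?thesis .
  qed
  have "(\<lambda>n. 4 * (L - d n) + 4 * e n) \<longlonglongrightarrow> 4 * (L - L) + 4 * 0"
    by (intro tendsto_intros L(1) e(1))
  then have lim: "(\<lambda>n. 4 * (L - d n) + 4 * e n) \<longlonglongrightarrow> 0" by simp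
  obtain G where "power_integrable M 2 G" "(\<lambda>n. LINT x|M. (norm (h n x - G x))\<^sup>2) \<longlonglongrightarrow> 0"
    by (rule square_Cauchy_imp_convergent[OF hint lim fin le])
  then show ?thesis using that[OF c(1)] by (simp add: h_def)
qed

section \<open>Rellich compactness for test functions\<close>

text \<open>Cauchy-Schwarz on the unit interval, read off from a variance:
  \<open>c = F 1 - F 0\<close> is the mean of \<open>h\<close>, so the nonnegative integral of
  \<open>(h - c)^2\<close> is that of \<open>h^2\<close> minus \<open>c^2\<close>.\<close>

lemma square_diff_le_integral_square_deriv:
  fixes F h :: "real \<Rightarrow> real"
  assumes F: "\<And>t. (F has_real_derivative h t) (at t)" and h: "continuous_on UNIV h"
  shows "ennreal ((F 1 - F 0)\<^sup>2) \<le> (\<integral>\<^sup>+t. ennreal ((h t)\<^sup>2) * indicator {0..1} t \<partial>lborel)"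
proof -
  define c where "c = F 1 - F 0"
  have hb: "has_bochner_integral lborel (\<lambda>t. h t * indicator {0..1} t) c"
    unfolding c_def
    by (rule has_bochner_integral_FTC_Icc_real) (use F h in \<open>auto simp: continuous_on_eq_continuous_at\<close>)
  have h2: "integrable lborel (\<lambda>t. (h t)\<^sup>2 * indicator {0..1} t)"
    using borel_integrable_compact[of "{0..1::real}" "\<lambda>t. (h t)\<^sup>2"] continuous_on_subset[OF h]
    by (auto simp: mult.commute intro!: continuous_intros)
  have "0 \<le> (LINT t|lborel. (h t - c)\<^sup>2 * indicator {0..1} t)"
    by simp
  also have "\<dots> = (LINT t|lborel. (h t)\<^sup>2 * indicator {0..1} t - 2 * c * (h t * indicator {0..1} t)
      + c\<^sup>2 * indicator {0..1} t)"
    by (intro Bochner_Integration.integral_cong refl) (simp add: power2_diff algebra_simps split: split_indicator)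
  also have "\<dots> = (LINT t|lborel. (h t)\<^sup>2 * indicator {0..1} t) - 2 * c * c + c\<^sup>2"
  proof -
    have i: "integrable lborel (\<lambda>t. h t * indicator {0..1} t)" "(LINT t|lborel. h t * indicator {0..1} t) = c"
      "integrable lborel (\<lambda>t. c\<^sup>2 * indicator {0..1::real} t)" "(LINT t|lborel. c\<^sup>2 * indicator {0..1::real} t) = c\<^sup>2"
      using hb by (auto simp: has_bochner_integral_iff intro!: integrable_mult_right integrable_real_indicator)
    show ?thesis
      using i h2 by (subst Bochner_Integration.integral_add) auto
  qed
  finally have "c\<^sup>2 \<le> (LINT t|lborel. (h t)\<^sup>2 * indicator {0..1} t)"
    by (simp add: power2_eq_square)
  then have "ennreal (c\<^sup>2) \<le> ennreal (LINT t|lborel. (h t)\<^sup>2 * indicator {0..1} t)"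
    by (rule ennreal_leI)
  also have "\<dots> = (\<integral>\<^sup>+t. ennreal ((h t)\<^sup>2 * indicator {0..1} t) \<partial>lborel)"
    using h2 by (intro nn_integral_eq_integral[symmetric]) auto
  also have "\<dots> = (\<integral>\<^sup>+t. ennreal ((h t)\<^sup>2) * indicator {0..1} t \<partial>lborel)"
    by (intro nn_integral_cong) (simp split: split_indicator)
  finally show ?thesis by (simp add: c_def)
qed

lemma nn_integral_lborel_translate:
  fixes f :: "'a::euclidean_space \<Rightarrow> ennreal"
  assumes [measurable]: "f \<in> borel_measurable borel"
  shows "(\<integral>\<^sup>+x. f (a + x) \<partial>lborel) = (\<integral>\<^sup>+x. f x \<partial>lborel)"
proof -
  have "(\<integral>\<^sup>+x. f (a + x) \<partial>lborel) = (\<integral>\<^sup>+x. f x \<partial>distr lborel borel ((+) a))"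
    by (subst nn_integral_distr) auto
  then show ?thesis by (simp add: lborel_distr_plus)
qed

text \<open>The increment is the integral of the derivative along the segment from \<open>x\<close>
  to \<open>z + x\<close>. After squaring and exchanging the integrals, translation invariance makes
  the inner integral independent of the position on the segment.\<close>

lemma translation_estimate:
  fixes \<phi> :: "'a::euclidean_space \<Rightarrow> real"
  assumes sm: "smooth \<phi>"
  shows "(\<integral>\<^sup>+x. ennreal ((\<phi> (z + x) - \<phi> x)\<^sup>2) \<partial>lborel)
    \<le> ennreal ((norm z)\<^sup>2) * (\<integral>\<^sup>+x. ennreal ((norm (grad \<phi> x))\<^sup>2) \<partial>lborel)"
proof -
  note [measurable] = smooth_borel_measurable[OF sm] grad_borel_measurable[OF sm]
  have "ennreal ((\<phi> (z + x) - \<phi> x)\<^sup>2) \<le> (\<integral>\<^sup>+t. ennreal ((grad \<phi> (t *\<^sub>R z + x) \<bullet> z)\<^sup>2) * indicator {0..1} t \<partial>lborel)" for x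
  proof -
    have "((\<lambda>t. \<phi> (t *\<^sub>R z + x)) has_real_derivative (grad \<phi> (t *\<^sub>R z + x) \<bullet> z)) (at t)" for t
    proof -
      have "((\<lambda>s::real. s *\<^sub>R z + x) has_derivative (\<lambda>s. s *\<^sub>R z)) (at t)"
        by (auto intro!: derivative_eq_intros)
      from has_derivative_compose[OF this smooth_has_derivative[OF sm]]
      show ?thesis
        unfolding has_field_derivative_def by (rule has_derivative_eq_rhs) (auto simp: mult.commute)
    qed
    moreover have "continuous_on UNIV (\<lambda>t. grad \<phi> (t *\<^sub>R z + x) \<bullet> z)"
      by (intro continuous_intros continuous_on_compose2[OF continuous_grad[OF sm, of UNIV]]) auto
    ultimately show ?thesis
      using square_diff_le_integral_square_deriv[of "\<lambda>t. \<phi> (t *\<^sub>R z + x)" "\<lambda>t. grad \<phi> (t *\<^sub>R z + x) \<bullet> z"] by simp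
  qed
  then have "(\<integral>\<^sup>+x. ennreal ((\<phi> (z + x) - \<phi> x)\<^sup>2) \<partial>lborel) \<le>
     (\<integral>\<^sup>+x. (\<integral>\<^sup>+t. ennreal ((grad \<phi> (t *\<^sub>R z + x) \<bullet> z)\<^sup>2) * indicator {0..1} t \<partial>lborel) \<partial>lborel)"
    by (intro nn_integral_mono) auto
  also have "\<dots> = (\<integral>\<^sup>+t. (\<integral>\<^sup>+x. ennreal ((grad \<phi> (t *\<^sub>R z + x) \<bullet> z)\<^sup>2) * indicator {0..1} t \<partial>lborel) \<partial>lborel)"
    by (rule lborel_pair.Fubini'[symmetric]) measurable
  also have "\<dots> = (\<integral>\<^sup>+t. (\<integral>\<^sup>+x. ennreal ((grad \<phi> x \<bullet> z)\<^sup>2) \<partial>lborel) * indicator {0..1::real} t \<partial>lborel)"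
    using nn_integral_lborel_translate[of "\<lambda>x. ennreal ((grad \<phi> x \<bullet> z)\<^sup>2)"]
    by (intro nn_integral_cong) (simp add: nn_integral_multc)
  also have "\<dots> = (\<integral>\<^sup>+x. ennreal ((grad \<phi> x \<bullet> z)\<^sup>2) \<partial>lborel)"
    by (simp add: nn_integral_cmult)
  also have "\<dots> \<le> (\<integral>\<^sup>+x. ennreal ((norm z)\<^sup>2) * ennreal ((norm (grad \<phi> x))\<^sup>2) \<partial>lborel)"
  proof (intro nn_integral_mono)
    fix x
    have "(grad \<phi> x \<bullet> z)\<^sup>2 \<le> (norm z)\<^sup>2 * (norm (grad \<phi> x))\<^sup>2"
      using Cauchy_Schwarz_ineq[of "grad \<phi> x" z] by (simp add: power2_norm_eq_inner mult.commute)
    then show "ennreal ((grad \<phi> x \<bullet> z)\<^sup>2) \<le> ennreal ((norm z)\<^sup>2) * ennreal ((norm (grad \<phi> x))\<^sup>2)"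
      by (simp add: ennreal_mult[symmetric] ennreal_leI)
  qed
  also have "\<dots> = ennreal ((norm z)\<^sup>2) * (\<integral>\<^sup>+x. ennreal ((norm (grad \<phi> x))\<^sup>2) \<partial>lborel)"
    by (rule nn_integral_cmult) measurable
  finally show ?thesis .
qed

section \<open>A Poincare inequality on a grid of cubes\<close>

definition cell :: "real \<Rightarrow> 'a::euclidean_space \<Rightarrow> 'a set" where
  "cell h k = {y. \<forall>i\<in>Basis. h * (k \<bullet> i) \<le> y \<bullet> i \<and> y \<bullet> i < h * (k \<bullet> i + 1)}"

definition cell_label :: "real \<Rightarrow> 'a::euclidean_space \<Rightarrow> 'a" where
  "cell_label h x = (\<Sum>i\<in>Basis. of_int \<lfloor>(x \<bullet> i) / h\<rfloor> *\<^sub>R i)"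

lemma cell_borel [measurable]: "cell h k \<in> sets borel"
  unfolding cell_def by measurable

lemma emeasure_cell:
  fixes k :: "'a::euclidean_space"
  assumes "h > 0"
  shows "emeasure lborel (cell h k) = ennreal (h ^ DIM('a))"
proof (rule antisym)
  let ?a = "h *\<^sub>R k" and ?b = "h *\<^sub>R k + h *\<^sub>R One"
  have vol: "(\<Prod>i\<in>Basis. (?b - ?a) \<bullet> i) = h ^ DIM('a)"
    by (simp add: inner_diff_left)
  have le: "?a \<bullet> i \<le> ?b \<bullet> i" if "i \<in> Basis" for i using that assms by (simp add: inner_add_left)
  have "cell h k \<subseteq> cbox ?a ?b"
    by (auto simp: cell_def mem_box inner_add_left algebra_simps less_imp_le)
  then have "emeasure lborel (cell h k) \<le> emeasure lborel (cbox ?a ?b)"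
    by (intro emeasure_mono) auto
  also have "\<dots> = ennreal (h ^ DIM('a))"
    using emeasure_lborel_cbox[OF le] vol by simp
  finally show "emeasure lborel (cell h k) \<le> ennreal (h ^ DIM('a))" .
  have "box ?a ?b \<subseteq> cell h k"
    by (auto simp: cell_def mem_box inner_add_left algebra_simps less_imp_le)
  then have "emeasure lborel (box ?a ?b) \<le> emeasure lborel (cell h k)"
    by (intro emeasure_mono) auto
  moreover have "emeasure lborel (box ?a ?b) = ennreal (h ^ DIM('a))"
    using emeasure_lborel_box[OF le] vol by simp
  ultimately show "ennreal (h ^ DIM('a)) \<le> emeasure lborel (cell h k)" by simp
qed

text \<open>The cells are half-open so that the floor function decides membership: every point lies
  in exactly one cell of the grid, the one of its label.\<close>

lemma mem_cell_iff_label: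
  assumes "h > 0"
  shows "x \<in> cell h (cell_label h y) \<longleftrightarrow> cell_label h x = cell_label h y"
proof -
  have "x \<in> cell h (cell_label h y) \<longleftrightarrow> (\<forall>i\<in>Basis. \<lfloor>(x \<bullet> i) / h\<rfloor> = \<lfloor>(y \<bullet> i) / h\<rfloor>)"
  proof -
    have "(h * of_int n \<le> x \<bullet> i \<and> x \<bullet> i < h * (of_int n + 1)) \<longleftrightarrow> \<lfloor>(x \<bullet> i) / h\<rfloor> = n" for i n
      using assms by (simp add: floor_eq_iff pos_le_divide_eq pos_divide_less_eq mult.commute)
    then show ?thesis by (auto simp: cell_def cell_label_def)
  qed
  also have "\<dots> \<longleftrightarrow> cell_label h x = cell_label h y"
    by (subst euclidean_eq_iff) (auto simp: cell_label_def)
  finally show ?thesis .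
qed

lemma finite_cell_labels:
  fixes \<Omega> :: "'a::euclidean_space set"
  assumes "h > 0" "bounded \<Omega>"
  shows "finite (cell_label h ` \<Omega>)"
proof -
  obtain R where R: "\<And>x. x \<in> \<Omega> \<Longrightarrow> norm x \<le> R" using assms(2) by (auto simp: bounded_iff)
  define m where "m = \<lceil>R / h\<rceil> + 1"
  have "cell_label h ` \<Omega> \<subseteq> (\<lambda>f. \<Sum>i\<in>Basis. of_int (f i) *\<^sub>R i) ` (Basis \<rightarrow>\<^sub>E {- m..m})"
  proof
    fix k assume "k \<in> cell_label h ` \<Omega>"
    then obtain x where x: "x \<in> \<Omega>" "k = cell_label h x" by auto
    define f where "f = restrict (\<lambda>i. \<lfloor>(x \<bullet> i) / h\<rfloor>) (Basis :: 'a set)"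
    have "\<lfloor>(x \<bullet> i) / h\<rfloor> \<in> {- m..m}" if "i \<in> Basis" for i
    proof -
      have "\<bar>x \<bullet> i\<bar> \<le> R" using Basis_le_norm[OF that, of x] R[OF x(1)] by linarith
      then have "x \<bullet> i / h \<le> R / h" "- (R / h) \<le> x \<bullet> i / h"
        using assms(1) by (auto simp: field_simps abs_le_iff)
      then show ?thesis unfolding m_def by (simp, linarith)
    qed
    then have "f \<in> Basis \<rightarrow>\<^sub>E {- m..m}" by (auto simp: f_def)
    moreover have "k = (\<Sum>i\<in>Basis. of_int (f i) *\<^sub>R i)"
      by (simp add: x(2) cell_label_def f_def)
    ultimately show "k \<in> (\<lambda>f. \<Sum>i\<in>Basis. of_int (f i) *\<^sub>R i) ` (Basis \<rightarrow>\<^sub>E {- m..m})" by blast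
  qed
  moreover have "finite ((\<lambda>f. \<Sum>i\<in>(Basis::'a set). of_int (f i) *\<^sub>R i) ` (Basis \<rightarrow>\<^sub>E {- m..m}))"
    by (intro finite_imageI finite_PiE) auto
  ultimately show ?thesis by (rule finite_subset)
qed

text \<open>Expanding \<open>(w y - w x)^2\<close> gives the variance of \<open>w\<close> up to
  normalization. The second equation moves to \<open>[0, \<infinity>]\<close>-valued integrals, in
  which the cells can be summed and the order of integration exchanged freely.\<close>

lemma finite_measure_variance:
  fixes w :: "'a \<Rightarrow> real"
  assumes "finite_measure M" and w: "w \<in> borel_measurable M" and b: "\<And>x. \<bar>w x\<bar> \<le> C"
  shows "2 * measure M (space M) * (LINT x|M. (w x)\<^sup>2) =
    2 * (LINT x|M. w x)\<^sup>2 + (LINT x|M. LINT y|M. (w y - w x)\<^sup>2)"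
    and "ennreal (LINT x|M. LINT y|M. (w y - w x)\<^sup>2) = (\<integral>\<^sup>+x. \<integral>\<^sup>+y. ennreal ((w y - w x)\<^sup>2) \<partial>M \<partial>M)"
proof -
  interpret finite_measure M by fact
  note [measurable] = w
  have i1: "integrable M w" by (rule integrable_const_bound[where B = C]) (use b in auto)
  have sq: "(w x)\<^sup>2 \<le> C\<^sup>2" for x using abs_le_square_iff[of "w x" C] b[of x] by (simp add: abs_ge_zero order_trans[OF _ abs_ge_self])
  have i2: "integrable M (\<lambda>x. (w x)\<^sup>2)" by (rule integrable_const_bound[where B = "C\<^sup>2"]) (use sq in auto)
  let ?m = "measure M (space M)" and ?A = "LINT x|M. w x" and ?B = "LINT x|M. (w x)\<^sup>2"
  have in_eq: "(LINT y|M. (w y - w x)\<^sup>2) = ?B - 2 * w x * ?A + ?m * (w x)\<^sup>2" for x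
  proof -
    have "(LINT y|M. (w y - w x)\<^sup>2) = (LINT y|M. (w y)\<^sup>2 - (2 * w x) * w y + (w x)\<^sup>2)"
      by (intro Bochner_Integration.integral_cong refl) (simp add: power2_diff)
    then show ?thesis using i1 i2 by simp
  qed
  have in_int: "integrable M (\<lambda>y. (w y - w x)\<^sup>2)" for x
    using i1 i2 by (simp add: power2_diff)
  have "(LINT x|M. LINT y|M. (w y - w x)\<^sup>2) = (LINT x|M. ?B - (2 * ?A) * w x + ?m * (w x)\<^sup>2)"
    unfolding in_eq by (intro Bochner_Integration.integral_cong refl) simp
  also have "\<dots> = 2 * ?m * ?B - 2 * ?A\<^sup>2" using i1 i2 by (simp add: power2_eq_square)
  finally show "2 * ?m * ?B = 2 * ?A\<^sup>2 + (LINT x|M. LINT y|M. (w y - w x)\<^sup>2)" by simp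
  have out_int: "integrable M (\<lambda>x. LINT y|M. (w y - w x)\<^sup>2)"
    unfolding in_eq using i1 i2 by simp
  have "ennreal (LINT x|M. LINT y|M. (w y - w x)\<^sup>2) = (\<integral>\<^sup>+x. ennreal (LINT y|M. (w y - w x)\<^sup>2) \<partial>M)"
    using out_int by (intro nn_integral_eq_integral[symmetric]) auto
  also have "\<dots> = (\<integral>\<^sup>+x. \<integral>\<^sup>+y. ennreal ((w y - w x)\<^sup>2) \<partial>M \<partial>M)"
    using in_int by (intro nn_integral_cong nn_integral_eq_integral[symmetric]) auto
  finally show "ennreal (LINT x|M. LINT y|M. (w y - w x)\<^sup>2) = (\<integral>\<^sup>+x. \<integral>\<^sup>+y. ennreal ((w y - w x)\<^sup>2) \<partial>M \<partial>M)" .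
qed

text \<open>Two points of one cell differ by a vector \<open>z\<close> with coordinates in
  \<open>[-h, h]\<close>. Passing from \<open>(x, y)\<close> to \<open>(x, z)\<close> leaves
  translations by \<open>z\<close>: their length is at most \<open>DIM('a) * h\<close>, and the cube
  of all \<open>z\<close> has volume \<open>(2 * h) ^ DIM('a)\<close>.\<close>

lemma cells_difference_estimate:
  fixes \<phi> :: "'a::euclidean_space \<Rightarrow> real" and h :: real
  assumes sm: "smooth \<phi>" and h: "h > 0" and fin: "finite (cell_label h ` \<Omega>)"
  shows "(\<Sum>k\<in>cell_label h ` \<Omega>. \<integral>\<^sup>+x\<in>cell h k. \<integral>\<^sup>+y\<in>cell h k. ennreal ((\<phi> y - \<phi> x)\<^sup>2) \<partial>lborel \<partial>lborel)
    \<le> ennreal ((2 * h) ^ DIM('a) * (DIM('a) * h)\<^sup>2) * (\<integral>\<^sup>+x. ennreal ((norm (grad \<phi> x))\<^sup>2) \<partial>lborel)"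
proof -
  note [measurable] = smooth_borel_measurable[OF sm]
  let ?K = "cell_label h ` \<Omega>" and ?D = "cbox (- (h *\<^sub>R One)) (h *\<^sub>R One) :: 'a set"
  let ?G = "\<integral>\<^sup>+x. ennreal ((norm (grad \<phi> x))\<^sup>2) \<partial>lborel"
  have D: "norm z \<le> DIM('a) * h" if "z \<in> ?D" for z
  proof -
    have "norm z \<le> (\<Sum>i\<in>Basis. \<bar>z \<bullet> i\<bar>)" by (rule norm_le_l1)
    also have "\<dots> \<le> of_nat (card (Basis :: 'a set)) * h"
      by (rule sum_bounded_above) (use that in \<open>force simp: mem_box abs_le_iff\<close>)
    finally show ?thesis by simp
  qed
  \<comment> \<open>Cells are disjoint, so at most one term of the sum is nonzero and the number of
    cells does not enter the estimate.\<close>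
  have ind: "(\<Sum>k\<in>?K. indicator (cell h k) x * indicator (cell h k) y) \<le> (indicator ?D (y - x) :: ennreal)" for x y
  proof (cases "\<exists>k\<in>?K. x \<in> cell h k \<and> y \<in> cell h k")
    case True
    then obtain k where k: "k \<in> ?K" "x \<in> cell h k" "y \<in> cell h k" by blast
    have eq: "l = k" if "l \<in> ?K" "x \<in> cell h l" for l
      using that k(1,2) mem_cell_iff_label[OF h, of x] by (metis imageE)
    have "(\<Sum>k\<in>?K. indicator (cell h k) x * indicator (cell h k) y :: ennreal) =
        (\<Sum>l\<in>?K. if l = k then 1 else 0)"
    proof (rule sum.cong[OF refl])
      fix l assume l: "l \<in> ?K"
      show "indicator (cell h l) x * indicator (cell h l) y = (if l = k then 1 else 0 :: ennreal)"
      proof (cases "l = k")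
        case False
        then have "x \<notin> cell h l" using eq[OF l] by blast
        then show ?thesis using False by simp
      qed (use k(2,3) in simp)
    qed
    also have "\<dots> = 1" using fin k(1) by simp
    also have "y - x \<in> ?D"
    proof -
      have "- h \<le> y \<bullet> i - x \<bullet> i \<and> y \<bullet> i - x \<bullet> i \<le> h" if "i \<in> Basis" for i
      proof -
        have "h * (k \<bullet> i) \<le> x \<bullet> i" "x \<bullet> i < h * (k \<bullet> i) + h" "h * (k \<bullet> i) \<le> y \<bullet> i" "y \<bullet> i < h * (k \<bullet> i) + h"
          using k(2,3) that by (auto simp: cell_def distrib_left)
        then show ?thesis by linarith
      qed
      then show ?thesis by (simp add: mem_box inner_diff_left)
    qed
    then have "(1::ennreal) \<le> indicator ?D (y - x)" by simp
    finally show ?thesis .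
  next
    case False
    then have "(\<Sum>k\<in>?K. indicator (cell h k) x * indicator (cell h k) y :: ennreal) = 0"
      by (intro sum.neutral) (auto simp: indicator_def)
    then show ?thesis by simp
  qed
  have set_eq: "(\<integral>\<^sup>+y\<in>cell h k. ennreal ((\<phi> y - \<phi> x)\<^sup>2) \<partial>lborel) * indicator (cell h k) x =
      (\<integral>\<^sup>+y. ennreal ((\<phi> y - \<phi> x)\<^sup>2) * (indicator (cell h k) x * indicator (cell h k) y) \<partial>lborel)" for k x
  proof (cases "x \<in> cell h k")
    case True
    then show ?thesis by simp
  qed simp
  have "(\<Sum>k\<in>?K. \<integral>\<^sup>+x\<in>cell h k. \<integral>\<^sup>+y\<in>cell h k. ennreal ((\<phi> y - \<phi> x)\<^sup>2) \<partial>lborel \<partial>lborel) =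
      (\<Sum>k\<in>?K. \<integral>\<^sup>+x. \<integral>\<^sup>+y. ennreal ((\<phi> y - \<phi> x)\<^sup>2) * (indicator (cell h k) x * indicator (cell h k) y) \<partial>lborel \<partial>lborel)"
    by (intro sum.cong refl nn_integral_cong) (rule set_eq)
  also have "\<dots> = (\<integral>\<^sup>+x. (\<Sum>k\<in>?K. \<integral>\<^sup>+y. ennreal ((\<phi> y - \<phi> x)\<^sup>2) * (indicator (cell h k) x * indicator (cell h k) y) \<partial>lborel) \<partial>lborel)"
    by (rule nn_integral_sum[symmetric]) measurable
  also have "\<dots> = (\<integral>\<^sup>+x. \<integral>\<^sup>+y. (\<Sum>k\<in>?K. ennreal ((\<phi> y - \<phi> x)\<^sup>2) * (indicator (cell h k) x * indicator (cell h k) y)) \<partial>lborel \<partial>lborel)"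
    by (intro nn_integral_cong nn_integral_sum[symmetric]) measurable
  also have "\<dots> \<le> (\<integral>\<^sup>+x. \<integral>\<^sup>+y. ennreal ((\<phi> y - \<phi> x)\<^sup>2) * indicator ?D (y - x) \<partial>lborel \<partial>lborel)"
    unfolding sum_distrib_left[symmetric] by (intro nn_integral_mono mult_left_mono ind) auto
  also have "\<dots> = (\<integral>\<^sup>+x. \<integral>\<^sup>+z. ennreal ((\<phi> (x + z) - \<phi> x)\<^sup>2) * indicator ?D z \<partial>lborel \<partial>lborel)"
  proof (rule nn_integral_cong)
    fix x :: 'a
    show "(\<integral>\<^sup>+y. ennreal ((\<phi> y - \<phi> x)\<^sup>2) * indicator ?D (y - x) \<partial>lborel) =
        (\<integral>\<^sup>+z. ennreal ((\<phi> (x + z) - \<phi> x)\<^sup>2) * indicator ?D z \<partial>lborel)"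
      using nn_integral_lborel_translate[of "\<lambda>y. ennreal ((\<phi> y - \<phi> x)\<^sup>2) * indicator ?D (y - x)" x] by simp
  qed
  also have "\<dots> = (\<integral>\<^sup>+z. \<integral>\<^sup>+x. ennreal ((\<phi> (x + z) - \<phi> x)\<^sup>2) * indicator ?D z \<partial>lborel \<partial>lborel)"
    by (rule lborel_pair.Fubini'[symmetric]) measurable
  also have "\<dots> = (\<integral>\<^sup>+z. (\<integral>\<^sup>+x. ennreal ((\<phi> (z + x) - \<phi> x)\<^sup>2) \<partial>lborel) * indicator ?D z \<partial>lborel)"
    by (intro nn_integral_cong) (simp add: nn_integral_multc add.commute)
  also have "\<dots> \<le> (\<integral>\<^sup>+z. (ennreal ((DIM('a) * h)\<^sup>2) * ?G) * indicator ?D z \<partial>lborel)"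
  proof (rule nn_integral_mono)
    fix z :: 'a
    show "(\<integral>\<^sup>+x. ennreal ((\<phi> (z + x) - \<phi> x)\<^sup>2) \<partial>lborel) * indicator ?D z \<le> (ennreal ((DIM('a) * h)\<^sup>2) * ?G) * indicator ?D z"
    proof (cases "z \<in> ?D")
      case True
      have "(\<integral>\<^sup>+x. ennreal ((\<phi> (z + x) - \<phi> x)\<^sup>2) \<partial>lborel) \<le> ennreal ((norm z)\<^sup>2) * ?G"
        by (rule translation_estimate[OF sm])
      also have "\<dots> \<le> ennreal ((DIM('a) * h)\<^sup>2) * ?G"
        using D[OF True] by (intro mult_right_mono ennreal_leI power_mono) auto
      finally show ?thesis using True by simp
    qed simp
  qed
  also have "\<dots> = ennreal ((DIM('a) * h)\<^sup>2) * ?G * emeasure lborel ?D"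
    by (simp add: nn_integral_cmult)
  also have "emeasure lborel ?D = ennreal ((2 * h) ^ DIM('a))"
  proof -
    have "(\<Prod>i\<in>(Basis::'a set). (h *\<^sub>R One - - (h *\<^sub>R One)) \<bullet> i) = (\<Prod>i\<in>(Basis::'a set). 2 * h)"
      by (rule prod.cong[OF refl]) (simp add: inner_add_left)
    then show ?thesis using h by (subst emeasure_lborel_cbox) auto
  qed
  finally show ?thesis
    using h by (simp add: ennreal_mult mult_ac)
qed

lemma test_functions_integrable_mult:
  assumes \<phi>: "\<phi> \<in> test_functions \<Omega>" and [measurable]: "\<psi> \<in> borel_measurable borel" and b: "\<And>x. \<bar>\<psi> x\<bar> \<le> (C::real)"
  shows "integrable lborel (\<lambda>x. \<psi> x * \<phi> x)"
proof -
  have K: "bounded (closure {x. \<phi> x \<noteq> 0})" using \<phi> by (auto simp: test_functions_iff intro: compact_imp_bounded)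
  obtain D where D: "\<And>x. \<bar>\<phi> x\<bar> \<le> D" using test_functions_bounded[OF \<phi>] by blast
  have C: "C \<ge> 0" using b[of 0] by linarith
  note [measurable] = smooth_borel_measurable[OF test_functions_smooth[OF \<phi>]]
  show ?thesis
  proof (rule bounded_support_integrable[OF _ _ _ K, where C = "C * D"])
    show "norm (\<psi> x * \<phi> x) \<le> C * D" for x
      unfolding real_norm_def abs_mult by (intro mult_mono b D C abs_ge_zero)
    show "\<psi> x * \<phi> x = 0" if "x \<notin> closure {x. \<phi> x \<noteq> 0}" for x
      using that closure_subset[of "{x. \<phi> x \<noteq> 0}"] by auto
  qed measurable
qed

lemma test_functions_square_integrable:
  assumes \<phi>: "\<phi> \<in> test_functions \<Omega>"
  shows "integrable lborel (\<lambda>x. (\<phi> x)\<^sup>2)" "integrable lborel (\<lambda>x. (norm (grad \<phi> x))\<^sup>2)"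
proof -
  obtain D where D: "\<And>x. \<bar>\<phi> x\<bar> \<le> D" using test_functions_bounded[OF \<phi>] by blast
  show "integrable lborel (\<lambda>x. (\<phi> x)\<^sup>2)"
    using test_functions_integrable_mult[OF \<phi> smooth_borel_measurable[OF test_functions_smooth[OF \<phi>]] D]
    by (simp add: power2_eq_square)
  obtain E where E: "E \<ge> 0" "\<And>x. norm (grad \<phi> x) \<le> E" using test_functions_grad_bounded[OF \<phi>] by blast
  note [measurable] = grad_borel_measurable[OF test_functions_smooth[OF \<phi>]]
  have K: "bounded (closure {x. \<phi> x \<noteq> 0})" using \<phi> by (auto simp: test_functions_iff intro: compact_imp_bounded)
  show "integrable lborel (\<lambda>x. (norm (grad \<phi> x))\<^sup>2)"
  proof (rule bounded_support_integrable[OF _ _ _ K, where C = "E\<^sup>2"])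
    show "norm ((norm (grad \<phi> x))\<^sup>2) \<le> E\<^sup>2" for x
      using E(2)[of x] by (simp add: power_mono)
    show "(norm (grad \<phi> x))\<^sup>2 = 0" if "x \<notin> closure {x. \<phi> x \<noteq> 0}" for x
      using grad_eq_0_outside[OF that] by simp
  qed measurable
qed

text \<open>On each cell, \<open>|Q| \<integral> \<phi>\<^sup>2 = (\<integral> \<phi>)\<^sup>2 + \<integral>\<integral> (\<phi> y - \<phi> x)\<^sup>2 / 2\<close>, and the double
  integrals sum to at most an average over small \<open>z\<close> of translation differences.\<close>

lemma cell_Poincare:
  fixes \<phi> :: "'a::euclidean_space \<Rightarrow> real" and h :: real
  assumes \<phi>: "\<phi> \<in> test_functions \<Omega>" and h: "h > 0" and bd: "bounded \<Omega>"
  shows "(LINT x|lborel. (\<phi> x)\<^sup>2) \<le>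
    (\<Sum>k\<in>cell_label h ` \<Omega>. (LINT x|lborel. indicator (cell h k) x * \<phi> x)\<^sup>2) / h ^ DIM('a)
    + 2 ^ DIM('a) * (DIM('a) * h)\<^sup>2 * (LINT x|lborel. (norm (grad \<phi> x))\<^sup>2)"
proof -
  note sm = test_functions_smooth[OF \<phi>]
  note [measurable] = smooth_borel_measurable[OF sm]
  let ?K = "cell_label h ` \<Omega>" and ?v = "h ^ DIM('a)" and ?G = "LINT x|lborel. (norm (grad \<phi> x))\<^sup>2"
  have fin: "finite ?K" by (rule finite_cell_labels[OF h bd])
  have v: "?v > 0" using h by simp
  obtain D where D: "\<And>x. \<bar>\<phi> x\<bar> \<le> D" using test_functions_bounded[OF \<phi>] by blast
  define M where "M k = restrict_space lborel (cell h k)" for k :: 'a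
  have finM: "finite_measure (M k)" and mM: "measure (M k) (space (M k)) = ?v" for k
  proof -
    have "emeasure (M k) (space (M k)) = ennreal ?v"
      by (simp add: M_def emeasure_restrict_space space_restrict_space emeasure_cell[OF h])
    then show "finite_measure (M k)" "measure (M k) (space (M k)) = ?v"
      using v by (auto intro!: finite_measureI simp: measure_def)
  qed
  have measM: "\<phi> \<in> borel_measurable (M k)" for k
    unfolding M_def by (rule measurable_restrict_space1) simp
  define I where "I k = (LINT x|M k. LINT y|M k. (\<phi> y - \<phi> x)\<^sup>2)" for k
  have var: "2 * ?v * (LINT x|M k. (\<phi> x)\<^sup>2) = 2 * (LINT x|M k. \<phi> x)\<^sup>2 + I k" for k
    using finite_measure_variance(1)[OF finM measM D, of k] by (simp add: mM I_def)
  have I: "ennreal (I k) = (\<integral>\<^sup>+x\<in>cell h k. \<integral>\<^sup>+y\<in>cell h k. ennreal ((\<phi> y - \<phi> x)\<^sup>2) \<partial>lborel \<partial>lborel)" for k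
    unfolding I_def finite_measure_variance(2)[OF finM measM D]
    by (simp add: M_def nn_integral_restrict_space)
  have I0: "I k \<ge> 0" for k unfolding I_def by (intro integral_nonneg_AE AE_I2) simp
  have Mint: "(LINT x|M k. f x) = (LINT x|lborel. indicator (cell h k) x * f x)" for k and f :: "'a \<Rightarrow> real"
    unfolding M_def by (subst integral_restrict_space) auto
  have G: "ennreal ?G = (\<integral>\<^sup>+x. ennreal ((norm (grad \<phi> x))\<^sup>2) \<partial>lborel)"
    using test_functions_square_integrable(2)[OF \<phi>] by (intro nn_integral_eq_integral[symmetric]) auto
  have G0: "?G \<ge> 0" by simp
  have "ennreal (\<Sum>k\<in>?K. I k) = (\<Sum>k\<in>?K. ennreal (I k))" using I0 by (simp add: sum_ennreal)
  also have "\<dots> \<le> ennreal ((2 * h) ^ DIM('a) * (DIM('a) * h)\<^sup>2) * ennreal ?G"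
    unfolding I G by (rule cells_difference_estimate[OF sm h fin])
  also have "\<dots> = ennreal ((2 * h) ^ DIM('a) * (DIM('a) * h)\<^sup>2 * ?G)"
    using h G0 by (simp add: ennreal_mult)
  \<comment> \<open>The factor \<open>(2 * h) ^ DIM('a)\<close> is split so that one cell volume
    \<open>?v\<close> appears: it cancels against the division by \<open>?v\<close> below, and the
    surviving \<open>h^2\<close> makes the gradient term small on fine grids.\<close>
  finally have sumI: "(\<Sum>k\<in>?K. I k) \<le> ?v * (2 ^ DIM('a) * (DIM('a) * h)\<^sup>2 * ?G)"
    using h G0 by (subst (asm) ennreal_le_iff) (auto simp: power_mult_distrib mult_ac)
  have "(LINT x|lborel. (\<phi> x)\<^sup>2) = (LINT x|lborel. (\<Sum>k\<in>?K. indicator (cell h k) x * (\<phi> x)\<^sup>2))"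
  proof (intro Bochner_Integration.integral_cong refl)
    fix x
    show "(\<phi> x)\<^sup>2 = (\<Sum>k\<in>?K. indicator (cell h k) x * (\<phi> x)\<^sup>2)"
    proof (cases "x \<in> \<Omega>")
      case True
      have "(\<Sum>k\<in>?K. indicator (cell h k) x * (\<phi> x)\<^sup>2) = (\<Sum>k\<in>?K. if k = cell_label h x then (\<phi> x)\<^sup>2 else 0)"
        by (rule sum.cong) (use mem_cell_iff_label[OF h] in \<open>auto simp: indicator_def\<close>)
      then show ?thesis using fin True by simp
    next
      case False
      then show ?thesis using test_functions_zero_outside[OF \<phi>] by simp
    qed
  qed
  also have "\<dots> = (\<Sum>k\<in>?K. LINT x|lborel. indicator (cell h k) x * (\<phi> x)\<^sup>2)"
  proof (rule Bochner_Integration.integral_sum)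
    fix k
    have "integrable lborel (\<lambda>x. (indicator (cell h k) x * \<phi> x) * \<phi> x)"
    proof (rule test_functions_integrable_mult[OF \<phi>, where C = D])
      show "\<bar>indicator (cell h k) x * \<phi> x\<bar> \<le> D" for x
        using D[of x] by (auto simp: indicator_def abs_if split: if_splits)
    qed measurable
    then show "integrable lborel (\<lambda>x. indicator (cell h k) x * (\<phi> x)\<^sup>2)"
      by (simp add: power2_eq_square mult.assoc)
  qed
  also have "\<dots> = (\<Sum>k\<in>?K. (LINT x|M k. \<phi> x)\<^sup>2 / ?v + I k / (2 * ?v))"
  proof (rule sum.cong[OF refl])
    fix k
    have "(LINT x|M k. (\<phi> x)\<^sup>2) = (LINT x|M k. \<phi> x)\<^sup>2 / ?v + I k / (2 * ?v)"
    proof -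
      have "(LINT x|M k. (\<phi> x)\<^sup>2) = (2 * (LINT x|M k. \<phi> x)\<^sup>2 + I k) / (2 * ?v)"
        using var[of k] h by (subst eq_divide_eq) (simp add: mult.commute)
      then show ?thesis by (simp add: add_divide_distrib)
    qed
    then show "(LINT x|lborel. indicator (cell h k) x * (\<phi> x)\<^sup>2) = (LINT x|M k. \<phi> x)\<^sup>2 / ?v + I k / (2 * ?v)"
      by (simp add: Mint)
  qed
  also have "\<dots> = (\<Sum>k\<in>?K. (LINT x|M k. \<phi> x)\<^sup>2) / ?v + (\<Sum>k\<in>?K. I k) / (2 * ?v)"
    by (simp add: sum.distrib sum_divide_distrib)
  also have "(\<Sum>k\<in>?K. I k) / (2 * ?v) \<le> (?v * (2 ^ DIM('a) * (DIM('a) * h)\<^sup>2 * ?G)) / (2 * ?v)"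
    using sumI v by (intro divide_right_mono) auto
  also have "\<dots> \<le> 2 ^ DIM('a) * (DIM('a) * h)\<^sup>2 * ?G"
    using v G0 by simp
  finally show ?thesis by (simp add: Mint)
qed

text \<open>Bolzano-Weierstrass gives a convergent subsequence for each \<open>j\<close>, and the
  diagonal sequence serves all \<open>j\<close> at once.\<close>

lemma bounded_functionals_convergent_subseq:
  fixes L :: "nat \<Rightarrow> nat \<Rightarrow> real"
  assumes "\<And>j. bounded (range (L j))"
  obtains r :: "nat \<Rightarrow> nat" where "strict_mono r" "\<And>j. convergent (\<lambda>n. L j (r n))"
proof -
  interpret subseqs "\<lambda>j s. convergent (\<lambda>n. L j (s n))"
  proof
    fix j and s :: "nat \<Rightarrow> nat" assume "strict_mono s"
    have "bounded (range (\<lambda>n. L j (s n)))"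
      by (rule bounded_subset[OF assms[of j]]) auto
    from bounded_imp_convergent_subsequence[OF this]
    obtain l r where "strict_mono r" "((\<lambda>n. L j (s n)) \<circ> r) \<longlonglongrightarrow> l" by blast
    then show "\<exists>r'. strict_mono r' \<and> convergent (\<lambda>n. L j ((s \<circ> r') n))"
      by (auto simp: o_def intro: convergentI)
  qed
  have "convergent (\<lambda>n. L j (diagseq n))" for j
  proof -
    \<comment> \<open>The diagonal sequence is a subsequence of the \<open>j\<close>-th selection
      only after its first \<open>Suc j\<close> terms are dropped, which convergence does not
      notice.\<close>
    have "convergent (\<lambda>n. L j ((diagseq \<circ> ((+) (Suc j))) n))"
    proof (rule diagseq_holds)
      fix r s :: "nat \<Rightarrow> nat" and n assume r: "strict_mono r" and "convergent (\<lambda>k. L n (s k))"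
      then have "convergent ((\<lambda>k. L n (s k)) \<circ> r)" by (metis convergent_subseq_convergent)
      then show "convergent (\<lambda>k. L n ((s \<circ> r) k))" by (simp add: o_def)
    qed
    then have "convergent (\<lambda>n. L j (diagseq (n + Suc j)))" by (simp add: o_def add.commute)
    then show ?thesis using convergent_ignore_initial_segment[of "\<lambda>n. L j (diagseq n)" "Suc j"] by simp
  qed
  then show ?thesis using that subseq_diagseq by blast
qed

lemma test_functions_diff:
  "\<phi> \<in> test_functions \<Omega> \<Longrightarrow> \<psi> \<in> test_functions \<Omega> \<Longrightarrow> (\<lambda>x. \<phi> x - \<psi> x) \<in> test_functions \<Omega>"
  using test_functions_add[OF _ test_functions_scale[of \<psi> \<Omega> "-1"], of \<phi>] by simp

lemma grad_diff: "smooth f \<Longrightarrow> smooth g \<Longrightarrow> grad (\<lambda>x. f x - g x) x = grad f x - grad g x"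
  using grad_add[of f "\<lambda>x. (-1) * g x" x] grad_scale[of g "-1" x] smooth_mult[of "\<lambda>x. -1" g] by simp

text \<open>By \<open>cell_Poincare\<close> the \<open>L^2\<close> distance is controlled by
  finitely many cell integrals and a gradient term of order \<open>h^2\<close>. The cell integrals
  over all dyadic grids form countably many bounded sequences, so one subsequence makes all of them
  converge. The grid is refined first; the cell integrals are compared afterwards.\<close>

theorem Rellich_test_functions:
  fixes \<phi> :: "nat \<Rightarrow> 'a::euclidean_space \<Rightarrow> real"
  assumes bd: "bounded \<Omega>" and \<phi>: "\<And>n. \<phi> n \<in> test_functions \<Omega>"
    and b1: "\<And>n. (LINT x|lborel. (\<phi> n x)\<^sup>2) \<le> C" and b2: "\<And>n. (LINT x|lborel. (norm (grad (\<phi> n) x))\<^sup>2) \<le> C"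
  obtains r :: "nat \<Rightarrow> nat" where "strict_mono r"
    "\<And>n m. n \<le> m \<Longrightarrow> (LINT x|lborel. (\<phi> (r n) x - \<phi> (r m) x)\<^sup>2) \<le> (1/2)^n"
proof -
  define H where "H l = (1/2::real)^l" for l :: nat
  have H: "H l > 0" for l by (simp add: H_def)
  define avg where "avg h k n = (LINT x|lborel. indicator (cell h k) x * \<phi> n x)" for h and k :: 'a and n
  have ind_int: "integrable lborel (\<lambda>x. indicator (cell h k) x * \<psi> x)" if "\<psi> \<in> test_functions \<Omega>" for h k \<psi>
    by (rule test_functions_integrable_mult[OF that, where C = 1]) (auto simp: indicator_def)
  define A where "A = (SIGMA l:UNIV. cell_label (H l) ` \<Omega>)"
  have cA: "countable A"
    unfolding A_def by (intro countable_SIGMA countableI_type countable_finite finite_cell_labels[OF H bd])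
  define L where "L j n = avg (H (fst (from_nat_into A j))) (snd (from_nat_into A j)) n" for j n
  have "bounded (range (L j))" for j
  proof -
    let ?h = "H (fst (from_nat_into A j))" and ?k = "snd (from_nat_into A j)"
    let ?v = "?h ^ DIM('a)"
    have "\<bar>L j n\<bar> \<le> ?v + C" for n
    proof -
      note sq = test_functions_square_integrable(1)[OF \<phi>, of n]
      have vi: "integrable lborel (indicator (cell ?h ?k) :: 'a \<Rightarrow> real)"
        using emeasure_cell[OF H, of "fst (from_nat_into A j)" ?k] by (intro integrable_real_indicator) auto
      have "\<bar>L j n\<bar> \<le> (LINT x|lborel. \<bar>indicator (cell ?h ?k) x * \<phi> n x\<bar>)"
        unfolding L_def avg_def by (rule integral_abs_bound)
      also have "\<dots> \<le> (LINT x|lborel. indicator (cell ?h ?k) x + (\<phi> n x)\<^sup>2)"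
      proof (rule integral_mono)
        fix x
        have "0 \<le> (\<bar>\<phi> n x\<bar> - 1)\<^sup>2" by simp
        then have "2 * \<bar>\<phi> n x\<bar> \<le> 1 + (\<phi> n x)\<^sup>2" by (simp add: power2_diff)
        then have "\<bar>\<phi> n x\<bar> \<le> 1 + (\<phi> n x)\<^sup>2" by simp
        then show "\<bar>indicator (cell ?h ?k) x * \<phi> n x\<bar> \<le> indicator (cell ?h ?k) x + (\<phi> n x)\<^sup>2"
          by (simp add: indicator_def)
      qed (use ind_int[OF \<phi>, of ?h ?k n] sq vi in auto)
      also have "\<dots> = ?v + (LINT x|lborel. (\<phi> n x)\<^sup>2)"
        using sq vi emeasure_cell[OF H, of "fst (from_nat_into A j)" ?k] H[of "fst (from_nat_into A j)"]
        by (simp add: measure_def)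
      finally show ?thesis using b1[of n] by simp
    qed
    then show ?thesis by (auto simp: bounded_iff)
  qed
  from bounded_functionals_convergent_subseq[of L, OF this]
  obtain r0 :: "nat \<Rightarrow> nat" where r0: "strict_mono r0" "\<And>j. convergent (\<lambda>n. L j (r0 n))" by blast
  have conv: "convergent (\<lambda>n. avg (H l) k (r0 n))" if "k \<in> cell_label (H l) ` \<Omega>" for l k
  proof -
    have "(l, k) \<in> A" using that by (simp add: A_def)
    then obtain j where "from_nat_into A j = (l, k)" using from_nat_into_surj[OF cA] by metis
    then show ?thesis using r0(2)[of j] by (simp add: L_def)
  qed
  have cauchy: "\<exists>N. \<forall>n\<ge>N. \<forall>m\<ge>N. (LINT x|lborel. (\<phi> (r0 n) x - \<phi> (r0 m) x)\<^sup>2) \<le> e" if e: "e > 0" for e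
  proof -
    \<comment> \<open>\<open>P * h^2\<close> is the gradient term of \<open>cell_Poincare\<close>
      for a difference of two members, whose squared gradient has integral at most
      \<open>4 * C\<close>.\<close>
    define P where "P = 2 ^ DIM('a) * (real DIM('a))\<^sup>2 * (4 * C)"
    have "(\<lambda>l. P * (H l)\<^sup>2) \<longlonglongrightarrow> P * 0\<^sup>2"
      unfolding H_def by (intro tendsto_intros LIMSEQ_realpow_zero) auto
    then have "\<forall>\<^sub>F l in sequentially. P * (H l)\<^sup>2 < e / 2"
      by (rule order_tendstoD) (use e in simp)
    then obtain l where l: "P * (H l)\<^sup>2 < e / 2" by (auto simp: eventually_sequentially)
    let ?K = "cell_label (H l) ` \<Omega>" and ?v = "H l ^ DIM('a)"
    have v: "?v > 0" using H by simp
    have fin: "finite ?K" by (rule finite_cell_labels[OF H bd])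
    \<comment> \<open>With this tolerance the squares of all cell integrals add up to at most
      \<open>e * ?v / 2\<close>. The \<open>+ 1\<close> keeps \<open>\<delta>\<close> positive when
      there are no cells.\<close>
    define \<delta> where "\<delta> = sqrt (e * ?v / (2 * (real (card ?K) + 1)))"
    have \<delta>: "\<delta> > 0" using e v by (simp add: \<delta>_def)
    have "\<exists>N. \<forall>n\<ge>N. \<forall>m\<ge>N. \<bar>avg (H l) k (r0 n) - avg (H l) k (r0 m)\<bar> < \<delta>" if "k \<in> ?K" for k
      using CauchyD[OF convergent_Cauchy[OF conv[OF that]] \<delta>] by simp
    then obtain N where N: "\<And>k n m. k \<in> ?K \<Longrightarrow> n \<ge> N k \<Longrightarrow> m \<ge> N k \<Longrightarrow> \<bar>avg (H l) k (r0 n) - avg (H l) k (r0 m)\<bar> < \<delta>"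
      by metis
    define N0 where "N0 = Max (insert 0 (N ` ?K))"
    have N0: "N k \<le> N0" if "k \<in> ?K" for k
      unfolding N0_def by (rule Max_ge) (use that fin in auto)
    have "(LINT x|lborel. (\<phi> (r0 n) x - \<phi> (r0 m) x)\<^sup>2) \<le> e" if nm: "n \<ge> N0" "m \<ge> N0" for n m
    proof -
      let ?f = "\<phi> (r0 n)" and ?g = "\<phi> (r0 m)"
      note sm = test_functions_smooth[OF \<phi>]
      have d: "(\<lambda>x. ?f x - ?g x) \<in> test_functions \<Omega>" by (intro test_functions_diff \<phi>)
      have av: "(LINT x|lborel. indicator (cell (H l) k) x * (?f x - ?g x)) = avg (H l) k (r0 n) - avg (H l) k (r0 m)" for k
        unfolding avg_def right_diff_distrib by (rule Bochner_Integration.integral_diff[OF ind_int[OF \<phi>] ind_int[OF \<phi>]])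
      have "(\<Sum>k\<in>?K. (LINT x|lborel. indicator (cell (H l) k) x * (?f x - ?g x))\<^sup>2) \<le> (\<Sum>k\<in>?K. \<delta>\<^sup>2)"
      proof (rule sum_mono)
        fix k assume k: "k \<in> ?K"
        have "\<bar>avg (H l) k (r0 n) - avg (H l) k (r0 m)\<bar> \<le> \<delta>"
          using N[OF k order_trans[OF N0[OF k] nm(1)] order_trans[OF N0[OF k] nm(2)]] by simp
        then show "(LINT x|lborel. indicator (cell (H l) k) x * (?f x - ?g x))\<^sup>2 \<le> \<delta>\<^sup>2"
          unfolding av using \<delta> by (simp add: abs_le_square_iff[symmetric])
      qed
      also have "\<dots> \<le> (real (card ?K) + 1) * \<delta>\<^sup>2" by (simp add: distrib_right)
      also have "\<dots> = e * ?v / 2"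
      proof -
        have "\<delta>\<^sup>2 = e * ?v / (2 * (real (card ?K) + 1))" unfolding \<delta>_def using e v by simp
        moreover have "real (card ?K) + 1 > 0" by linarith
        ultimately show ?thesis by (simp add: field_simps)
      qed
      finally have s1: "(\<Sum>k\<in>?K. (LINT x|lborel. indicator (cell (H l) k) x * (?f x - ?g x))\<^sup>2) / ?v \<le> e / 2"
        using v by (simp add: pos_divide_le_eq)
      have "(LINT x|lborel. (norm (grad (\<lambda>x. ?f x - ?g x) x))\<^sup>2)
          \<le> (LINT x|lborel. 2 * (norm (grad ?f x))\<^sup>2 + 2 * (norm (grad ?g x))\<^sup>2)"
      proof (rule integral_mono)
        show "integrable lborel (\<lambda>x. (norm (grad (\<lambda>x. ?f x - ?g x) x))\<^sup>2)"
          by (rule test_functions_square_integrable(2)[OF d])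
        show "integrable lborel (\<lambda>x. 2 * (norm (grad ?f x))\<^sup>2 + 2 * (norm (grad ?g x))\<^sup>2)"
          using test_functions_square_integrable(2)[OF \<phi>] by auto
        fix x
        have "(norm (grad ?f x - grad ?g x))\<^sup>2 + (norm (grad ?f x + grad ?g x))\<^sup>2 = 2 * (norm (grad ?f x))\<^sup>2 + 2 * (norm (grad ?g x))\<^sup>2"
          by (simp add: power2_norm_eq_inner inner_add_left inner_add_right inner_diff_left inner_diff_right inner_commute)
        moreover have "(norm (grad ?f x + grad ?g x))\<^sup>2 \<ge> 0" by simp
        ultimately show "(norm (grad (\<lambda>x. ?f x - ?g x) x))\<^sup>2 \<le> 2 * (norm (grad ?f x))\<^sup>2 + 2 * (norm (grad ?g x))\<^sup>2"
          unfolding grad_diff[OF sm sm] by linarith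
      qed
      also have "\<dots> = 2 * (LINT x|lborel. (norm (grad ?f x))\<^sup>2) + 2 * (LINT x|lborel. (norm (grad ?g x))\<^sup>2)"
        using test_functions_square_integrable(2)[OF \<phi>] by simp
      also have "\<dots> \<le> 4 * C" using b2[of "r0 n"] b2[of "r0 m"] by simp
      finally have g4: "(LINT x|lborel. (norm (grad (\<lambda>x. ?f x - ?g x) x))\<^sup>2) \<le> 4 * C" .
      have "2 ^ DIM('a) * (DIM('a) * H l)\<^sup>2 * (LINT x|lborel. (norm (grad (\<lambda>x. ?f x - ?g x) x))\<^sup>2)
          \<le> 2 ^ DIM('a) * (DIM('a) * H l)\<^sup>2 * (4 * C)"
        by (rule mult_left_mono[OF g4]) simp
      also have "\<dots> = P * (H l)\<^sup>2" by (simp add: P_def power_mult_distrib)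
      finally have s2: "2 ^ DIM('a) * (DIM('a) * H l)\<^sup>2 * (LINT x|lborel. (norm (grad (\<lambda>x. ?f x - ?g x) x))\<^sup>2) \<le> e / 2"
        using l by linarith
      show ?thesis using cell_Poincare[OF d H bd, of l] s1 s2 by linarith
    qed
    then show ?thesis by blast
  qed
  have "\<exists>N. \<forall>n\<ge>N. \<forall>m\<ge>N. (LINT x|lborel. (\<phi> (r0 n) x - \<phi> (r0 m) x)\<^sup>2) \<le> (1/2)^i" for i :: nat
    by (rule cauchy) simp
  then obtain N where N: "\<And>i n m. n \<ge> N i \<Longrightarrow> m \<ge> N i \<Longrightarrow> (LINT x|lborel. (\<phi> (r0 n) x - \<phi> (r0 m) x)\<^sup>2) \<le> (1/2)^i"
    by metis
  obtain s :: "nat \<Rightarrow> nat" where s: "strict_mono s" "\<And>k. N k \<le> s k" using strict_mono_above by metis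
  show ?thesis
  proof (rule that[of "r0 \<circ> s"])
    show "strict_mono (r0 \<circ> s)" by (rule strict_mono_o[OF r0(1) s(1)])
    fix n m :: nat assume "n \<le> m"
    then have "s n \<le> s m" using s(1) by (simp add: strict_mono_less_eq)
    then show "(LINT x|lborel. (\<phi> ((r0 \<circ> s) n) x - \<phi> ((r0 \<circ> s) m) x)\<^sup>2) \<le> (1/2)^n"
      using N[of n "s n" "s m"] s(2)[of n] by simp
  qed
qed

section \<open>Sobolev functions vanishing on the boundary\<close>

text \<open>Convergence to 0 in \<open>L^p\<close>. Membership is demanded as well because the
  Bochner integral of a nonintegrable function is 0, so sequences outside \<open>L^p\<close> could
  satisfy the limit condition.\<close>

definition power_null :: "'a measure \<Rightarrow> real \<Rightarrow> (nat \<Rightarrow> 'a \<Rightarrow> 'b::euclidean_space) \<Rightarrow> bool" where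
  "power_null M p f \<longleftrightarrow> (\<forall>n. power_integrable M p (f n)) \<and> (\<lambda>n. LINT x|M. norm (f n x) powr p) \<longlonglongrightarrow> 0"

lemma nonneg_sandwich_0:
  fixes a b :: "nat \<Rightarrow> real"
  assumes "\<And>n. 0 \<le> a n" "\<And>n. a n \<le> b n" "b \<longlonglongrightarrow> 0"
  shows "a \<longlonglongrightarrow> 0"
  by (rule Lim_null_comparison[OF _ assms(3)]) (use assms(1,2) in simp)

lemma power_null_bound:
  assumes g: "power_null M p g" and f: "\<And>n. f n \<in> borel_measurable M" and p: "p > 0"
    and le: "\<And>n. AE x in M. norm (f n x) \<le> C * norm (g n x)"
  shows "power_null M p f"
  unfolding power_null_def
proof
  have gi: "power_integrable M p (g n)" for n using g by (simp add: power_null_def)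
  have fi: "power_integrable M p (f n)" for n by (rule power_integrable_bound[OF gi f p le])
  then show "\<forall>n. power_integrable M p (f n)" by blast
  have "(LINT x|M. norm (f n x) powr p) \<le> \<bar>C\<bar> powr p * (LINT x|M. norm (g n x) powr p)" for n
  proof -
    have "(LINT x|M. norm (f n x) powr p) \<le> (LINT x|M. \<bar>C\<bar> powr p * norm (g n x) powr p)"
    proof (rule integral_mono_AE)
      show "integrable M (\<lambda>x. norm (f n x) powr p)" "integrable M (\<lambda>x. \<bar>C\<bar> powr p * norm (g n x) powr p)"
        using fi gi by (auto simp: power_integrable_def)
      show "AE x in M. norm (f n x) powr p \<le> \<bar>C\<bar> powr p * norm (g n x) powr p"
        using le[of n]
      proof eventually_elim
        case (elim x)
        have "norm (f n x) \<le> \<bar>C\<bar> * norm (g n x)"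
          using elim mult_right_mono[OF abs_ge_self[of C] norm_ge_zero[of "g n x"]] by linarith
        then have "norm (f n x) powr p \<le> (\<bar>C\<bar> * norm (g n x)) powr p"
          using p by (intro powr_mono2) auto
        then show ?case by (simp add: powr_mult)
      qed
    qed
    then show ?thesis by simp
  qed
  moreover have "(\<lambda>n. \<bar>C\<bar> powr p * (LINT x|M. norm (g n x) powr p)) \<longlonglongrightarrow> \<bar>C\<bar> powr p * 0"
    using g by (intro tendsto_intros) (simp add: power_null_def)
  ultimately show "(\<lambda>n. LINT x|M. norm (f n x) powr p) \<longlonglongrightarrow> 0"
    using nonneg_sandwich_0[of "\<lambda>n. LINT x|M. norm (f n x) powr p"
        "\<lambda>n. \<bar>C\<bar> powr p * (LINT x|M. norm (g n x) powr p)"]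
    by (simp add: Bochner_Integration.integral_nonneg)
qed

lemma power_null_add:
  assumes f: "power_null M p f" and g: "power_null M p g" and p: "p > 0"
  shows "power_null M p (\<lambda>n x. f n x + g n x)"
  unfolding power_null_def
proof
  have i: "power_integrable M p (f n)" "power_integrable M p (g n)" for n
    using f g by (simp_all add: power_null_def)
  have s: "power_integrable M p (\<lambda>x. f n x + g n x)" for n by (rule power_integrable_add[OF i p])
  then show "\<forall>n. power_integrable M p (\<lambda>x. f n x + g n x)" by blast
  let ?B = "\<lambda>n. 2 powr p * ((LINT x|M. norm (f n x) powr p) + (LINT x|M. norm (g n x) powr p))"
  have "(LINT x|M. norm (f n x + g n x) powr p) \<le> ?B n" for n
  proof -
    have "(LINT x|M. norm (f n x + g n x) powr p) \<le> (LINT x|M. 2 powr p * (norm (f n x) powr p + norm (g n x) powr p))"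
      using i s by (intro integral_mono norm_add_powr_le[OF p]) (auto simp: power_integrable_def)
    also have "\<dots> = ?B n" using i by (simp add: power_integrable_def)
    finally show ?thesis .
  qed
  moreover have "?B \<longlonglongrightarrow> 2 powr p * (0 + 0)"
    using f g by (intro tendsto_intros) (simp_all add: power_null_def)
  ultimately show "(\<lambda>n. LINT x|M. norm (f n x + g n x) powr p) \<longlonglongrightarrow> 0"
    using nonneg_sandwich_0[of "\<lambda>n. LINT x|M. norm (f n x + g n x) powr p" ?B]
    by (simp add: Bochner_Integration.integral_nonneg)
qed

lemma power_null_subseq:
  "power_null M p f \<Longrightarrow> strict_mono r \<Longrightarrow> power_null M p (\<lambda>n. f (r n))"
  unfolding power_null_def using LIMSEQ_subseq_LIMSEQ by (fastforce simp: o_def)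

lemma power_null_dominated:
  assumes f: "\<And>n. f n \<in> borel_measurable M" and w: "power_integrable M p w" and p: "p > 0"
    and lim: "AE x in M. (\<lambda>n. f n x) \<longlonglongrightarrow> 0"
    and le: "\<And>n. AE x in M. norm (f n x) \<le> C * norm (w x)"
  shows "power_null M p f"
  unfolding power_null_def
proof
  show "\<forall>n. power_integrable M p (f n)" using power_integrable_bound[OF w f p le] by blast
  have "(\<lambda>n. LINT x|M. norm (f n x - 0) powr p) \<longlonglongrightarrow> 0"
  proof (rule power_dominated_convergence[OF f _ p lim])
    show "integrable M (\<lambda>x. \<bar>C\<bar> powr p * norm (w x) powr p)" using w by (simp add: power_integrable_def)
    show "AE x in M. norm (f n x - 0) powr p \<le> \<bar>C\<bar> powr p * norm (w x) powr p" for n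
      using le[of n]
    proof eventually_elim
      case (elim x)
      have "norm (f n x) \<le> \<bar>C\<bar> * norm (w x)"
        using elim mult_right_mono[OF abs_ge_self[of C] norm_ge_zero[of "w x"]] by linarith
      then have "norm (f n x) powr p \<le> (\<bar>C\<bar> * norm (w x)) powr p"
        using p by (intro powr_mono2) auto
      then show ?case by (simp add: powr_mult)
    qed
  qed simp
  then show "(\<lambda>n. LINT x|M. norm (f n x) powr p) \<longlonglongrightarrow> 0" by simp
qed

lemma power_null_imp_dominated_subseq:
  assumes "power_null M p f" "p > 0"
  obtains r :: "nat \<Rightarrow> nat" and w :: "'a \<Rightarrow> real"
  where "strict_mono r" "integrable M w" "AE x in M. (\<lambda>k. f (r k) x) \<longlonglongrightarrow> 0"
    "AE x in M. \<forall>k. norm (f (r k) x) powr p \<le> w x"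
proof -
  have i: "power_integrable M p (f n)" for n using assms(1) by (simp add: power_null_def)
  have z: "power_integrable M p (\<lambda>x. 0 :: 'b)" by (simp add: power_integrable_def)
  have l: "(\<lambda>n. LINT x|M. norm (f n x - 0) powr p) \<longlonglongrightarrow> 0" using assms(1) by (simp add: power_null_def)
  show ?thesis
    by (rule power_conv_imp_dominated_subseq[OF i z assms(2) l]) (rule that; simp)
qed

text \<open>Beyond the threshold \<open>e\<close> the power \<open>t powr p\<close> takes over. On a
  finite measure this yields the passage from \<open>L^p\<close> to \<open>L^1\<close>: the second
  term tends to 0 for fixed \<open>e\<close>, and the first is small with \<open>e\<close>.\<close>

lemma norm_le_eps_powr:
  fixes t :: real
  assumes "t \<ge> 0" "e > 0" "p \<ge> 1"
  shows "t \<le> e + e powr (1 - p) * t powr p"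
proof (cases "t \<le> e")
  case True
  then show ?thesis using mult_nonneg_nonneg[OF powr_ge_zero[of e "1-p"] powr_ge_zero[of t p]] by linarith
next
  case False
  then have t: "t > 0" "t \<ge> e" using assms by auto
  have "t = t powr (1 - p) * t powr p" using t(1) by (simp add: powr_add[symmetric])
  also have "\<dots> \<le> e powr (1 - p) * t powr p"
    by (intro mult_right_mono powr_mono2') (use assms t in auto)
  finally show ?thesis using assms by simp
qed

lemma power_integrable_imp_1:
  assumes "finite_measure M" "power_integrable M p f" "p \<ge> 1"
  shows "power_integrable M 1 f" "integrable M f"
proof -
  interpret finite_measure M by fact
  have m: "f \<in> borel_measurable M" using assms by (simp add: power_integrable_def)
  show "integrable M f"
  proof (rule Bochner_Integration.integrable_bound)
    show "integrable M (\<lambda>x. 1 + norm (f x) powr p)" using assms(2) by (simp add: power_integrable_def)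
    show "AE x in M. norm (f x) \<le> norm (1 + norm (f x) powr p)"
      using norm_le_eps_powr[of "norm (f _)" 1 p] assms(3) by (auto intro!: AE_I2)
  qed (fact m)
  then show "power_integrable M 1 f" using m by (simp add: power_integrable_def)
qed

lemma power_null_imp_1:
  assumes fin: "finite_measure M" and f: "power_null M p f" and p: "p \<ge> 1"
  shows "power_null M 1 f"
  unfolding power_null_def
proof
  interpret finite_measure M by fact
  have fi: "power_integrable M p (f n)" for n using f by (simp add: power_null_def)
  note f1 = power_integrable_imp_1[OF fin fi p]
  then show "\<forall>n. power_integrable M 1 (f n)" by blast
  let ?m = "measure M (space M)"
  have le: "(LINT x|M. norm (f n x) powr 1) \<le> e * ?m + e powr (1 - p) * (LINT x|M. norm (f n x) powr p)" if "e > 0" for e n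
  proof -
    have "(LINT x|M. norm (f n x) powr 1) \<le> (LINT x|M. e + e powr (1 - p) * norm (f n x) powr p)"
      using f1(1)[of n] fi[of n] norm_le_eps_powr[OF norm_ge_zero that p]
      by (intro integral_mono) (auto simp: power_integrable_def)
    also have "\<dots> = e * ?m + e powr (1 - p) * (LINT x|M. norm (f n x) powr p)"
      using fi[of n] by (simp add: power_integrable_def mult.commute)
    finally show ?thesis .
  qed
  show "(\<lambda>n. LINT x|M. norm (f n x) powr 1) \<longlonglongrightarrow> 0"
  proof (rule order_tendstoI)
    fix a :: real assume "a < 0"
    then show "\<forall>\<^sub>F n in sequentially. a < (LINT x|M. norm (f n x) powr 1)"
      by (intro always_eventually allI less_le_trans[OF _ integral_nonneg_AE]) auto
  next
    fix a :: real assume a: "a > 0"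
    \<comment> \<open>The first term then contributes at most \<open>a / 2\<close>; the
      \<open>+ 1\<close> admits a space of measure 0.\<close>
    define e where "e = a / (2 * (?m + 1))"
    have m: "?m + 1 > 0" by (simp add: add_nonneg_pos)
    have e: "e > 0" "e * ?m < a" 
    proof -
      show "e > 0" using a m by (simp add: e_def)
      have "e * ?m \<le> e * (?m + 1)" using \<open>e > 0\<close> by simp
      also have "\<dots> = a / 2"
      proof -
        have "a / (2 * y) * y = a / 2" if "y > 0" for y :: real using that by simp
        from this[OF m] show ?thesis by (simp only: e_def)
      qed
      finally show "e * ?m < a" using a by simp
    qed
    have "(\<lambda>n. e * ?m + e powr (1 - p) * (LINT x|M. norm (f n x) powr p)) \<longlonglongrightarrow> e * ?m + e powr (1 - p) * 0"
      using f by (intro tendsto_intros) (simp add: power_null_def)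
    then have "\<forall>\<^sub>F n in sequentially. e * ?m + e powr (1 - p) * (LINT x|M. norm (f n x) powr p) < a"
      by (rule order_tendstoD) (use e in simp)
    then show "\<forall>\<^sub>F n in sequentially. (LINT x|M. norm (f n x) powr 1) < a"
      by eventually_elim (use le[OF e(1)] in \<open>rule le_less_trans\<close>)
  qed
qed

lemma Lp_eq_power_integrable: "Lp p \<Omega> = {f. power_integrable (lebesgue_on \<Omega>) p f}"
  by (auto simp: Lp_def power_integrable_def)

lemma bounded_power_integrable:
  assumes "finite_measure M" "f \<in> borel_measurable M" "\<And>x. norm (f x) \<le> C" "p > 0"
  shows "power_integrable M p f"
proof -
  interpret finite_measure M by fact
  have "norm (f x) powr p \<le> C powr p" for x using assms(3,4) by (intro powr_mono2) auto
  then show ?thesis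
    using assms(2) unfolding power_integrable_def by (auto intro!: integrable_const_bound[where B = "C powr p"])
qed

lemma bounded_open_finite_measure:
  fixes \<Omega> :: "'a::euclidean_space set"
  assumes "open \<Omega>" "bounded \<Omega>"
  shows "finite_measure (lebesgue_on \<Omega>)"
  using assms by (intro finite_measure_lebesgue_on lmeasurable_open)

lemma test_functions_power_integrable:
  assumes "open \<Omega>" "bounded \<Omega>" "\<phi> \<in> test_functions \<Omega>" "p > 0"
  shows "power_integrable (lebesgue_on \<Omega>) p \<phi>" "power_integrable (lebesgue_on \<Omega>) p (grad \<phi>)"
proof -
  note fin = bounded_open_finite_measure[OF assms(1,2)] and sm = test_functions_smooth[OF assms(3)]
  obtain C where "\<And>x. \<bar>\<phi> x\<bar> \<le> C" using test_functions_bounded[OF assms(3)] by blast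
  then show "power_integrable (lebesgue_on \<Omega>) p \<phi>"
    by (intro bounded_power_integrable[OF fin _ _ assms(4)] borel_measurable_lebesgue_onI smooth_borel_measurable[OF sm]) auto
  obtain D where "\<And>x. norm (grad \<phi> x) \<le> D" using test_functions_grad_bounded[OF assms(3)] by blast
  then show "power_integrable (lebesgue_on \<Omega>) p (grad \<phi>)"
    by (intro bounded_power_integrable[OF fin _ _ assms(4)] borel_measurable_lebesgue_onI grad_borel_measurable[OF sm]) auto
qed

text \<open>The gradient is an explicit argument, which avoids the choice made by \<open>weak_grad\<close>.\<close>

definition sobolev0 :: "real \<Rightarrow> 'a::euclidean_space set \<Rightarrow> ('a \<Rightarrow> real) \<Rightarrow> ('a \<Rightarrow> 'a) \<Rightarrow> bool" where
  "sobolev0 p \<Omega> u g \<longleftrightarrow>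
    power_integrable (lebesgue_on \<Omega>) p u \<and> power_integrable (lebesgue_on \<Omega>) p g \<and>
    (\<exists>\<phi>. (\<forall>n. \<phi> n \<in> test_functions \<Omega>) \<and>
      power_null (lebesgue_on \<Omega>) p (\<lambda>n x. u x - \<phi> n x) \<and>
      power_null (lebesgue_on \<Omega>) p (\<lambda>n x. g x - grad (\<phi> n) x))"

lemma integral_mult_bounded_tendsto:
  fixes f :: "nat \<Rightarrow> 'a \<Rightarrow> real"
  assumes d: "power_null M 1 (\<lambda>n x. g x - f n x)" and g: "integrable M g"
    and \<psi>: "\<psi> \<in> borel_measurable M" "\<And>x. \<bar>\<psi> x\<bar> \<le> C"
  shows "(\<lambda>n. LINT x|M. f n x * \<psi> x) \<longlonglongrightarrow> (LINT x|M. g x * \<psi> x)"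
proof -
  have di: "integrable M (\<lambda>x. g x - f n x)" for n
  proof -
    have "power_integrable M 1 (\<lambda>x. g x - f n x)" using d by (simp add: power_null_def)
    then show ?thesis
      using integrable_norm_cancel[of M "\<lambda>x. g x - f n x"] by (simp add: power_integrable_def)
  qed
  have mi: "integrable M (\<lambda>x. h x * \<psi> x)" if "integrable M h" for h :: "'a \<Rightarrow> real"
  proof (rule Bochner_Integration.integrable_bound[where f = "\<lambda>x. C * h x"])
    show "AE x in M. norm (h x * \<psi> x) \<le> norm (C * h x)"
    proof (rule AE_I2)
      fix x
      have "\<bar>\<psi> x\<bar> \<le> \<bar>C\<bar>" using \<psi>(2)[of x] by linarith
      then show "norm (h x * \<psi> x) \<le> norm (C * h x)"
        by (simp add: abs_mult mult.commute mult_right_mono)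
    qed
  qed (use that \<psi> in auto)
  have p0: "power_null M 1 (\<lambda>n x. (g x - f n x) * \<psi> x)"
  proof (rule power_null_bound[OF d, where C = C])
    show "(\<lambda>x. (g x - f n x) * \<psi> x) \<in> borel_measurable M" for n using mi[OF di] by simp
    show "AE x in M. norm ((g x - f n x) * \<psi> x) \<le> C * norm (g x - f n x)" for n
      using \<psi>(2) by (intro AE_I2) (simp add: abs_mult mult.commute mult_right_mono)
  qed simp
  have "(\<lambda>n. LINT x|M. (g x - f n x) * \<psi> x) \<longlonglongrightarrow> 0"
  proof (rule Lim_null_comparison)
    show "(\<lambda>n. LINT x|M. norm ((g x - f n x) * \<psi> x) powr 1) \<longlonglongrightarrow> 0"
      using p0 by (simp add: power_null_def)
    show "\<forall>\<^sub>F n in sequentially. norm (LINT x|M. (g x - f n x) * \<psi> x) \<le> (LINT x|M. norm ((g x - f n x) * \<psi> x) powr 1)"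
      by (intro always_eventually allI) (simp add: integral_abs_bound)
  qed
  from tendsto_diff[OF tendsto_const[of "LINT x|M. g x * \<psi> x"] this]
  have "(\<lambda>n. (LINT x|M. g x * \<psi> x) - (LINT x|M. (g x - f n x) * \<psi> x)) \<longlonglongrightarrow> (LINT x|M. g x * \<psi> x)" by simp
  moreover have "(LINT x|M. g x * \<psi> x) - (LINT x|M. (g x - f n x) * \<psi> x) = (LINT x|M. f n x * \<psi> x)" for n
    by (subst Bochner_Integration.integral_diff[OF mi[OF g] mi[OF di], symmetric])
      (simp add: left_diff_distrib)
  ultimately show ?thesis by simp
qed

lemma integrable_imp_locally_integrable:
  assumes f: "integrable (lebesgue_on \<Omega>) f" and \<Omega>: "\<Omega> \<in> sets lebesgue"
  shows "locally_integrable_on \<Omega> f"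
  unfolding locally_integrable_on_def
proof (intro allI impI)
  fix K :: "'a set" assume K: "compact K" "K \<subseteq> \<Omega>"
  have Ks: "K \<in> sets lebesgue" using K(1) by (simp add: compact_imp_closed)
  have "integrable lebesgue (\<lambda>x. indicator \<Omega> x *\<^sub>R f x)"
    using f \<Omega> by (simp add: integrable_restrict_space)
  from integrable_mult_indicator[OF Ks this]
  have "integrable lebesgue (\<lambda>x. indicator K x *\<^sub>R (indicator \<Omega> x *\<^sub>R f x))" .
  also have "(\<lambda>x. indicator K x *\<^sub>R (indicator \<Omega> x *\<^sub>R f x)) = (\<lambda>x. indicator K x *\<^sub>R f x)"
    using K(2) by (auto simp: indicator_def fun_eq_iff)
  finally show "integrable (lebesgue_on K) f" using Ks by (simp add: integrable_restrict_space)
qed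

text \<open>Both sides of the integration by parts formula for test functions pass to the limit: a
  finite measure turns \<open>L^p\<close> convergence into \<open>L^1\<close> convergence, and
  \<open>\<psi>\<close> and its gradient are bounded.\<close>

lemma sobolev0_has_weak_grad:
  assumes \<Omega>: "open \<Omega>" "bounded \<Omega>" and p: "p \<ge> 1" and s: "sobolev0 p \<Omega> u g"
  shows "has_weak_grad \<Omega> u g"
proof -
  let ?M = "lebesgue_on \<Omega>"
  note fin = bounded_open_finite_measure[OF \<Omega>]
  have \<Omega>': "\<Omega> \<in> sets lebesgue" using \<Omega> by simp
  obtain \<phi> where \<phi>: "\<And>n. \<phi> n \<in> test_functions \<Omega>" and nu: "power_null ?M p (\<lambda>n x. u x - \<phi> n x)"
    and ng: "power_null ?M p (\<lambda>n x. g x - grad (\<phi> n) x)"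
    using s by (auto simp: sobolev0_def)
  have ui: "integrable ?M u" and gi: "integrable ?M g"
    using s power_integrable_imp_1(2)[OF fin _ p] by (auto simp: sobolev0_def)
  note nu1 = power_null_imp_1[OF fin nu p] and ng1 = power_null_imp_1[OF fin ng p]
  show ?thesis
    unfolding has_weak_grad_def
  proof (intro conjI ballI integrable_imp_locally_integrable[OF ui \<Omega>'] integrable_imp_locally_integrable[OF gi \<Omega>'])
    fix \<psi> and i :: 'a assume \<psi>: "\<psi> \<in> test_functions \<Omega>" and i: "i \<in> Basis"
    note sm = test_functions_smooth[OF \<psi>]
    obtain C where C: "\<And>x. \<bar>\<psi> x\<bar> \<le> C" using test_functions_bounded[OF \<psi>] by blast
    obtain D where D: "\<And>x. norm (grad \<psi> x) \<le> D" using test_functions_grad_bounded[OF \<psi>] by blast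
    have D': "\<bar>grad \<psi> x \<bullet> i\<bar> \<le> D" for x using Basis_le_norm[OF i, of "grad \<psi> x"] D[of x] by linarith
    have m1: "(\<lambda>x. grad \<psi> x \<bullet> i) \<in> borel_measurable ?M"
      by (rule borel_measurable_lebesgue_onI) (use grad_borel_measurable[OF sm] in simp)
    have m2: "\<psi> \<in> borel_measurable ?M" by (rule borel_measurable_lebesgue_onI[OF smooth_borel_measurable[OF sm]])
    have c: "power_null ?M 1 (\<lambda>n x. g x \<bullet> i - grad (\<phi> n) x \<bullet> i)"
    proof (rule power_null_bound[OF ng1, where C = 1])
      show "(\<lambda>x. g x \<bullet> i - grad (\<phi> n) x \<bullet> i) \<in> borel_measurable ?M" for n
        using gi borel_measurable_lebesgue_onI[OF grad_borel_measurable[OF test_functions_smooth[OF \<phi>[of n]]], of \<Omega>] by simp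
      show "AE x in ?M. norm (g x \<bullet> i - grad (\<phi> n) x \<bullet> i) \<le> 1 * norm (g x - grad (\<phi> n) x)" for n
        using Basis_le_norm[OF i] by (intro AE_I2) (simp add: inner_diff_left[symmetric])
    qed simp
    have gi': "integrable ?M (\<lambda>x. g x \<bullet> i)" using gi by simp
    have l1: "(\<lambda>n. LINT x|?M. \<phi> n x * (grad \<psi> x \<bullet> i)) \<longlonglongrightarrow> (LINT x|?M. u x * (grad \<psi> x \<bullet> i))"
      by (rule integral_mult_bounded_tendsto[OF nu1 ui m1 D'])
    have eq: "(\<lambda>n. LINT x|?M. \<phi> n x * (grad \<psi> x \<bullet> i)) = (\<lambda>n. - (LINT x|?M. (grad (\<phi> n) x \<bullet> i) * \<psi> x))"
    proof
      fix n
      have "\<forall>\<psi>\<in>test_functions \<Omega>. \<forall>i\<in>Basis. (LINT x|?M. \<phi> n x * (grad \<psi> x \<bullet> i)) = - (LINT x|?M. (grad (\<phi> n) x \<bullet> i) * \<psi> x)"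
        using has_weak_grad_test_function[OF \<phi>[of n] \<Omega>'] unfolding has_weak_grad_def by blast
      then show "(LINT x|?M. \<phi> n x * (grad \<psi> x \<bullet> i)) = - (LINT x|?M. (grad (\<phi> n) x \<bullet> i) * \<psi> x)"
        using \<psi> i by blast
    qed
    have l2: "(\<lambda>n. - (LINT x|?M. (grad (\<phi> n) x \<bullet> i) * \<psi> x)) \<longlonglongrightarrow> - (LINT x|?M. (g x \<bullet> i) * \<psi> x)"
      by (intro tendsto_minus integral_mult_bounded_tendsto[OF c gi' m2 C])
    show "(LINT x|?M. u x * (grad \<psi> x \<bullet> i)) = - (LINT x|?M. (g x \<bullet> i) * \<psi> x)"
      by (rule LIMSEQ_unique[OF l1[unfolded eq] l2])
  qed
qed

lemma weak_grad_AE_eq: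
  assumes "has_weak_grad \<Omega> u g" "open \<Omega>"
  shows "AE x in lebesgue_on \<Omega>. weak_grad \<Omega> u x = g x"
  using has_weak_grad_unique[OF someI[of "has_weak_grad \<Omega> u", OF assms(1)] assms] by (simp add: weak_grad_def)

text \<open>The representative chosen by \<open>weak_grad\<close> is known only to be locally
  integrable. Its measurability on \<open>\<Omega>\<close>, required for comparing integrals, is
  pieced together from a countable cover by compact boxes.\<close>

lemma locally_integrable_imp_measurable:
  assumes f: "locally_integrable_on \<Omega> f" and \<Omega>: "open \<Omega>"
  shows "f \<in> borel_measurable (lebesgue_on \<Omega>)"
proof -
  obtain \<D> where \<D>: "countable \<D>" "\<D> \<subseteq> Pow \<Omega>" "\<And>X. X \<in> \<D> \<Longrightarrow> \<exists>a b. X = cbox a b" "\<Union>\<D> = \<Omega>"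
    using open_countable_Union_open_cbox[OF \<Omega>] by metis
  have X: "X \<subseteq> \<Omega>" "X \<in> sets lebesgue" "compact X" if "X \<in> \<D>" for X
    using \<D>(2) \<D>(3)[OF that] that by auto
  show ?thesis
  proof (rule measurable_piecewise_restrict[OF \<D>(1)])
    show "space (lebesgue_on \<Omega>) \<subseteq> \<Union>\<D>" using \<D>(4) by simp
    fix X assume XD: "X \<in> \<D>"
    show "X \<inter> space (lebesgue_on \<Omega>) \<in> sets (lebesgue_on \<Omega>)"
      using X[OF XD] \<Omega> by (auto simp: sets_restrict_space)
    have "restrict_space (lebesgue_on \<Omega>) X = lebesgue_on X"
      using X[OF XD] \<Omega> by (simp add: restrict_restrict_space Int_absorb1)
    moreover have "f \<in> borel_measurable (lebesgue_on X)"
      using f X[OF XD] by (simp add: locally_integrable_on_def borel_measurable_integrable)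
    ultimately show "f \<in> borel_measurable (restrict_space (lebesgue_on \<Omega>) X)" by simp
  qed
qed

lemma integral_weak_grad_eq:
  assumes g: "has_weak_grad \<Omega> u g" and \<Omega>: "open \<Omega>"
  shows "(LINT x|lebesgue_on \<Omega>. norm (weak_grad \<Omega> u x) powr p) = (LINT x|lebesgue_on \<Omega>. norm (g x) powr p)"
proof (rule integral_cong_AE)
  have w: "has_weak_grad \<Omega> u (weak_grad \<Omega> u)"
    unfolding weak_grad_def by (rule someI[of "has_weak_grad \<Omega> u", OF g])
  have "weak_grad \<Omega> u \<in> borel_measurable (lebesgue_on \<Omega>)" "g \<in> borel_measurable (lebesgue_on \<Omega>)"
    using g w by (auto simp: has_weak_grad_def intro!: locally_integrable_imp_measurable[OF _ \<Omega>])
  then show "(\<lambda>x. norm (weak_grad \<Omega> u x) powr p) \<in> borel_measurable (lebesgue_on \<Omega>)"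
    "(\<lambda>x. norm (g x) powr p) \<in> borel_measurable (lebesgue_on \<Omega>)" by measurable
  show "AE x in lebesgue_on \<Omega>. norm (weak_grad \<Omega> u x) powr p = norm (g x) powr p"
    using weak_grad_AE_eq[OF g \<Omega>] by eventually_elim simp
qed

text \<open>The norm of \<open>u - \<phi> n\<close> involves the chosen weak gradient of the
  difference. By uniqueness it equals \<open>g - grad (\<phi> n)\<close> almost everywhere, so the
  norm is computed from the two null sequences.\<close>

lemma sobolev0_imp_W1_0:
  assumes \<Omega>: "open \<Omega>" "bounded \<Omega>" and p: "p \<ge> 1" and s: "sobolev0 p \<Omega> u g"
  shows "u \<in> W1_0 p \<Omega>"
proof -
  let ?M = "lebesgue_on \<Omega>"
  have \<Omega>': "\<Omega> \<in> sets lebesgue" using \<Omega> by simp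
  obtain \<phi> where \<phi>: "\<And>n. \<phi> n \<in> test_functions \<Omega>" and nu: "power_null ?M p (\<lambda>n x. u x - \<phi> n x)"
    and ng: "power_null ?M p (\<lambda>n x. g x - grad (\<phi> n) x)"
    using s by (auto simp: sobolev0_def)
  note wg = sobolev0_has_weak_grad[OF \<Omega> p s]
  have "\<exists>\<phi>\<in>test_functions \<Omega>. W1_norm p \<Omega> (\<lambda>x. u x - \<phi> x) < \<epsilon>" if "\<epsilon> > 0" for \<epsilon>
  proof -
    have eq: "W1_norm p \<Omega> (\<lambda>x. u x - \<phi> n x) = (LINT x|?M. norm (u x - \<phi> n x) powr p) powr (1/p)
        + (LINT x|?M. norm (g x - grad (\<phi> n) x) powr p) powr (1/p)" for n
      unfolding W1_norm_def Lp_norm_def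
      using integral_weak_grad_eq[OF has_weak_grad_diff[OF wg has_weak_grad_test_function[OF \<phi> \<Omega>'] \<Omega>'] \<Omega>(1), of n p]
      by simp
    have "(\<lambda>n. W1_norm p \<Omega> (\<lambda>x. u x - \<phi> n x)) \<longlonglongrightarrow> 0 powr (1/p) + 0 powr (1/p)"
      unfolding eq using nu ng p
      by (intro tendsto_add tendsto_powr') (auto simp: power_null_def intro!: tendsto_intros always_eventually)
    then have "\<forall>\<^sub>F n in sequentially. W1_norm p \<Omega> (\<lambda>x. u x - \<phi> n x) < \<epsilon>"
      by (rule order_tendstoD) (use that in simp)
    then obtain n where "W1_norm p \<Omega> (\<lambda>x. u x - \<phi> n x) < \<epsilon>"
      by (auto simp: eventually_sequentially)
    then show ?thesis using \<phi> by blast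
  qed
  moreover have "u \<in> W1 p \<Omega>"
    using s wg by (auto simp: W1_def Lp_eq_power_integrable sobolev0_def)
  ultimately show ?thesis by (simp add: W1_0_def)
qed

lemma W1_0_imp_sobolev0:
  assumes \<Omega>: "open \<Omega>" "bounded \<Omega>" and p: "p \<ge> 1" and u: "u \<in> W1_0 p \<Omega>"
  obtains g where "sobolev0 p \<Omega> u g"
proof -
  let ?M = "lebesgue_on \<Omega>"
  have \<Omega>': "\<Omega> \<in> sets lebesgue" using \<Omega> by simp
  have p0: "p > 0" using p by simp
  obtain g where g: "power_integrable ?M p g" "has_weak_grad \<Omega> u g" and ui: "power_integrable ?M p u"
    using u by (auto simp: W1_0_def W1_def Lp_eq_power_integrable)
  define e where "e n = 1 / real (Suc n)" for n
  have e: "e \<longlonglongrightarrow> 0" "\<And>n. e n > 0"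
    unfolding e_def by (rule LIMSEQ_inverse_real_of_nat[unfolded inverse_eq_divide]) simp
  have "\<exists>\<phi>\<in>test_functions \<Omega>. W1_norm p \<Omega> (\<lambda>x. u x - \<phi> x) < e n" for n
    using u e(2)[of n] by (simp add: W1_0_def)
  then obtain \<phi> where \<phi>: "\<And>n. \<phi> n \<in> test_functions \<Omega>" "\<And>n. W1_norm p \<Omega> (\<lambda>x. u x - \<phi> n x) < e n"
    by metis
  define a where "a n = (LINT x|?M. norm (u x - \<phi> n x) powr p)" for n
  define b where "b n = (LINT x|?M. norm (g x - grad (\<phi> n) x) powr p)" for n
  have ab0: "a n \<ge> 0" "b n \<ge> 0" for n by (simp_all add: a_def b_def integral_nonneg_AE)
  have "W1_norm p \<Omega> (\<lambda>x. u x - \<phi> n x) = a n powr (1/p) + b n powr (1/p)" for n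
    unfolding W1_norm_def Lp_norm_def a_def b_def
    using integral_weak_grad_eq[OF has_weak_grad_diff[OF g(2) has_weak_grad_test_function[OF \<phi>(1) \<Omega>'] \<Omega>'] \<Omega>(1), of n p]
    by simp
  then have sum: "a n powr (1/p) + b n powr (1/p) < e n" for n using \<phi>(2)[of n] by simp
  have "a n powr (1/p) \<le> e n" "b n powr (1/p) \<le> e n" for n
    using sum[of n] powr_ge_zero[of "a n" "1/p"] powr_ge_zero[of "b n" "1/p"] by linarith+
  then have "(a n powr (1/p)) powr p \<le> e n powr p" "(b n powr (1/p)) powr p \<le> e n powr p" for n
    using p0 by (auto intro!: powr_mono2)
  then have le: "a n \<le> e n powr p" "b n \<le> e n powr p" for n
    using p0 ab0 by (simp_all add: powr_powr)
  have "(\<lambda>n. e n powr p) \<longlonglongrightarrow> 0 powr p"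
    using e p0 by (intro tendsto_powr') (auto intro!: tendsto_intros always_eventually less_imp_le)
  then have ep: "(\<lambda>n. e n powr p) \<longlonglongrightarrow> 0" by simp
  have "a \<longlonglongrightarrow> 0" "b \<longlonglongrightarrow> 0"
    by (rule nonneg_sandwich_0[OF ab0(1) le(1) ep], rule nonneg_sandwich_0[OF ab0(2) le(2) ep])
  moreover note power_integrable_diff[OF ui test_functions_power_integrable(1)[OF \<Omega> \<phi>(1) p0] p0]
    power_integrable_diff[OF g(1) test_functions_power_integrable(2)[OF \<Omega> \<phi>(1) p0] p0]
  ultimately have "sobolev0 p \<Omega> u g"
    unfolding sobolev0_def power_null_def using ui g(1) \<phi>(1)
    by (intro conjI exI[of _ \<phi>]) (simp_all add: a_def[abs_def] b_def[abs_def])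
  then show ?thesis by (rule that)
qed

text \<open>A diagonal choice: each \<open>v n\<close> is replaced by a test function whose error
  integrals, for the function and for the gradient, are below \<open>1 / (n + 1)\<close>.\<close>

lemma sobolev0_closed:
  assumes \<Omega>: "open \<Omega>" "bounded \<Omega>" and p: "p \<ge> 1"
    and s: "\<And>n. sobolev0 p \<Omega> (v n) (h n)"
    and u: "power_integrable (lebesgue_on \<Omega>) p u" and g: "power_integrable (lebesgue_on \<Omega>) p g"
    and nu: "power_null (lebesgue_on \<Omega>) p (\<lambda>n x. u x - v n x)"
    and ng: "power_null (lebesgue_on \<Omega>) p (\<lambda>n x. g x - h n x)"
  shows "sobolev0 p \<Omega> u g"
proof -
  let ?M = "lebesgue_on \<Omega>"
  have p0: "p > 0" using p by simp
  define e where "e n = 1 / real (Suc n)" for n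
  have e: "e \<longlonglongrightarrow> 0" "\<And>n. e n > 0"
    unfolding e_def by (rule LIMSEQ_inverse_real_of_nat[unfolded inverse_eq_divide]) simp
  define Q where "Q n \<psi> \<longleftrightarrow> \<psi> \<in> test_functions \<Omega> \<and> power_integrable ?M p (\<lambda>x. v n x - \<psi> x) \<and>
     power_integrable ?M p (\<lambda>x. h n x - grad \<psi> x) \<and>
     (LINT x|?M. norm (v n x - \<psi> x) powr p) < e n \<and> (LINT x|?M. norm (h n x - grad \<psi> x) powr p) < e n" for n \<psi>
  have "\<exists>\<psi>. Q n \<psi>" for n
  proof -
    obtain \<phi> where \<phi>: "\<And>m. \<phi> m \<in> test_functions \<Omega>" and a: "power_null ?M p (\<lambda>m x. v n x - \<phi> m x)"
      and b: "power_null ?M p (\<lambda>m x. h n x - grad (\<phi> m) x)"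
      using s[of n] by (auto simp: sobolev0_def)
    have la: "(\<lambda>m. LINT x|?M. norm (v n x - \<phi> m x) powr p) \<longlonglongrightarrow> 0"
      and lb: "(\<lambda>m. LINT x|?M. norm (h n x - grad (\<phi> m) x) powr p) \<longlonglongrightarrow> 0"
      using a b by (simp_all add: power_null_def)
    have "\<forall>\<^sub>F m in sequentially. (LINT x|?M. norm (v n x - \<phi> m x) powr p) < e n \<and> (LINT x|?M. norm (h n x - grad (\<phi> m) x) powr p) < e n"
      by (intro eventually_conj order_tendstoD(2)[OF la e(2)] order_tendstoD(2)[OF lb e(2)])
    from eventually_happens'[OF sequentially_bot this]
    obtain m where "(LINT x|?M. norm (v n x - \<phi> m x) powr p) < e n" "(LINT x|?M. norm (h n x - grad (\<phi> m) x) powr p) < e n"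
      by blast
    moreover have "power_integrable ?M p (\<lambda>x. v n x - \<phi> m x)" "power_integrable ?M p (\<lambda>x. h n x - grad (\<phi> m) x)"
      using a b by (simp_all add: power_null_def)
    ultimately show ?thesis using \<phi>[of m] unfolding Q_def by blast
  qed
  then obtain \<psi> where Q: "\<And>n. Q n (\<psi> n)" by metis
  then have \<psi>: "\<psi> n \<in> test_functions \<Omega>" "power_integrable ?M p (\<lambda>x. v n x - \<psi> n x)"
    "power_integrable ?M p (\<lambda>x. h n x - grad (\<psi> n) x)"
    "(LINT x|?M. norm (v n x - \<psi> n x) powr p) < e n" "(LINT x|?M. norm (h n x - grad (\<psi> n) x) powr p) < e n" for n
    unfolding Q_def by blast+
  have "(\<lambda>n. LINT x|?M. norm (v n x - \<psi> n x) powr p) \<longlonglongrightarrow> 0"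
    by (rule nonneg_sandwich_0[OF Bochner_Integration.integral_nonneg less_imp_le[OF \<psi>(4)] e(1)]) simp
  then have a: "power_null ?M p (\<lambda>n x. v n x - \<psi> n x)" using \<psi>(2) by (simp add: power_null_def)
  have "(\<lambda>n. LINT x|?M. norm (h n x - grad (\<psi> n) x) powr p) \<longlonglongrightarrow> 0"
    by (rule nonneg_sandwich_0[OF Bochner_Integration.integral_nonneg less_imp_le[OF \<psi>(5)] e(1)]) simp
  then have b: "power_null ?M p (\<lambda>n x. h n x - grad (\<psi> n) x)" using \<psi>(3) by (simp add: power_null_def)
  have "power_null ?M p (\<lambda>n x. u x - \<psi> n x)" "power_null ?M p (\<lambda>n x. g x - grad (\<psi> n) x)"
    using power_null_add[OF nu a p0] power_null_add[OF ng b p0] by simp_all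
  then show ?thesis unfolding sobolev0_def using u g \<psi>(1) by blast
qed

lemma sobolev0_imp_sobolev0_1:
  assumes \<Omega>: "open \<Omega>" "bounded \<Omega>" and p: "p \<ge> 1" and s: "sobolev0 p \<Omega> u g"
  shows "sobolev0 1 \<Omega> u g"
proof -
  note fin = bounded_open_finite_measure[OF \<Omega>]
  obtain \<phi> where \<phi>: "\<forall>n. \<phi> n \<in> test_functions \<Omega>"
    and a: "power_null (lebesgue_on \<Omega>) p (\<lambda>n x. u x - \<phi> n x)"
    and b: "power_null (lebesgue_on \<Omega>) p (\<lambda>n x. g x - grad (\<phi> n) x)"
    using s by (auto simp: sobolev0_def)
  have "power_integrable (lebesgue_on \<Omega>) 1 u" "power_integrable (lebesgue_on \<Omega>) 1 g"
    using s power_integrable_imp_1(1)[OF fin _ p] by (auto simp: sobolev0_def)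
  with \<phi> power_null_imp_1[OF fin a p] power_null_imp_1[OF fin b p] show ?thesis
    unfolding sobolev0_def by blast
qed

section \<open>Chain rules\<close>

lemma real_Lipschitz:
  fixes R :: "real \<Rightarrow> real"
  assumes "\<And>t. (R has_real_derivative R' t) (at t)" "\<And>t. \<bar>R' t\<bar> \<le> C"
  shows "\<bar>R s - R t\<bar> \<le> C * \<bar>s - t\<bar>"
proof -
  have "norm (R s - R t) \<le> C * norm (s - t)"
    by (rule field_differentiable_bound[where S = UNIV and f' = R']) (use assms in auto)
  then show ?thesis by simp
qed

text \<open>The gradient error splits into \<open>R' \<phi> * (g - grad \<phi>)\<close>, small
  because \<open>R'\<close> is bounded, and \<open>(R' u - R' \<phi>) * g\<close>, which tends to 0
  pointwise along a subsequence and is dominated by \<open>2 * C * |g|\<close>.\<close>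

lemma sobolev0_compose_smooth:
  fixes R :: "real \<Rightarrow> real"
  assumes \<Omega>: "open \<Omega>" "bounded \<Omega>" and p: "p \<ge> 1" and s: "sobolev0 p \<Omega> u g"
    and R: "smooth R" "R 0 = 0" "\<And>t. (R has_real_derivative R' t) (at t)" "\<And>t. \<bar>R' t\<bar> \<le> C"
  shows "sobolev0 p \<Omega> (\<lambda>x. R (u x)) (\<lambda>x. R' (u x) *\<^sub>R g x)"
proof -
  let ?M = "lebesgue_on \<Omega>"
  have p0: "p > 0" using p by simp
  have dR: "deriv R = R'" using R(3) by (auto intro: DERIV_imp_deriv)
  have sR': "smooth R'" using smooth_real_derivative(2)[OF R(1)] by (simp add: dR)
  have contR: "continuous_on UNIV R" "continuous_on UNIV R'" by (rule smooth_continuous[OF R(1)], rule smooth_continuous[OF sR'])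
  note [measurable] = smooth_borel_measurable[OF R(1)] smooth_borel_measurable[OF sR']
  have lip: "\<bar>R a - R b\<bar> \<le> C * \<bar>a - b\<bar>" for a b by (rule real_Lipschitz[OF R(3,4)])
  obtain \<phi> where \<phi>: "\<And>n. \<phi> n \<in> test_functions \<Omega>" and nu: "power_null ?M p (\<lambda>n x. u x - \<phi> n x)"
    and ng: "power_null ?M p (\<lambda>n x. g x - grad (\<phi> n) x)"
    using s by (auto simp: sobolev0_def)
  obtain r :: "nat \<Rightarrow> nat" and w where r: "strict_mono r" "AE x in ?M. (\<lambda>k. u x - \<phi> (r k) x) \<longlonglongrightarrow> 0"
    by (rule power_null_imp_dominated_subseq[OF nu p0])
  have ui: "power_integrable ?M p u" and gi: "power_integrable ?M p g" using s by (simp_all add: sobolev0_def)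
  have [measurable]: "u \<in> borel_measurable ?M" "g \<in> borel_measurable ?M" using ui gi by (simp_all add: power_integrable_def)
  have [measurable]: "\<phi> n \<in> borel_measurable ?M" "grad (\<phi> n) \<in> borel_measurable ?M" for n
    using smooth_borel_measurable grad_borel_measurable test_functions_smooth[OF \<phi>[of n]]
    by (auto intro!: borel_measurable_lebesgue_onI)
  have 1: "power_null ?M p (\<lambda>n x. R (u x) - R (\<phi> (r n) x))"
    by (rule power_null_bound[OF power_null_subseq[OF nu r(1)] _ p0, where C = C])
      (use lip in \<open>auto intro!: AE_I2\<close>)
  have 2: "power_null ?M p (\<lambda>n x. R' (\<phi> (r n) x) *\<^sub>R (g x - grad (\<phi> (r n)) x))"
  proof (rule power_null_bound[OF power_null_subseq[OF ng r(1)] _ p0, where C = C])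
    show "AE x in ?M. norm (R' (\<phi> (r n) x) *\<^sub>R (g x - grad (\<phi> (r n)) x)) \<le> C * norm (g x - grad (\<phi> (r n)) x)" for n
      using R(4) by (intro AE_I2) (simp add: mult_right_mono)
  qed measurable
  have 3: "power_null ?M p (\<lambda>n x. (R' (u x) - R' (\<phi> (r n) x)) *\<^sub>R g x)"
  proof (rule power_null_dominated[OF _ gi p0, where C = "2 * C"])
    show "AE x in ?M. (\<lambda>n. (R' (u x) - R' (\<phi> (r n) x)) *\<^sub>R g x) \<longlonglongrightarrow> 0"
      using r(2)
    proof eventually_elim
      case (elim x)
      from tendsto_diff[OF tendsto_const[of "u x"] elim] have "(\<lambda>n. \<phi> (r n) x) \<longlonglongrightarrow> u x" by simp
      then have "(\<lambda>n. R' (\<phi> (r n) x)) \<longlonglongrightarrow> R' (u x)"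
        using contR(2) by (auto intro: continuous_on_tendsto_compose[of UNIV R'])
      from tendsto_scaleR[OF tendsto_diff[OF tendsto_const[of "R' (u x)"] this] tendsto_const[of "g x"]]
      show ?case by simp
    qed
    show "AE x in ?M. norm ((R' (u x) - R' (\<phi> (r n) x)) *\<^sub>R g x) \<le> 2 * C * norm (g x)" for n
    proof (rule AE_I2)
      fix x
      have "\<bar>R' (u x) - R' (\<phi> (r n) x)\<bar> \<le> 2 * C" using R(4)[of "u x"] R(4)[of "\<phi> (r n) x"] by linarith
      then show "norm ((R' (u x) - R' (\<phi> (r n) x)) *\<^sub>R g x) \<le> 2 * C * norm (g x)" by (simp add: mult_right_mono)
    qed
  qed measurable
  have gr: "grad (\<lambda>x. R (\<phi> (r n) x)) x = R' (\<phi> (r n) x) *\<^sub>R grad (\<phi> (r n)) x" for n x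
    by (simp add: grad_compose[OF R(1) test_functions_smooth[OF \<phi>]] dR)
  have 4: "power_null ?M p (\<lambda>n x. R' (u x) *\<^sub>R g x - grad (\<lambda>x. R (\<phi> (r n) x)) x)"
    using power_null_add[OF 2 3 p0] by (simp add: gr algebra_simps)
  have "power_integrable ?M p (\<lambda>x. R (u x))"
    by (rule power_integrable_bound[OF ui _ p0, where C = C]) (use lip[of _ 0] R(2) in \<open>auto intro!: AE_I2\<close>)
  moreover have "power_integrable ?M p (\<lambda>x. R' (u x) *\<^sub>R g x)"
    by (rule power_integrable_bound[OF gi _ p0, where C = C]) (use R(4) in \<open>auto intro!: AE_I2 mult_right_mono\<close>)
  moreover have "\<forall>n. (\<lambda>x. R (\<phi> (r n) x)) \<in> test_functions \<Omega>"
    using test_functions_compose[OF \<phi> R(1,2)] by blast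
  ultimately show ?thesis using 1 4 unfolding sobolev0_def by (intro conjI exI[of _ "\<lambda>n x. R (\<phi> (r n) x)"])
qed

text \<open>This reaches functions with kinks as limits of smooth ones. The derivatives converge at
  every \<open>t\<close>, so the value of \<open>\<rho>\<close> at a kink is the one the
  approximation produces; the bounds by \<open>C\<close> survive the limit and provide the
  domination.\<close>

lemma sobolev0_compose_limit:
  fixes R R' :: "nat \<Rightarrow> real \<Rightarrow> real"
  assumes \<Omega>: "open \<Omega>" "bounded \<Omega>" and p: "p \<ge> 1" and s: "sobolev0 p \<Omega> u g"
    and R: "\<And>n. smooth (R n)" "\<And>n. R n 0 = 0" "\<And>n t. (R n has_real_derivative R' n t) (at t)" "\<And>n t. \<bar>R' n t\<bar> \<le> C"
    and lim: "\<And>t. (\<lambda>n. R n t) \<longlonglongrightarrow> \<tau> t" "\<And>t. (\<lambda>n. R' n t) \<longlonglongrightarrow> \<rho> t"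
  shows "sobolev0 p \<Omega> (\<lambda>x. \<tau> (u x)) (\<lambda>x. \<rho> (u x) *\<^sub>R g x)"
proof -
  let ?M = "lebesgue_on \<Omega>"
  have p0: "p > 0" using p by simp
  have ui: "power_integrable ?M p u" and gi: "power_integrable ?M p g" using s by (simp_all add: sobolev0_def)
  have [measurable]: "u \<in> borel_measurable ?M" "g \<in> borel_measurable ?M" using ui gi by (simp_all add: power_integrable_def)
  have Rm [measurable]: "R n \<in> borel_measurable borel" for n by (rule smooth_borel_measurable[OF R(1)])
  have R'm [measurable]: "R' n \<in> borel_measurable borel" for n
  proof -
    have "deriv (R n) = R' n" using R(3) by (auto intro: DERIV_imp_deriv)
    then show ?thesis using smooth_borel_measurable[OF smooth_real_derivative(2)[OF R(1)[of n]]] by simp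
  qed
  have [measurable]: "\<tau> \<in> borel_measurable borel" by (rule borel_measurable_LIMSEQ_real[OF lim(1) Rm])
  have [measurable]: "\<rho> \<in> borel_measurable borel" by (rule borel_measurable_LIMSEQ_real[OF lim(2) R'm])
  have bR: "\<bar>R n t\<bar> \<le> C * \<bar>t\<bar>" for n t using real_Lipschitz[OF R(3,4), of n t 0] R(2) by simp
  have b\<tau>: "\<bar>\<tau> t\<bar> \<le> C * \<bar>t\<bar>" for t
    by (rule LIMSEQ_le_const2[OF tendsto_rabs[OF lim(1)]]) (use bR in auto)
  have b\<rho>: "\<bar>\<rho> t\<bar> \<le> C" for t
    by (rule LIMSEQ_le_const2[OF tendsto_rabs[OF lim(2)]]) (use R(4) in auto)
  show ?thesis
  proof (rule sobolev0_closed[OF \<Omega> p sobolev0_compose_smooth[OF \<Omega> p s R]])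
    show "power_integrable ?M p (\<lambda>x. \<tau> (u x))"
      by (rule power_integrable_bound[OF ui _ p0, where C = C]) (use b\<tau> in \<open>auto intro!: AE_I2\<close>)
    show "power_integrable ?M p (\<lambda>x. \<rho> (u x) *\<^sub>R g x)"
      by (rule power_integrable_bound[OF gi _ p0, where C = C]) (use b\<rho> in \<open>auto intro!: AE_I2 mult_right_mono\<close>)
    show "power_null ?M p (\<lambda>n x. \<tau> (u x) - R n (u x))"
    proof (rule power_null_dominated[OF _ ui p0, where C = "2 * C"])
      show "AE x in ?M. (\<lambda>n. \<tau> (u x) - R n (u x)) \<longlonglongrightarrow> 0"
      proof (rule AE_I2)
        fix x
        show "(\<lambda>n. \<tau> (u x) - R n (u x)) \<longlonglongrightarrow> 0"
          using tendsto_diff[OF tendsto_const[of "\<tau> (u x)"] lim(1)[of "u x"]] by simp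
      qed
      show "AE x in ?M. norm (\<tau> (u x) - R n (u x)) \<le> 2 * C * norm (u x)" for n
      proof (rule AE_I2)
        fix x
        show "norm (\<tau> (u x) - R n (u x)) \<le> 2 * C * norm (u x)"
          using b\<tau>[of "u x"] bR[of n "u x"] unfolding real_norm_def mult.assoc by linarith
      qed
    qed measurable
    show "power_null ?M p (\<lambda>n x. \<rho> (u x) *\<^sub>R g x - R' n (u x) *\<^sub>R g x)"
    proof (rule power_null_dominated[OF _ gi p0, where C = "2 * C"])
      show "AE x in ?M. (\<lambda>n. \<rho> (u x) *\<^sub>R g x - R' n (u x) *\<^sub>R g x) \<longlonglongrightarrow> 0"
      proof (rule AE_I2)
        fix x
        show "(\<lambda>n. \<rho> (u x) *\<^sub>R g x - R' n (u x) *\<^sub>R g x) \<longlonglongrightarrow> 0"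
          using tendsto_diff[OF tendsto_const tendsto_scaleR[OF lim(2)[of "u x"] tendsto_const[of "g x"]], of "\<rho> (u x) *\<^sub>R g x"] by simp
      qed
      show "AE x in ?M. norm (\<rho> (u x) *\<^sub>R g x - R' n (u x) *\<^sub>R g x) \<le> 2 * C * norm (g x)" for n
      proof (rule AE_I2)
        fix x
        have "\<bar>\<rho> (u x) - R' n (u x)\<bar> \<le> 2 * C" using b\<rho>[of "u x"] R(4)[of n "u x"] by linarith
        then show "norm (\<rho> (u x) *\<^sub>R g x - R' n (u x) *\<^sub>R g x) \<le> 2 * C * norm (g x)"
          by (simp add: scaleR_diff_left[symmetric] mult_right_mono)
      qed
    qed measurable
  qed
qed

section \<open>Truncations\<close>

lemma sqrt_square_plus_one_has_derivative:
  "((\<lambda>x::real. sqrt (x\<^sup>2 + 1)) has_real_derivative x * (1 / sqrt (x\<^sup>2 + 1))) (at x)"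
proof -
  have "x\<^sup>2 + 1 > 0" by (simp add: add_nonneg_pos)
  then show ?thesis by (auto intro!: derivative_eq_intros simp: field_simps)
qed

lemma smooth_sqrt_square_plus_one: "smooth (\<lambda>x::real. sqrt (x\<^sup>2 + 1))"
  by (rule smooth_realI[OF sqrt_square_plus_one_has_derivative])
    (intro smooth_mult smooth_ident smooth_inverse_sqrt)

lemma sqrt_square_plus_one_derivative_bound: "\<bar>x * (1 / sqrt (x\<^sup>2 + 1))\<bar> \<le> (1::real)"
proof -
  have "\<bar>x\<bar> \<le> sqrt (x\<^sup>2 + 1)" by (rule real_le_rsqrt) simp
  moreover have "sqrt (x\<^sup>2 + 1) > 0" by (simp add: add_nonneg_pos)
  ultimately show ?thesis by (simp add: abs_mult)
qed

lemma sqrt_square_plus_one_scaled_tendsto: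
  "(\<lambda>n. sqrt ((real (Suc n) * x)\<^sup>2 + 1) / real (Suc n)) \<longlonglongrightarrow> \<bar>x\<bar>"
proof -
  have "(\<lambda>n. sqrt (x\<^sup>2 + (1 / real (Suc n))\<^sup>2)) \<longlonglongrightarrow> sqrt (x\<^sup>2 + 0\<^sup>2)"
    by (intro tendsto_intros LIMSEQ_inverse_real_of_nat[unfolded inverse_eq_divide])
  moreover have "sqrt ((real (Suc n) * x)\<^sup>2 + 1) / real (Suc n) = sqrt (x\<^sup>2 + (1 / real (Suc n))\<^sup>2)" for n
  proof -
    have "sqrt ((real (Suc n) * x)\<^sup>2 + 1) / real (Suc n) = sqrt (((real (Suc n) * x)\<^sup>2 + 1) / (real (Suc n))\<^sup>2)"
      by (simp add: real_sqrt_divide del: of_nat_Suc)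
    also have "((real (Suc n) * x)\<^sup>2 + 1) / (real (Suc n))\<^sup>2 = x\<^sup>2 + (1 / real (Suc n))\<^sup>2"
      by (simp add: add_divide_distrib power_mult_distrib power_divide del: of_nat_Suc)
    finally show ?thesis .
  qed
  ultimately show ?thesis by simp
qed

text \<open>Away from 0 the expression is \<open>x\<close> divided by the smoothed absolute value;
  at \<open>x = 0\<close> all terms are 0, in agreement with \<open>sgn 0\<close>. Convergence thus
  holds at every point.\<close>

lemma sqrt_square_plus_one_derivative_scaled_tendsto:
  "(\<lambda>n. (real (Suc n) * x) * (1 / sqrt ((real (Suc n) * x)\<^sup>2 + 1))) \<longlonglongrightarrow> sgn x"
proof (cases "x = 0")
  case False
  have "(\<lambda>n. x / (sqrt ((real (Suc n) * x)\<^sup>2 + 1) / real (Suc n))) \<longlonglongrightarrow> x / \<bar>x\<bar>"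
    by (intro tendsto_divide tendsto_const sqrt_square_plus_one_scaled_tendsto) (use False in simp)
  moreover have "x / (sqrt ((real (Suc n) * x)\<^sup>2 + 1) / real (Suc n)) = (real (Suc n) * x) * (1 / sqrt ((real (Suc n) * x)\<^sup>2 + 1))" for n
    by (simp add: mult.commute del: of_nat_Suc)
  moreover have "x / \<bar>x\<bar> = sgn x" using False by (simp add: sgn_if)
  ultimately show ?thesis by (simp only:)
qed simp

lemma trunc_eq_abs: "L > 0 \<Longrightarrow> trunc L t = (\<bar>t + L\<bar> - \<bar>t - L\<bar>) / 2"
  by (simp add: trunc_def max_def min_def abs_if)

lemma abs_trunc_le: "L > 0 \<Longrightarrow> \<bar>trunc L t\<bar> \<le> \<bar>t\<bar>"
  by (simp add: trunc_def max_def min_def abs_if)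

text \<open>Truncation of \<open>sinh\<close> is \<open>sinh\<close> of a truncation, and the inner truncation
  \<open>(\<bar>t + L\<bar> - \<bar>t - L\<bar>) / 2\<close> is smoothed by replacing \<open>\<bar>x\<bar>\<close> with
  \<open>sqrt ((N x)\<^sup>2 + 1) / N\<close>.\<close>

lemma sobolev0_trunc_sinh:
  assumes \<Omega>: "open \<Omega>" "bounded \<Omega>" and p: "p \<ge> 1" and s: "sobolev0 p \<Omega> w G" and k: "k > 0"
  obtains \<rho> where "sobolev0 p \<Omega> (\<lambda>x. trunc k (sinh (w x))) (\<lambda>x. \<rho> (w x) *\<^sub>R G x)"
    "\<And>t. \<bar>\<rho> t\<bar> \<le> cosh t" "\<And>t. \<bar>sinh t\<bar> < k \<Longrightarrow> \<rho> t = cosh t"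
proof -
  define L where "L = arsinh k"
  have L: "L > 0" "sinh L = k" using k by (simp_all add: L_def)
  define q where "q x = sqrt (x\<^sup>2 + 1)" for x :: real
  define q' where "q' x = x * (1 / sqrt (x\<^sup>2 + 1))" for x :: real
  have dq: "(q has_real_derivative q' x) (at x)" for x
    unfolding q_def[abs_def] q'_def by (rule sqrt_square_plus_one_has_derivative)
  have q'1: "\<bar>q' x\<bar> \<le> 1" for x unfolding q'_def by (rule sqrt_square_plus_one_derivative_bound)
  have sq: "smooth q" unfolding q_def[abs_def] by (rule smooth_sqrt_square_plus_one)
  define N where "N n = real (Suc n)" for n
  have N: "N n > 0" for n by (simp add: N_def)
  define V where "V n t = (1 / (2 * N n)) * (q (N n * (t + L)) - q (N n * (t - L)))" for n t
  define V' where "V' n t = (q' (N n * (t + L)) - q' (N n * (t - L))) / 2" for n t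
  have dV: "(V n has_real_derivative V' n t) (at t)" for n t
  proof -
    have a: "((\<lambda>t. q (N n * (t + L))) has_real_derivative q' (N n * (t + L)) * N n) (at t)"
      by (rule DERIV_chain2[OF dq]) (auto intro!: derivative_eq_intros)
    have b: "((\<lambda>t. q (N n * (t - L))) has_real_derivative q' (N n * (t - L)) * N n) (at t)"
      by (rule DERIV_chain2[OF dq]) (auto intro!: derivative_eq_intros)
    have "(1 / (2 * N n)) * (q' (N n * (t + L)) * N n - q' (N n * (t - L)) * N n) = V' n t"
      using N[of n] by (simp add: V'_def left_diff_distrib[symmetric])
    with DERIV_cmult[OF DERIV_diff[OF a b], of "1 / (2 * N n)"] show ?thesis
      unfolding V_def[abs_def] by simp
  qed
  have sV: "smooth (V n)" for n
    unfolding V_def[abs_def]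
    by (intro smooth_mult smooth_const smooth_diff smooth_compose[OF sq] smooth_add smooth_ident)
  have V'1: "\<bar>V' n t\<bar> \<le> 1" for n t
  proof -
    have "\<bar>q' (N n * (t + L)) - q' (N n * (t - L))\<bar> \<le> 2"
      using abs_triangle_ineq4[of "q' (N n * (t + L))" "q' (N n * (t - L))"]
        q'1[of "N n * (t + L)"] q'1[of "N n * (t - L)"] by linarith
    then show ?thesis by (simp add: V'_def)
  qed
  have V0: "V n 0 = 0" for n by (simp add: V_def q_def)
  \<comment> \<open>\<open>sinh\<close> is not globally Lipschitz, so the smoothed truncations must
    themselves stay in \<open>[-L, L]\<close> to keep \<open>cosh (V n t)\<close> below
    \<open>cosh L\<close>. They do because \<open>q\<close> is 1-Lipschitz and its two arguments
    differ by \<open>2 * N n * L\<close>.\<close>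
  have VL: "\<bar>V n t\<bar> \<le> L" for n t
  proof -
    have "\<bar>q (N n * (t + L)) - q (N n * (t - L))\<bar> \<le> 1 * \<bar>N n * (t + L) - N n * (t - L)\<bar>"
      by (rule real_Lipschitz[OF dq q'1])
    also have "N n * (t + L) - N n * (t - L) = 2 * N n * L" by (simp add: algebra_simps)
    finally have "\<bar>q (N n * (t + L)) - q (N n * (t - L))\<bar> \<le> 2 * N n * L"
      using N[of n] L(1) by (simp add: abs_mult)
    then have "(1 / (2 * N n)) * \<bar>q (N n * (t + L)) - q (N n * (t - L))\<bar> \<le> (1 / (2 * N n)) * (2 * N n * L)"
      using N[of n] by (intro mult_left_mono) auto
    then show ?thesis using N[of n] by (simp add: V_def abs_mult)
  qed
  have limV: "(\<lambda>n. V n t) \<longlonglongrightarrow> trunc L t" for t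
  proof -
    have "(\<lambda>n. (q (N n * (t + L)) / N n - q (N n * (t - L)) / N n) / 2) \<longlonglongrightarrow> (\<bar>t + L\<bar> - \<bar>t - L\<bar>) / 2"
      unfolding q_def N_def by (intro tendsto_intros sqrt_square_plus_one_scaled_tendsto) simp
    moreover have "V n t = (q (N n * (t + L)) / N n - q (N n * (t - L)) / N n) / 2" for n
      by (simp add: V_def diff_divide_distrib)
    ultimately show ?thesis unfolding trunc_eq_abs[OF L(1)] by (simp only:)
  qed
  \<comment> \<open>The factor after \<open>cosh\<close> is 1 inside \<open>(-L, L)\<close>, 0
    outside \<open>[-L, L]\<close>, and 1/2 at the two kinks, where it is the limit of the smoothed
    derivatives.\<close>
  define \<rho> where "\<rho> t = cosh (trunc L t) * ((sgn (t + L) - sgn (t - L)) / 2)" for t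
  have limV': "(\<lambda>n. V' n t) \<longlonglongrightarrow> (sgn (t + L) - sgn (t - L)) / 2" for t
    unfolding V'_def q'_def N_def by (intro tendsto_intros sqrt_square_plus_one_derivative_scaled_tendsto) simp
  have cosh_mono: "cosh x \<le> cosh y" if "\<bar>x\<bar> \<le> \<bar>y\<bar>" for x y :: real
    using cosh_real_nonneg_le_iff[of "\<bar>x\<bar>" "\<bar>y\<bar>"] that by simp
  show ?thesis
  proof (rule that[of \<rho>])
    have "sobolev0 p \<Omega> (\<lambda>x. sinh (trunc L (w x))) (\<lambda>x. \<rho> (w x) *\<^sub>R G x)"
    proof (rule sobolev0_compose_limit[OF \<Omega> p s, where R = "\<lambda>n t. sinh (V n t)" and R' = "\<lambda>n t. cosh (V n t) * V' n t" and C = "cosh L"])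
      show "smooth (\<lambda>t. sinh (V n t))" for n by (rule smooth_compose[OF smooth_sinh sV])
      show "sinh (V n 0) = 0" for n by (simp add: V0)
      show "((\<lambda>t. sinh (V n t)) has_real_derivative cosh (V n t) * V' n t) (at t)" for n t
        by (rule DERIV_chain2[OF _ dV]) (auto intro!: derivative_eq_intros)
      show "\<bar>cosh (V n t) * V' n t\<bar> \<le> cosh L" for n t
      proof -
        have "\<bar>cosh (V n t) * V' n t\<bar> \<le> cosh (V n t) * 1"
          unfolding abs_mult by (intro mult_mono V'1) auto
        also have "\<dots> \<le> cosh L" using cosh_mono[of "V n t" L] VL[of n t] L(1) by simp
        finally show ?thesis .
      qed
      show "(\<lambda>n. sinh (V n t)) \<longlonglongrightarrow> sinh (trunc L t)" for t by (intro tendsto_intros limV)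
      show "(\<lambda>n. cosh (V n t) * V' n t) \<longlonglongrightarrow> \<rho> t" for t
        unfolding \<rho>_def by (intro tendsto_mult limV' tendsto_intros limV)
    qed
    moreover have "sinh (trunc L t) = trunc k (sinh t)" for t
    proof -
      have low: "- k \<le> sinh t \<longleftrightarrow> - L \<le> t"
        using sinh_real_le_iff[of "- L" t] by (simp only: sinh_minus L(2))
      have high: "sinh t \<le> k \<longleftrightarrow> t \<le> L"
        using sinh_real_le_iff[of t L] by (simp only: L(2))
      consider "t < - L" | "- L \<le> t" "t \<le> L" | "L < t" by linarith
      then show ?thesis
      proof cases
        case 1
        then have "trunc L t = - L" using L(1) by (simp add: trunc_def)
        moreover have "trunc k (sinh t) = - k" using 1 low k by (simp add: trunc_def)
        ultimately show ?thesis by (simp add: L(2))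
      next
        case 2
        then have "trunc L t = t" by (simp add: trunc_def)
        moreover have "trunc k (sinh t) = sinh t"
          using 2 low high by (simp add: trunc_def)
        ultimately show ?thesis by simp
      next
        case 3
        then have "trunc L t = L" using L(1) by (simp add: trunc_def)
        moreover have "trunc k (sinh t) = k" using 3 high low k by (simp add: trunc_def)
        ultimately show ?thesis by (simp add: L(2))
      qed
    qed
    ultimately show "sobolev0 p \<Omega> (\<lambda>x. trunc k (sinh (w x))) (\<lambda>x. \<rho> (w x) *\<^sub>R G x)" by simp
    show "\<bar>\<rho> t\<bar> \<le> cosh t" for t
    proof -
      have "\<bar>\<rho> t\<bar> \<le> cosh (trunc L t) * 1"
        unfolding \<rho>_def abs_mult by (intro mult_mono) (auto simp: sgn_if)
      also have "\<dots> \<le> cosh t" using cosh_mono[OF abs_trunc_le[OF L(1)]] by simp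
      finally show ?thesis .
    qed
    show "\<rho> t = cosh t" if "\<bar>sinh t\<bar> < k" for t
    proof -
      have "sinh t < sinh L" "sinh (- L) < sinh t" using that by (auto simp: L(2) abs_less_iff)
      then have "t < L" "- L < t" by (simp_all only: sinh_real_less_iff)
      then show ?thesis by (simp add: \<rho>_def trunc_def)
    qed
  qed
qed

text \<open>\<open>soft_trunc K\<close> is a smooth substitute for the truncation at level \<open>K\<close>. Its derivative decays
  like \<open>K / |s|\<close>, which is exactly what the degenerate coercivity of the functional controls, and it
  tends to \<open>1\<close> as \<open>K\<close> grows.\<close>

definition soft_trunc :: "real \<Rightarrow> real \<Rightarrow> real" where
  "soft_trunc K s = K * arsinh (s / K)"

definition soft_trunc_deriv :: "real \<Rightarrow> real \<Rightarrow> real" where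
  "soft_trunc_deriv K s = 1 / sqrt ((s / K)\<^sup>2 + 1)"

lemma soft_trunc_has_derivative:
  assumes "K > 0"
  shows "(soft_trunc K has_real_derivative soft_trunc_deriv K s) (at s)"
proof -
  have "((\<lambda>s. arsinh (s / K)) has_real_derivative (1 / sqrt ((s / K)\<^sup>2 + 1)) * (1 / K)) (at s)"
    by (rule DERIV_chain2[OF arsinh_real_has_field_derivative]) (use assms in \<open>auto intro!: derivative_eq_intros\<close>)
  from DERIV_cmult[OF this, of K] show ?thesis
    unfolding soft_trunc_def[abs_def] soft_trunc_deriv_def using assms by simp
qed

lemma smooth_soft_trunc: "smooth (soft_trunc K)"
proof -
  have "smooth (\<lambda>s. K * arsinh (s * (1 / K)))"
    by (intro smooth_mult smooth_const smooth_compose[OF smooth_arsinh] smooth_ident)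
  then show ?thesis by (simp add: soft_trunc_def[abs_def])
qed

lemma soft_trunc_0 [simp]: "soft_trunc K 0 = 0" by (simp add: soft_trunc_def)

lemma soft_trunc_deriv_bounds: "0 < soft_trunc_deriv K s" "soft_trunc_deriv K s \<le> 1"
proof -
  have 1: "sqrt ((s / K)\<^sup>2 + 1) \<ge> 1" by simp
  then have 2: "sqrt ((s / K)\<^sup>2 + 1) > 0" by linarith
  from 2 show "0 < soft_trunc_deriv K s"
    unfolding soft_trunc_deriv_def by (rule divide_pos_pos[OF zero_less_one])
  from 1 2 show "soft_trunc_deriv K s \<le> 1"
    unfolding soft_trunc_deriv_def by (subst divide_le_eq_1_pos)
qed

lemma soft_trunc_1_sinh: "soft_trunc 1 (sinh t) = t"
  by (simp add: soft_trunc_def arsinh_sinh_real)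

text \<open>Up to constants \<open>(1 + B |s|)^2\<close> grows like \<open>1 + s^2\<close>, and the
  squared derivative decays like the reciprocal. The constant comes from
  \<open>(1 + y)^2 \<le> 2 + 2 y^2\<close> in the variable \<open>t = s / K\<close>.\<close>

lemma soft_trunc_deriv_square: "K > 0 \<Longrightarrow> (soft_trunc_deriv K s)\<^sup>2 * (1 + B * \<bar>s\<bar>)\<^sup>2 \<le> 2 + 2 * B\<^sup>2 * K\<^sup>2"
proof -
  assume K: "K > 0"
  define t where "t = s / K"
  have s: "\<bar>s\<bar> = K * \<bar>t\<bar>" "s = K * t" using K by (simp_all add: t_def abs_mult)
  have "t\<^sup>2 + 1 > 0" by (simp add: add_nonneg_pos)
  have "0 \<le> (1 - B * \<bar>s\<bar>)\<^sup>2" by simp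
  then have "(1 + B * \<bar>s\<bar>)\<^sup>2 \<le> 2 + 2 * (B * \<bar>s\<bar>)\<^sup>2" by (simp add: power2_sum power2_diff)
  also have "(B * \<bar>s\<bar>)\<^sup>2 = B\<^sup>2 * K\<^sup>2 * t\<^sup>2" by (simp add: s(1) power_mult_distrib)
  also have "2 + 2 * (B\<^sup>2 * K\<^sup>2 * t\<^sup>2) \<le> (2 + 2 * B\<^sup>2 * K\<^sup>2) * (t\<^sup>2 + 1)"
    by (simp add: algebra_simps)
  finally have le: "(1 + B * \<bar>s\<bar>)\<^sup>2 \<le> (2 + 2 * B\<^sup>2 * K\<^sup>2) * (t\<^sup>2 + 1)" .
  have "(soft_trunc_deriv K s)\<^sup>2 = 1 / (t\<^sup>2 + 1)"
    unfolding soft_trunc_deriv_def t_def[symmetric] by (simp add: power_divide)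
  then have "(soft_trunc_deriv K s)\<^sup>2 * (1 + B * \<bar>s\<bar>)\<^sup>2 = (1 + B * \<bar>s\<bar>)\<^sup>2 / (t\<^sup>2 + 1)" by simp
  also have "\<dots> \<le> 2 + 2 * B\<^sup>2 * K\<^sup>2"
    using le \<open>t\<^sup>2 + 1 > 0\<close> by (subst pos_divide_le_eq) auto
  finally show ?thesis .
qed

text \<open>As a function of \<open>arsinh s\<close>, each \<open>soft_trunc K s\<close> is
  Lipschitz with constant \<open>K\<close>, so convergence of \<open>arsinh \<phi>\<close> transfers
  to every \<open>K\<close>. Behind the bound is
  \<open>cosh^2 = sinh^2 + 1 \<le> sinh^2 + K^2\<close>, where \<open>K \<ge> 1\<close>
  enters.\<close>

lemma soft_trunc_sinh:
  assumes "K \<ge> 1"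
  shows "((\<lambda>t. soft_trunc K (sinh t)) has_real_derivative soft_trunc_deriv K (sinh t) * cosh t) (at t)"
    and "\<bar>soft_trunc_deriv K (sinh t) * cosh t\<bar> \<le> K"
    and "smooth (\<lambda>t. soft_trunc K (sinh t))"
proof -
  show "((\<lambda>t. soft_trunc K (sinh t)) has_real_derivative soft_trunc_deriv K (sinh t) * cosh t) (at t)"
    by (rule DERIV_chain2[OF soft_trunc_has_derivative]) (use assms in \<open>auto intro!: derivative_eq_intros\<close>)
  show "smooth (\<lambda>t. soft_trunc K (sinh t))" by (rule smooth_compose[OF smooth_soft_trunc smooth_sinh])
  have "(cosh t)\<^sup>2 = (sinh t)\<^sup>2 + 1" by (simp add: cosh_square_eq)
  also have "\<dots> \<le> K\<^sup>2 * ((sinh t / K)\<^sup>2 + 1)"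
    using assms by (simp add: power_divide distrib_left one_le_power)
  finally have "cosh t \<le> sqrt (K\<^sup>2 * ((sinh t / K)\<^sup>2 + 1))" by (rule real_le_rsqrt)
  also have "\<dots> = K * sqrt ((sinh t / K)\<^sup>2 + 1)" using assms by (simp add: real_sqrt_mult)
  finally have "cosh t / sqrt ((sinh t / K)\<^sup>2 + 1) \<le> K"
    by (subst pos_divide_le_eq) (auto simp: add_nonneg_pos)
  moreover have "0 \<le> cosh t / sqrt ((sinh t / K)\<^sup>2 + 1)" by simp
  ultimately show "\<bar>soft_trunc_deriv K (sinh t) * cosh t\<bar> \<le> K"
    by (simp add: soft_trunc_deriv_def)
qed

lemma soft_trunc_deriv_tendsto: "(\<lambda>n. soft_trunc_deriv (real (Suc n)) s) \<longlonglongrightarrow> 1"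
proof -
  have "(\<lambda>n. 1 / sqrt ((s * (1 / real (Suc n)))\<^sup>2 + 1)) \<longlonglongrightarrow> 1 / sqrt ((s * 0)\<^sup>2 + 1)"
    by (intro tendsto_intros LIMSEQ_inverse_real_of_nat[unfolded inverse_eq_divide]) simp
  then show ?thesis by (simp add: soft_trunc_deriv_def)
qed

section \<open>Lower semicontinuity\<close>

text \<open>For a simple field only finitely many second arguments occur; continuity in that
  argument then handles pointwise limits of simple fields.\<close>

lemma caratheodory_measurable:
  fixes J :: "'a \<Rightarrow> 'b::euclidean_space \<Rightarrow> real"
  assumes J: "\<And>\<xi>. (\<lambda>x. J x \<xi>) \<in> borel_measurable M" "\<And>x. continuous_on UNIV (J x)"
    and g: "g \<in> borel_measurable M"
  shows "(\<lambda>x. J x (g x)) \<in> borel_measurable M"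
proof -
  obtain F where F: "\<And>i. simple_function M (F i)" "\<And>x. x \<in> space M \<Longrightarrow> (\<lambda>i. F i x) \<longlonglongrightarrow> g x"
    using borel_measurable_implies_sequence_metric[OF g, of 0] by metis
  have Fm: "(\<lambda>x. J x (F i x)) \<in> borel_measurable M" for i
  proof (rule measurable_compose_countable'[where I = "F i ` space M" and f = "\<lambda>\<xi> x. J x \<xi>"])
    have fin: "finite (F i ` space M)" using F(1)[of i] by (simp add: simple_function_def)
    then show "countable (F i ` space M)" by (rule countable_finite)
    show "F i \<in> measurable M (count_space (F i ` space M))"
      using F(1)[of i] by (auto simp: measurable_count_space_eq2[OF fin] simple_function_def)
  qed (rule J(1))
  show ?thesis
  proof (rule borel_measurable_LIMSEQ_metric[OF Fm])
    fix x assume "x \<in> space M"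
    then show "(\<lambda>i. J x (F i x)) \<longlonglongrightarrow> J x (g x)"
      using continuous_on_tendsto_compose[OF J(2) F(2)] by auto
  qed
qed

text \<open>The pointwise core of lower semicontinuity. The factors \<open>a m\<close> vary, so
  Jensen's inequality does not apply to \<open>J (\<xi> m) * a m\<close> directly. On a late tail
  they all exceed a constant \<open>A' < A\<close>; since \<open>J\<close> is nonnegative they may
  be lowered to it, and then Jensen applies.\<close>

lemma wavg_eventually_greater:
  fixes J :: "'b::real_normed_vector \<Rightarrow> real"
  assumes c: "\<And>n. tail_weights n (c n)" and J: "convex_on UNIV J" "continuous_on UNIV J" "\<And>\<xi>. J \<xi> \<ge> 0"
    and lim: "(\<lambda>n. wavg (c n) \<xi>) \<longlonglongrightarrow> \<zeta>" "a \<longlonglongrightarrow> A" "d \<longlonglongrightarrow> D" and A: "A > 0" and y: "y < J \<zeta> * A + D"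
  shows "\<forall>\<^sub>F n in sequentially. y < wavg (c n) (\<lambda>m. J (\<xi> m) * a m + d m)"
proof -
  \<comment> \<open>\<open>A'\<close> must lie below \<open>A\<close> and still leave
    \<open>y < A' * J \<zeta> + D\<close>. Lowering \<open>A\<close> by half the gap divided by
    \<open>J \<zeta>\<close> does so, the maximum with 0 preserves the sign, and for
    \<open>J \<zeta> = 0\<close> the value 0 works.\<close>
  obtain A' where A': "0 \<le> A'" "A' < A" "y < A' * J \<zeta> + D"
  proof (cases "J \<zeta> = 0")
    case True
    then show ?thesis using that[of 0] A y by simp
  next
    case False
    then have X: "J \<zeta> > 0" using J(3)[of \<zeta>] by linarith
    define A' where "A' = max 0 (A - (J \<zeta> * A + D - y) / (2 * J \<zeta>))"
    have gap: "(J \<zeta> * A + D - y) / (2 * J \<zeta>) > 0" using X y by simp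
    have "J \<zeta> * (A - (J \<zeta> * A + D - y) / (2 * J \<zeta>)) = J \<zeta> * A - (J \<zeta> * A + D - y) / 2"
    proof -
      have "X * (A - g / (2 * X)) = X * A - g / 2" if "X > 0" for X g :: real
        using that by (simp add: right_diff_distrib)
      from this[OF X] show ?thesis .
    qed
    moreover have "J \<zeta> * (A - (J \<zeta> * A + D - y) / (2 * J \<zeta>)) \<le> J \<zeta> * A'"
      using X by (intro mult_left_mono) (auto simp: A'_def)
    ultimately have "J \<zeta> * A - (J \<zeta> * A + D - y) / 2 \<le> J \<zeta> * A'" by simp
    moreover have "J \<zeta> * A - (J \<zeta> * A + D - y) / 2 > y - D"
    proof -
      have "t - (t + D - y) / 2 > y - D" if "y < t + D" for t using that by (simp add: field_simps)
      from this[OF y] show ?thesis .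
    qed
    ultimately have "y < A' * J \<zeta> + D" by (simp add: mult.commute)
    moreover have "A' < A" using gap A by (simp add: A'_def)
    moreover have "0 \<le> A'" by (simp add: A'_def)
    ultimately show ?thesis using that by blast
  qed
  have "\<forall>\<^sub>F m in sequentially. A' < a m" by (rule order_tendstoD(1)[OF lim(2) A'(2)])
  then obtain N where N: "\<And>m. m \<ge> N \<Longrightarrow> A' < a m" by (auto simp: eventually_sequentially)
  have "(\<lambda>n. J (wavg (c n) \<xi>)) \<longlonglongrightarrow> J \<zeta>"
    using J(2) lim(1) by (auto intro: continuous_on_tendsto_compose[of UNIV J])
  then have "(\<lambda>n. A' * J (wavg (c n) \<xi>) + wavg (c n) d) \<longlonglongrightarrow> A' * J \<zeta> + D"
    by (intro tendsto_intros wavg_tendsto[OF lim(3) c])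
  then have "\<forall>\<^sub>F n in sequentially. y < A' * J (wavg (c n) \<xi>) + wavg (c n) d"
    by (rule order_tendstoD(1)[OF _ A'(3)])
  with eventually_ge_at_top[of N] show ?thesis
  proof eventually_elim
    case (elim n)
    have "A' * J (wavg (c n) \<xi>) \<le> A' * wavg (c n) (\<lambda>m. J (\<xi> m))"
      by (intro mult_left_mono wavg_convex[OF c J(1)] A'(1))
    also have "\<dots> = wavg (c n) (\<lambda>m. A' * J (\<xi> m))" by (simp add: wavg_mult)
    also have "\<dots> \<le> wavg (c n) (\<lambda>m. J (\<xi> m) * a m)"
    proof (rule wavg_mono[OF c])
      fix m assume "n \<le> m"
      then have "A' \<le> a m" using N[of m] elim(1) by simp
      from mult_right_mono[OF this J(3)[of "\<xi> m"]] show "A' * J (\<xi> m) \<le> J (\<xi> m) * a m"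
        by (simp add: mult.commute)
    qed
    finally show ?case using elim(2) by (simp add: wavg_add)
  qed
qed

text \<open>Convexity of the squared norm reduces this to averages of a real null sequence. Weights
  selected for the gradients may thus be applied to the functions as well.\<close>

lemma power_null_wavg:
  assumes c: "\<And>n. tail_weights n (c n)" and g: "power_null M 2 g"
  shows "power_null M 2 (\<lambda>n x. wavg (c n) (\<lambda>m. g m x))"
  unfolding power_null_def
proof
  have gi: "power_integrable M 2 (g m)" for m using g by (simp add: power_null_def)
  have wi: "power_integrable M 2 (\<lambda>x. wavg (c n) (\<lambda>m. g m x))" for n by (rule wavg_power_integrable[OF gi]) simp
  then show "\<forall>n. power_integrable M 2 (\<lambda>x. wavg (c n) (\<lambda>m. g m x))" by blast
  have g2: "integrable M (\<lambda>x. (norm (g m x))\<^sup>2)" for m using gi by (simp add: power_integrable_2)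
  have "(LINT x|M. (norm (wavg (c n) (\<lambda>m. g m x)))\<^sup>2) \<le> wavg (c n) (\<lambda>m. LINT x|M. (norm (g m x))\<^sup>2)" for n
  proof -
    have "(LINT x|M. (norm (wavg (c n) (\<lambda>m. g m x)))\<^sup>2) \<le> (LINT x|M. wavg (c n) (\<lambda>m. (norm (g m x))\<^sup>2))"
      using wi[of n] by (intro integral_mono integral_wavg(2) g2 norm_square_wavg_le[OF c]) (simp add: power_integrable_2)
    then show ?thesis by (simp add: integral_wavg(1)[OF g2])
  qed
  moreover have "(\<lambda>n. wavg (c n) (\<lambda>m. LINT x|M. (norm (g m x))\<^sup>2)) \<longlonglongrightarrow> 0"
    by (rule wavg_tendsto[OF _ c]) (use g in \<open>simp add: power_null_def\<close>)
  ultimately have "(\<lambda>n. LINT x|M. (norm (wavg (c n) (\<lambda>m. g m x)))\<^sup>2) \<longlonglongrightarrow> 0"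
    using nonneg_sandwich_0[of "\<lambda>n. LINT x|M. (norm (wavg (c n) (\<lambda>m. g m x)))\<^sup>2"
        "\<lambda>n. wavg (c n) (\<lambda>m. LINT x|M. (norm (g m x))\<^sup>2)"]
    by (simp add: Bochner_Integration.integral_nonneg)
  then show "(\<lambda>n. LINT x|M. norm (wavg (c n) (\<lambda>m. g m x)) powr 2) \<longlonglongrightarrow> 0" by simp
qed

lemma test_functions_wavg:
  assumes "\<And>m. \<phi> m \<in> test_functions \<Omega>"
  shows "(\<lambda>x. wavg c (\<lambda>m. \<phi> m x)) \<in> test_functions \<Omega>"
    and "grad (\<lambda>x. wavg c (\<lambda>m. \<phi> m x)) x = wavg c (\<lambda>m. grad (\<phi> m) x)"
  unfolding wavg_def real_scaleR_def
  by (rule test_functions_sum[OF assms], rule grad_sum[OF test_functions_smooth[OF assms]])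

text \<open>Averages of \<open>soft_trunc \<kappa> (\<phi> m)\<close> are test functions whose
  gradients are the averaged gradients. The gradients converge by the choice of weights, the
  functions because \<open>soft_trunc \<kappa>\<close> is a Lipschitz function of
  \<open>soft_trunc 1\<close>; hence \<open>h\<close> is the gradient of the limit.\<close>

lemma soft_trunc_limit:
  fixes \<Omega> :: "'a::euclidean_space set"
  assumes \<Omega>: "open \<Omega>" "bounded \<Omega>" and \<phi>: "\<And>n. \<phi> n \<in> test_functions \<Omega>"
    and bnd: "\<And>n. (LINT x|lebesgue_on \<Omega>. (norm (grad (\<lambda>x. soft_trunc \<kappa> (\<phi> n x)) x))\<^sup>2) \<le> C"
    and w: "power_integrable (lebesgue_on \<Omega>) 2 w"
    and nw: "power_null (lebesgue_on \<Omega>) 2 (\<lambda>n x. w x - soft_trunc 1 (\<phi> n x))" and \<kappa>: "\<kappa> \<ge> 1"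
  obtains c h where "\<And>n. tail_weights n (c n)" "sobolev0 2 \<Omega> (\<lambda>x. soft_trunc \<kappa> (sinh (w x))) h"
    "power_null (lebesgue_on \<Omega>) 2 (\<lambda>n x. h x - wavg (c n) (\<lambda>m. grad (\<lambda>x. soft_trunc \<kappa> (\<phi> m x)) x))"
proof -
  let ?M = "lebesgue_on \<Omega>" and ?A = "\<lambda>m x. soft_trunc \<kappa> (\<phi> m x)"
  note fin = bounded_open_finite_measure[OF \<Omega>]
  have A: "?A m \<in> test_functions \<Omega>" for m by (rule test_functions_compose[OF \<phi> smooth_soft_trunc soft_trunc_0])
  have Ai: "power_integrable ?M 2 (grad (?A m))" for m by (rule test_functions_power_integrable(2)[OF \<Omega> A]) simp
  obtain c h where c: "\<And>n. tail_weights n (c n)" and h: "power_integrable ?M 2 h"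
    "(\<lambda>n. LINT x|?M. (norm (wavg (c n) (\<lambda>m. grad (?A m) x) - h x))\<^sup>2) \<longlonglongrightarrow> 0"
    by (rule convex_combinations_converge[where g = "\<lambda>m. grad (?A m)", OF fin Ai bnd]) (rule that)
  have wi: "power_integrable ?M 2 (\<lambda>x. wavg (c n) (\<lambda>m. grad (?A m) x))" for n
    by (rule wavg_power_integrable[OF Ai]) simp
  have nh: "power_null ?M 2 (\<lambda>n x. h x - wavg (c n) (\<lambda>m. grad (?A m) x))"
    unfolding power_null_def using power_integrable_diff[OF h(1) wi] h(2) by (simp add: norm_minus_commute)
  have lip: "\<bar>soft_trunc \<kappa> (sinh s) - soft_trunc \<kappa> (sinh t)\<bar> \<le> \<kappa> * \<bar>s - t\<bar>" for s t
    by (rule real_Lipschitz[OF soft_trunc_sinh(1,2)[OF \<kappa>]])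
  have [measurable]: "w \<in> borel_measurable ?M" using w by (simp add: power_integrable_def)
  have [measurable]: "(\<lambda>t. soft_trunc \<kappa> (sinh t)) \<in> borel_measurable borel"
    by (rule smooth_borel_measurable[OF soft_trunc_sinh(3)[OF \<kappa>]])
  have [measurable]: "?A m \<in> borel_measurable ?M" for m
    by (rule borel_measurable_lebesgue_onI[OF smooth_borel_measurable[OF test_functions_smooth[OF A]]])
  have Phim: "(\<lambda>x. soft_trunc \<kappa> (sinh (w x))) \<in> borel_measurable ?M" by measurable
  have n1: "power_null ?M 2 (\<lambda>m x. soft_trunc \<kappa> (sinh (w x)) - ?A m x)"
  proof (rule power_null_bound[OF nw, where C = \<kappa>])
    show "AE x in ?M. norm (soft_trunc \<kappa> (sinh (w x)) - ?A m x) \<le> \<kappa> * norm (w x - soft_trunc 1 (\<phi> m x))" for m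
    proof (rule AE_I2)
      fix x
      \<comment> \<open>\<open>soft_trunc 1\<close> is \<open>arsinh\<close>, so the Lipschitz bound
        compares \<open>w x\<close> with \<open>arsinh (\<phi> m x)\<close>.\<close>
      have "sinh (soft_trunc 1 (\<phi> m x)) = \<phi> m x" by (simp add: soft_trunc_def)
      then show "norm (soft_trunc \<kappa> (sinh (w x)) - ?A m x) \<le> \<kappa> * norm (w x - soft_trunc 1 (\<phi> m x))"
        using lip[of "w x" "soft_trunc 1 (\<phi> m x)"] by simp
    qed
    show "(\<lambda>x. soft_trunc \<kappa> (sinh (w x)) - ?A m x) \<in> borel_measurable ?M" for m using Phim by measurable
  qed simp
  have n2: "power_null ?M 2 (\<lambda>n x. soft_trunc \<kappa> (sinh (w x)) - wavg (c n) (\<lambda>m. ?A m x))"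
    using power_null_wavg[OF c n1] by (simp add: wavg_diff wavg_const[OF c])
  have ui: "power_integrable ?M 2 (\<lambda>x. soft_trunc \<kappa> (sinh (w x)))"
    by (rule power_integrable_bound[OF w Phim, where C = \<kappa>]) (use lip[of _ 0] in \<open>auto intro!: AE_I2\<close>)
  have "sobolev0 2 \<Omega> (\<lambda>x. soft_trunc \<kappa> (sinh (w x))) h"
    unfolding sobolev0_def
  proof (intro conjI exI[of _ "\<lambda>n x. wavg (c n) (\<lambda>m. ?A m x)"])
    show "\<forall>n. (\<lambda>x. wavg (c n) (\<lambda>m. ?A m x)) \<in> test_functions \<Omega>"
      using test_functions_wavg(1)[of ?A, OF A] by blast
    show "power_null ?M 2 (\<lambda>n x. h x - grad (\<lambda>x. wavg (c n) (\<lambda>m. ?A m x)) x)"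
      using nh test_functions_wavg(2)[of ?A, OF A] by simp
  qed (fact ui h n2)+
  then show ?thesis using that c nh by blast
qed

section \<open>The degenerate functional: coercivity, approximation and lower semicontinuity\<close>

locale degenerate_functional =
  fixes \<Omega> :: "'a::euclidean_space set" and j :: "'a \<Rightarrow> 'a \<Rightarrow> real" and b f :: "'a \<Rightarrow> real" and \<alpha> \<beta> B :: real
  assumes open_\<Omega>: "open \<Omega>" and bounded_\<Omega>: "bounded \<Omega>"
    and j_meas: "\<And>\<xi>. (\<lambda>x. j x \<xi>) \<in> borel_measurable (lebesgue_on \<Omega>)"
    and j_cont: "\<And>x. continuous_on UNIV (j x)"
    and j_conv: "\<And>x. convex_on UNIV (j x)"
    and \<alpha>_pos: "\<alpha> > 0"
    and j_lower: "\<And>x \<xi>. \<alpha> * (norm \<xi>)\<^sup>2 \<le> j x \<xi>" and j_upper: "\<And>x \<xi>. j x \<xi> \<le> \<beta> * (norm \<xi>)\<^sup>2"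
    and b_meas: "b \<in> borel_measurable (lebesgue_on \<Omega>)"
    and b_nonneg: "\<And>x. 0 \<le> b x" and b_le: "\<And>x. b x \<le> B"
    and f_sq: "power_integrable (lebesgue_on \<Omega>) 2 f"
begin

abbreviation M :: "'a measure" where "M \<equiv> lebesgue_on \<Omega>"

text \<open>Completing the square turns the lower-order part of the functional into
  \<open>\<integral> (u - f)\<^sup>2 / 2\<close> minus the constant \<open>\<integral> f\<^sup>2 / 2\<close>,
  so that Fatou's lemma applies to a nonnegative integrand.\<close>

definition density :: "('a \<Rightarrow> real) \<Rightarrow> ('a \<Rightarrow> 'a) \<Rightarrow> 'a \<Rightarrow> real" where
  "density u g x = j x (g x) / (1 + b x * \<bar>u x\<bar>)\<^sup>2 + (u x - f x)\<^sup>2 / 2"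

text \<open>The gradient is a separate argument because \<open>u\<close> gets paired with fields
  other than its gradient, such as limits of the averaged gradients of
  \<open>soft_trunc \<kappa> (\<phi> n)\<close>.\<close>

definition K :: "('a \<Rightarrow> real) \<Rightarrow> ('a \<Rightarrow> 'a) \<Rightarrow> ennreal" where
  "K u g = (\<integral>\<^sup>+x. ennreal (density u g x) \<partial>M)"

lemma finite_M: "finite_measure M"
  by (rule bounded_open_finite_measure[OF open_\<Omega> bounded_\<Omega>])

lemma j_nonneg: "j x \<xi> \<ge> 0"
  using j_lower[of \<xi> x] \<alpha>_pos by (meson order_trans mult_nonneg_nonneg less_imp_le zero_le_power2)

lemma j_zero: "j x 0 = 0"
  using j_lower[of 0 x] j_upper[of x 0] by simp

lemma \<beta>_nonneg: "\<beta> \<ge> 0"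
proof -
  obtain i :: 'a where i: "i \<in> Basis" using nonempty_Basis by blast
  then show ?thesis using j_nonneg[of undefined i] j_upper[of undefined i] by simp
qed

lemma weight: "1 \<le> 1 + b x * \<bar>t\<bar>" "1 + b x * \<bar>t\<bar> \<le> 1 + B * \<bar>t\<bar>"
  using b_nonneg[of x] b_le[of x] by (auto intro: mult_right_mono)

lemma density_nonneg: "density u g x \<ge> 0"
  unfolding density_def by (intro add_nonneg_nonneg divide_nonneg_nonneg j_nonneg) auto

lemma f_meas [measurable]: "f \<in> borel_measurable M"
  using f_sq by (simp add: power_integrable_def)

lemma density_measurable [measurable]:
  assumes [measurable]: "u \<in> borel_measurable M" "g \<in> borel_measurable M"
  shows "density u g \<in> borel_measurable M"
proof -
  note [measurable] = caratheodory_measurable[OF j_meas j_cont assms(2)] b_meas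
  show ?thesis unfolding density_def[abs_def] by measurable
qed

text \<open>Convexity on the segment from 0 to \<open>\<xi>\<close> together with
  \<open>j x 0 = 0\<close>. This lets the shorter gradient of
  \<open>soft_trunc \<kappa> \<phi>\<close> replace \<open>grad \<phi>\<close> without raising the
  functional.\<close>

lemma j_scale_le: "0 \<le> t \<Longrightarrow> t \<le> 1 \<Longrightarrow> j x (t *\<^sub>R \<xi>) \<le> j x \<xi>"
proof -
  assume t: "0 \<le> t" "t \<le> 1"
  have "j x ((1 - t) *\<^sub>R 0 + t *\<^sub>R \<xi>) \<le> (1 - t) * j x 0 + t * j x \<xi>"
    by (rule convex_onD[OF j_conv]) (use t in auto)
  also have "\<dots> \<le> j x \<xi>" using t j_nonneg[of x \<xi>] by (simp add: j_zero mult_left_le_one_le)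
  finally show ?thesis by simp
qed

text \<open>Degenerate coercivity: \<open>\<alpha> |g|^2 / (1 + B |u|)^2\<close> and
  \<open>(u - f)^2 / 2\<close> both lie below the density. The first controls only a weighted
  gradient, the second controls \<open>u\<close> in \<open>L^2\<close>.\<close>

lemma K_bounds:
  assumes [measurable]: "u \<in> borel_measurable M" "g \<in> borel_measurable M" and K: "K u g \<le> ennreal C" and C: "C \<ge> 0"
  shows "integrable M (density u g)" "(LINT x|M. density u g x) \<le> C"
    and "integrable M (\<lambda>x. (norm (g x))\<^sup>2 / (1 + B * \<bar>u x\<bar>)\<^sup>2)"
    and "(LINT x|M. (norm (g x))\<^sup>2 / (1 + B * \<bar>u x\<bar>)\<^sup>2) \<le> C / \<alpha>"
    and "power_integrable M 2 u"
    and "(LINT x|M. (u x)\<^sup>2) \<le> 4 * C + 2 * (LINT x|M. (f x)\<^sup>2)"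
proof -
  show int: "integrable M (density u g)"
    by (rule integrableI_nonneg) (use K density_nonneg in \<open>auto simp: K_def le_less_trans[OF _ ennreal_less_top]\<close>)
  show le: "(LINT x|M. density u g x) \<le> C"
    using K C nn_integral_eq_integral[OF int AE_I2[OF density_nonneg]] by (simp add: K_def)
  have pt: "(norm (g x))\<^sup>2 / (1 + B * \<bar>u x\<bar>)\<^sup>2 \<le> density u g x / \<alpha>" for x
  proof -
    have "\<alpha> * ((norm (g x))\<^sup>2 / (1 + B * \<bar>u x\<bar>)\<^sup>2) = (\<alpha> * (norm (g x))\<^sup>2) / (1 + B * \<bar>u x\<bar>)\<^sup>2" by simp
    also have "\<dots> \<le> j x (g x) / (1 + b x * \<bar>u x\<bar>)\<^sup>2"
    proof (rule frac_le)
      show "(1 + b x * \<bar>u x\<bar>)\<^sup>2 \<le> (1 + B * \<bar>u x\<bar>)\<^sup>2"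
        using weight[of x "u x"] by (intro power_mono) auto
      show "0 < (1 + b x * \<bar>u x\<bar>)\<^sup>2" using weight(1)[of x "u x"] by simp
    qed (rule j_nonneg, rule j_lower)
    also have "\<dots> \<le> density u g x" by (simp add: density_def)
    finally show ?thesis using \<alpha>_pos by (simp add: pos_le_divide_eq mult.commute)
  qed
  show i3: "integrable M (\<lambda>x. (norm (g x))\<^sup>2 / (1 + B * \<bar>u x\<bar>)\<^sup>2)"
  proof (rule Bochner_Integration.integrable_bound[where f = "\<lambda>x. density u g x / \<alpha>"])
    show "AE x in M. norm ((norm (g x))\<^sup>2 / (1 + B * \<bar>u x\<bar>)\<^sup>2) \<le> norm (density u g x / \<alpha>)"
      using pt \<alpha>_pos density_nonneg by (intro AE_I2) simp
  qed (use int in auto)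
  have "(LINT x|M. (norm (g x))\<^sup>2 / (1 + B * \<bar>u x\<bar>)\<^sup>2) \<le> (LINT x|M. density u g x / \<alpha>)"
    by (rule integral_mono[OF i3 _ pt]) (use int in simp)
  also have "\<dots> \<le> C / \<alpha>" using le \<alpha>_pos by (simp add: divide_right_mono)
  finally show "(LINT x|M. (norm (g x))\<^sup>2 / (1 + B * \<bar>u x\<bar>)\<^sup>2) \<le> C / \<alpha>" .
  have ptu: "(u x)\<^sup>2 \<le> 4 * density u g x + 2 * (f x)\<^sup>2" for x
  proof -
    \<comment> \<open>This square equals \<open>2 * (u - f)^2 + 2 * f^2 - u^2\<close>.\<close>
    have "0 \<le> (u x - 2 * f x)\<^sup>2" by simp
    then have "(u x)\<^sup>2 \<le> 2 * (u x - f x)\<^sup>2 + 2 * (f x)\<^sup>2" by (simp add: power2_diff power_mult_distrib)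
    moreover have "(u x - f x)\<^sup>2 / 2 \<le> density u g x"
      unfolding density_def using j_nonneg[of x "g x"] by simp
    ultimately show ?thesis by simp
  qed
  have fi: "integrable M (\<lambda>x. (f x)\<^sup>2)" using f_sq by (simp add: power_integrable_2)
  have ui: "integrable M (\<lambda>x. (u x)\<^sup>2)"
  proof (rule Bochner_Integration.integrable_bound[where f = "\<lambda>x. 4 * density u g x + 2 * (f x)\<^sup>2"])
    show "AE x in M. norm ((u x)\<^sup>2) \<le> norm (4 * density u g x + 2 * (f x)\<^sup>2)"
      using ptu density_nonneg by (intro AE_I2) simp
  qed (use int fi in auto)
  then show "power_integrable M 2 u" by (simp add: power_integrable_2)
  have "(LINT x|M. (u x)\<^sup>2) \<le> (LINT x|M. 4 * density u g x + 2 * (f x)\<^sup>2)"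
    by (rule integral_mono[OF ui _ ptu]) (use int fi in auto)
  also have "\<dots> = 4 * (LINT x|M. density u g x) + 2 * (LINT x|M. (f x)\<^sup>2)" using int fi by simp
  finally show "(LINT x|M. (u x)\<^sup>2) \<le> 4 * C + 2 * (LINT x|M. (f x)\<^sup>2)" using le by simp
qed

lemma test_measurable:
  assumes "\<phi> \<in> test_functions \<Omega>"
  shows "\<phi> \<in> borel_measurable M" "grad \<phi> \<in> borel_measurable M"
  using smooth_borel_measurable grad_borel_measurable test_functions_smooth[OF assms]
  by (auto intro!: borel_measurable_lebesgue_onI)

lemma grad_soft_trunc:
  "\<phi> \<in> test_functions \<Omega> \<Longrightarrow> \<kappa> > 0 \<Longrightarrow> grad (\<lambda>x. soft_trunc \<kappa> (\<phi> x)) x = soft_trunc_deriv \<kappa> (\<phi> x) *\<^sub>R grad \<phi> x"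
  using grad_compose[OF smooth_soft_trunc test_functions_smooth, of \<phi> \<Omega> \<kappa> x]
    DERIV_imp_deriv[OF soft_trunc_has_derivative, of \<kappa> "\<phi> x"] by simp

text \<open>The decay of the derivative of \<open>soft_trunc \<kappa>\<close> cancels the weight in
  the coercivity estimate. The bound depends on \<open>\<kappa>\<close> and \<open>C\<close> but not
  on \<open>\<phi>\<close>, which makes minimizing sequences accessible to compactness.\<close>

lemma grad_soft_trunc_bound:
  assumes \<phi>: "\<phi> \<in> test_functions \<Omega>" and \<kappa>: "\<kappa> > 0" and K: "K \<phi> (grad \<phi>) \<le> ennreal C" and C: "C \<ge> 0"
  shows "(LINT x|M. (norm (grad (\<lambda>x. soft_trunc \<kappa> (\<phi> x)) x))\<^sup>2) \<le> (2 + 2 * B\<^sup>2 * \<kappa>\<^sup>2) * (C / \<alpha>)"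
proof -
  note kb = K_bounds[OF test_measurable[OF \<phi>] K C]
  let ?D = "2 + 2 * B\<^sup>2 * \<kappa>\<^sup>2" and ?w = "\<lambda>x. (norm (grad \<phi> x))\<^sup>2 / (1 + B * \<bar>\<phi> x\<bar>)\<^sup>2"
  have A: "(\<lambda>x. soft_trunc \<kappa> (\<phi> x)) \<in> test_functions \<Omega>"
    by (rule test_functions_compose[OF \<phi> smooth_soft_trunc soft_trunc_0])
  have "(LINT x|M. (norm (grad (\<lambda>x. soft_trunc \<kappa> (\<phi> x)) x))\<^sup>2) \<le> (LINT x|M. ?D * ?w x)"
  proof (rule integral_mono)
    show "integrable M (\<lambda>x. (norm (grad (\<lambda>x. soft_trunc \<kappa> (\<phi> x)) x))\<^sup>2)"
      using test_functions_power_integrable(2)[OF open_\<Omega> bounded_\<Omega> A, of 2] by (simp add: power_integrable_2)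
    show "integrable M (\<lambda>x. ?D * ?w x)" by (intro integrable_mult_right kb(3))
    fix x
    define y where "y = 1 + B * \<bar>\<phi> x\<bar>"
    have y: "y > 0" using weight[of x "\<phi> x"] unfolding y_def by linarith
    have "(soft_trunc_deriv \<kappa> (\<phi> x))\<^sup>2 * y\<^sup>2 \<le> ?D" unfolding y_def by (rule soft_trunc_deriv_square[OF \<kappa>])
    then have "(soft_trunc_deriv \<kappa> (\<phi> x))\<^sup>2 \<le> ?D / y\<^sup>2" using y by (subst pos_le_divide_eq) auto
    then have "(soft_trunc_deriv \<kappa> (\<phi> x))\<^sup>2 * (norm (grad \<phi> x))\<^sup>2 \<le> ?D / y\<^sup>2 * (norm (grad \<phi> x))\<^sup>2"
      by (rule mult_right_mono) simp
    then show "(norm (grad (\<lambda>x. soft_trunc \<kappa> (\<phi> x)) x))\<^sup>2 \<le> ?D * ?w x"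
      by (simp add: grad_soft_trunc[OF \<phi> \<kappa>] power_mult_distrib y_def)
  qed
  also have "\<dots> = ?D * (LINT x|M. ?w x)" by (rule integral_mult_right_zero)
  also have "\<dots> \<le> ?D * (C / \<alpha>)" by (rule mult_left_mono[OF kb(4)]) simp
  finally show ?thesis .
qed

text \<open>Along suitable approximating test functions the functional converges to its value at
  \<open>(v, h)\<close>: the quadratic growth of \<open>j\<close> and weights
  \<open>1 + b |u|\<close> of at least 1 allow dominated convergence.\<close>

lemma K_le_of_test_functions:
  assumes v: "sobolev0 2 \<Omega> v h" and I: "\<And>\<phi>. \<phi> \<in> test_functions \<Omega> \<Longrightarrow> I \<le> K \<phi> (grad \<phi>)"
  shows "I \<le> K v h"
proof -
  have pw2: "norm z powr 2 = (norm z)\<^sup>2" for z :: "'c::real_normed_vector" by simp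
  obtain \<phi> where \<phi>: "\<And>n. \<phi> n \<in> test_functions \<Omega>" and nu: "power_null M 2 (\<lambda>n x. v x - \<phi> n x)"
    and ng: "power_null M 2 (\<lambda>n x. h x - grad (\<phi> n) x)"
    using v by (auto simp: sobolev0_def)
  have vi: "power_integrable M 2 v" and hi: "power_integrable M 2 h" using v by (simp_all add: sobolev0_def)
  have [measurable]: "v \<in> borel_measurable M" "h \<in> borel_measurable M" using vi hi by (simp_all add: power_integrable_def)
  note [measurable] = test_measurable[OF \<phi>]
  obtain r1 :: "nat \<Rightarrow> nat" and w1 where r1: "strict_mono r1" "integrable M w1" "AE x in M. (\<lambda>k. v x - \<phi> (r1 k) x) \<longlonglongrightarrow> 0"
    "AE x in M. \<forall>k. norm (v x - \<phi> (r1 k) x) powr 2 \<le> w1 x"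
    by (rule power_null_imp_dominated_subseq[OF nu]) simp
  \<comment> \<open>The second extraction starts from the first subsequence, whose convergence and
    majorant it inherits.\<close>
  obtain r2 :: "nat \<Rightarrow> nat" and w2 where r2: "strict_mono r2" "integrable M w2"
    "AE x in M. (\<lambda>k. h x - grad (\<phi> (r1 (r2 k))) x) \<longlonglongrightarrow> 0"
    "AE x in M. \<forall>k. norm (h x - grad (\<phi> (r1 (r2 k))) x) powr 2 \<le> w2 x"
    by (rule power_null_imp_dominated_subseq[OF power_null_subseq[OF ng r1(1)]]) simp
  define \<psi> where "\<psi> k = \<phi> (r1 (r2 k))" for k
  have \<psi>: "\<psi> k \<in> test_functions \<Omega>" for k by (simp add: \<psi>_def \<phi>)
  note [measurable] = test_measurable[OF \<psi>]
  \<comment> \<open>A common majorant of the densities: \<open>|grad \<psi>|^2\<close> is at most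
    \<open>2 * (|h|^2 + w2)\<close>, and \<open>(\<psi> - f)^2 / 2\<close> is at most
    \<open>(v - f)^2 + w1\<close>.\<close>
  define W where "W x = 2 * \<beta> * ((norm (h x))\<^sup>2 + w2 x) + (v x - f x)\<^sup>2 + w1 x" for x
  have Wi: "integrable M W"
    unfolding W_def[abs_def]
    using hi power_integrable_diff[OF vi f_sq] r1(2) r2(2) by (auto simp: power_integrable_2)
  have l1: "AE x in M. (\<lambda>k. \<psi> k x) \<longlonglongrightarrow> v x"
    using r1(3)
  proof eventually_elim
    case (elim x)
    from LIMSEQ_subseq_LIMSEQ[OF elim r2(1)] have "(\<lambda>k. v x - \<psi> k x) \<longlonglongrightarrow> 0" by (simp add: o_def \<psi>_def)
    from tendsto_diff[OF tendsto_const[of "v x"] this] show ?case by simp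
  qed
  have l2: "AE x in M. (\<lambda>k. grad (\<psi> k) x) \<longlonglongrightarrow> h x"
    using r2(3)
  proof eventually_elim
    case (elim x)
    from tendsto_diff[OF tendsto_const[of "h x"] elim] show ?case by (simp add: \<psi>_def)
  qed
  have "(\<lambda>k. \<integral>\<^sup>+x. ennreal (density (\<psi> k) (grad (\<psi> k)) x) \<partial>M) \<longlonglongrightarrow> (\<integral>\<^sup>+x. ennreal (density v h x) \<partial>M)"
  proof (rule nn_integral_dominated_convergence[where w = "\<lambda>x. ennreal (W x)"])
    show "(\<lambda>x. ennreal (density v h x)) \<in> borel_measurable M" by measurable
    show "(\<lambda>x. ennreal (density (\<psi> k) (grad (\<psi> k)) x)) \<in> borel_measurable M" for k by measurable
    show "(\<lambda>x. ennreal (W x)) \<in> borel_measurable M" using Wi by auto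
    show "(\<integral>\<^sup>+x. ennreal (W x) \<partial>M) < \<infinity>"
    proof -
      have "(\<integral>\<^sup>+x. ennreal (W x) \<partial>M) \<le> (\<integral>\<^sup>+x. ennreal (norm (W x)) \<partial>M)"
        by (intro nn_integral_mono ennreal_leI) simp
      also have "\<dots> < \<infinity>" using Wi by (simp add: integrable_iff_bounded)
      finally show ?thesis .
    qed
    show "AE x in M. (\<lambda>k. ennreal (density (\<psi> k) (grad (\<psi> k)) x)) \<longlonglongrightarrow> ennreal (density v h x)"
      using l1 l2
    proof eventually_elim
      case (elim x)
      have "(\<lambda>k. j x (grad (\<psi> k) x)) \<longlonglongrightarrow> j x (h x)"
        using j_cont elim(2) by (auto intro: continuous_on_tendsto_compose[of UNIV "j x"])
      moreover have "(1 + b x * \<bar>v x\<bar>)\<^sup>2 \<noteq> 0" using weight(1)[of x "v x"] by simp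
      ultimately show ?case
        unfolding density_def by (intro tendsto_ennrealI tendsto_intros elim(1)) auto
    qed
    show "AE x in M. ennreal (density (\<psi> k) (grad (\<psi> k)) x) \<le> ennreal (W x)" for k
      using r1(4) r2(4)
    proof eventually_elim
      case (elim x)
      have e1: "(v x - \<psi> k x)\<^sup>2 \<le> w1 x" using elim(1)[rule_format, of "r2 k"] by (simp add: \<psi>_def)
      have e2: "(norm (h x - grad (\<psi> k) x))\<^sup>2 \<le> w2 x" using elim(2)[rule_format, of k] by (simp add: \<psi>_def)
      have g2: "(norm (grad (\<psi> k) x))\<^sup>2 \<le> 2 * ((norm (h x))\<^sup>2 + w2 x)"
      proof -
        have "norm (grad (\<psi> k) x) \<le> norm (h x) + norm (h x - grad (\<psi> k) x)"
          using norm_triangle_ineq4[of "h x" "h x - grad (\<psi> k) x"] by simp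
        then have "(norm (grad (\<psi> k) x))\<^sup>2 \<le> (norm (h x) + norm (h x - grad (\<psi> k) x))\<^sup>2" by (rule power_mono) simp
        also have "\<dots> \<le> 2 * (norm (h x))\<^sup>2 + 2 * (norm (h x - grad (\<psi> k) x))\<^sup>2"
          using zero_le_power2[of "norm (h x) - norm (h x - grad (\<psi> k) x)"] by (simp add: power2_sum power2_diff)
        finally show ?thesis using e2 by simp
      qed
      have "j x (grad (\<psi> k) x) / (1 + b x * \<bar>\<psi> k x\<bar>)\<^sup>2 \<le> j x (grad (\<psi> k) x) / 1"
        using weight(1)[of x "\<psi> k x"] by (intro divide_left_mono j_nonneg) (auto simp: one_le_power)
      also have "\<dots> \<le> \<beta> * (2 * ((norm (h x))\<^sup>2 + w2 x))"
        using j_upper[of x "grad (\<psi> k) x"] mult_left_mono[OF g2 \<beta>_nonneg] by simp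
      finally have p1: "j x (grad (\<psi> k) x) / (1 + b x * \<bar>\<psi> k x\<bar>)\<^sup>2 \<le> 2 * \<beta> * ((norm (h x))\<^sup>2 + w2 x)"
        by (simp only: mult.assoc mult.left_commute[of \<beta> 2])
      have "(\<psi> k x - f x)\<^sup>2 \<le> 2 * (v x - f x)\<^sup>2 + 2 * (v x - \<psi> k x)\<^sup>2"
      proof -
        have "(s - t)\<^sup>2 \<le> 2 * s\<^sup>2 + 2 * t\<^sup>2" for s t :: real
          using zero_le_power2[of "s + t"] by (simp add: power2_sum power2_diff)
        from this[of "v x - f x" "v x - \<psi> k x"] show ?thesis by simp
      qed
      then have p2: "(\<psi> k x - f x)\<^sup>2 / 2 \<le> (v x - f x)\<^sup>2 + w1 x" using e1 by simp
      show ?case unfolding density_def W_def using p1 p2 by (intro ennreal_leI) simp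
    qed
  qed
  then have "(\<lambda>k. K (\<psi> k) (grad (\<psi> k))) \<longlonglongrightarrow> K v h" by (simp add: K_def)
  then show ?thesis by (rule LIMSEQ_le_const) (use I[OF \<psi>] in auto)
qed

text \<open>Densities are averaged, each taken at its own \<open>\<phi> m\<close>; the functions
  inside the weights are never averaged. The averages have integral at most \<open>I + e n\<close>,
  \<open>wavg_eventually_greater\<close> puts their lower limit above the density of
  \<open>(u, h)\<close>, and Fatou's lemma concludes.\<close>

lemma K_lower_semicontinuous:
  assumes \<phi>: "\<And>n. \<phi> n \<in> test_functions \<Omega>" and K\<phi>: "\<And>n. K (\<phi> n) (grad (\<phi> n)) \<le> ennreal (I + e n)"
    and I: "I \<ge> 0" and e: "\<And>n. e n \<ge> 0" "e \<longlonglongrightarrow> 0" "\<And>n m. n \<le> m \<Longrightarrow> e m \<le> e n"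
    and u [measurable]: "u \<in> borel_measurable M" and h [measurable]: "h \<in> borel_measurable M"
    and \<phi>u: "AE x in M. (\<lambda>n. \<phi> n x) \<longlonglongrightarrow> u x"
    and c: "\<And>n. tail_weights n (c n)" and \<kappa>: "\<kappa> > 0"
    and nh: "power_null M 2 (\<lambda>n x. h x - wavg (c n) (\<lambda>m. grad (\<lambda>x. soft_trunc \<kappa> (\<phi> m x)) x))"
  shows "K u h \<le> ennreal I"
proof -
  let ?g = "\<lambda>m. grad (\<lambda>x. soft_trunc \<kappa> (\<phi> m x))"
  obtain r :: "nat \<Rightarrow> nat" and w where r: "strict_mono r"
    and rl: "AE x in M. (\<lambda>n. h x - wavg (c (r n)) (\<lambda>m. ?g m x)) \<longlonglongrightarrow> 0"
    by (rule power_null_imp_dominated_subseq[OF nh]) simp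
  have rn: "n \<le> r n" for n by (rule strict_mono_imp_increasing[OF r])
  \<comment> \<open>Passing to a subsequence moves the weights further out, so the
    \<open>n\<close>-th ones still charge only indices from \<open>n\<close> on.\<close>
  have c': "tail_weights n (c (r n))" for n by (rule tail_weights_mono[OF c rn])
  have A: "(\<lambda>x. soft_trunc \<kappa> (\<phi> m x)) \<in> test_functions \<Omega>" for m
    by (rule test_functions_compose[OF \<phi> smooth_soft_trunc soft_trunc_0])
  note [measurable] = test_measurable[OF \<phi>] test_measurable[OF A]
  have Ie: "I + e n \<ge> 0" for n using I e(1)[of n] by simp
  note kb = K_bounds[OF test_measurable[OF \<phi>] K\<phi> Ie]
  \<comment> \<open>The gradient of \<open>soft_trunc \<kappa> (\<phi> m)\<close> is
    \<open>grad (\<phi> m)\<close> times a factor in \<open>(0, 1]\<close>.\<close>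
  have le: "density (\<phi> m) (?g m) x \<le> density (\<phi> m) (grad (\<phi> m)) x" for m x
    unfolding density_def grad_soft_trunc[OF \<phi> \<kappa>]
    using soft_trunc_deriv_bounds[of \<kappa> "\<phi> m x"]
    by (intro add_right_mono divide_right_mono j_scale_le) auto
  have di: "integrable M (density (\<phi> m) (?g m))" for m
  proof (rule Bochner_Integration.integrable_bound[OF kb(1)[of m]])
    show "AE x in M. norm (density (\<phi> m) (?g m) x) \<le> norm (density (\<phi> m) (grad (\<phi> m)) x)"
      using le[of m] density_nonneg by (intro AE_I2) simp
  qed measurable
  have dle: "(LINT x|M. density (\<phi> m) (?g m) x) \<le> I + e m" for m
    using integral_mono[OF di[of m] kb(1)[of m] le[of m]] kb(2)[of m] by simp
  define S where "S n x = wavg (c (r n)) (\<lambda>m. density (\<phi> m) (?g m) x)" for n x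
  have S0: "S n x \<ge> 0" for n x unfolding S_def by (rule wavg_nonneg[OF c density_nonneg])
  have Si: "integrable M (S n)" for n unfolding S_def[abs_def] by (rule integral_wavg(2)[OF di])
  have Sle: "(\<integral>\<^sup>+x. ennreal (S n x) \<partial>M) \<le> ennreal (I + e n)" for n
  proof -
    have "(LINT x|M. S n x) = wavg (c (r n)) (\<lambda>m. LINT x|M. density (\<phi> m) (?g m) x)"
      unfolding S_def by (rule integral_wavg(1)[OF di])
    also have "\<dots> \<le> I + e n"
    proof (rule wavg_le[OF c'])
      fix m assume "n \<le> m"
      then show "(LINT x|M. density (\<phi> m) (?g m) x) \<le> I + e n" using dle[of m] e(3)[of n m] by simp
    qed
    finally have "(LINT x|M. S n x) \<le> I + e n" .
    then show ?thesis
      using nn_integral_eq_integral[OF Si AE_I2[OF S0]] by (simp add: ennreal_leI)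
  qed
  have "K u h \<le> (\<integral>\<^sup>+x. liminf (\<lambda>n. ennreal (S n x)) \<partial>M)"
    unfolding K_def
  proof (rule nn_integral_mono_AE)
    show "AE x in M. ennreal (density u h x) \<le> liminf (\<lambda>n. ennreal (S n x))"
      using \<phi>u rl
    proof eventually_elim
      case (elim x)
      have l1: "(\<lambda>n. wavg (c (r n)) (\<lambda>m. ?g m x)) \<longlonglongrightarrow> h x"
        using tendsto_diff[OF tendsto_const[of "h x"] elim(2)] by simp
      have nz: "(1 + b x * \<bar>u x\<bar>)\<^sup>2 > 0" using weight(1)[of x "u x"] by simp
      have l2: "(\<lambda>m. 1 / (1 + b x * \<bar>\<phi> m x\<bar>)\<^sup>2) \<longlonglongrightarrow> 1 / (1 + b x * \<bar>u x\<bar>)\<^sup>2"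
        using nz by (intro tendsto_intros elim(1)) auto
      have l3: "(\<lambda>m. (\<phi> m x - f x)\<^sup>2 / 2) \<longlonglongrightarrow> (u x - f x)\<^sup>2 / 2"
        by (intro tendsto_intros elim(1)) simp
      have pos: "1 / (1 + b x * \<bar>u x\<bar>)\<^sup>2 > 0" using nz by simp
      have ev: "\<forall>\<^sub>F n in sequentially. y < S n x" if "y < density u h x" for y
      proof -
        have y: "y < j x (h x) * (1 / (1 + b x * \<bar>u x\<bar>)\<^sup>2) + (u x - f x)\<^sup>2 / 2"
          using that by (simp add: density_def)
        show ?thesis
          using wavg_eventually_greater[OF c' j_conv j_cont j_nonneg l1 l2 l3 pos y]
          by (simp add: S_def density_def)
      qed
      \<comment> \<open>The lower limit is tested against every \<open>y\<close> below the density;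
        such a \<open>y\<close> is finite, hence the image of a nonnegative real.\<close>
      show ?case
        unfolding le_Liminf_iff
      proof (intro allI impI)
        fix y :: ennreal assume y: "y < ennreal (density u h x)"
        then have "y < top" using less_trans ennreal_less_top by blast
        then obtain z where z: "z \<ge> 0" "y = ennreal z" by (cases y) auto
        then have "z < density u h x" using y by (simp add: ennreal_less_iff)
        from ev[OF this] show "\<forall>\<^sub>F n in sequentially. y < ennreal (S n x)"
          by eventually_elim (simp add: z ennreal_less_iff)
      qed
    qed
  qed
  also have "\<dots> \<le> liminf (\<lambda>n. \<integral>\<^sup>+x. ennreal (S n x) \<partial>M)"
    by (rule nn_integral_liminf) (use Si in auto)
  also have "\<dots> \<le> liminf (\<lambda>n. ennreal (I + e n))"
    by (rule Liminf_mono) (use Sle in simp)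
  also have "\<dots> = ennreal I"
  proof -
    have "(\<lambda>n. ennreal (I + e n)) \<longlonglongrightarrow> ennreal (I + 0)" by (intro tendsto_ennrealI tendsto_intros e(2))
    then show ?thesis using lim_imp_Liminf[OF sequentially_bot] by fastforce
  qed
  finally show ?thesis .
qed

end

section \<open>Existence of a minimizer\<close>

context degenerate_functional begin

text \<open>One pair \<open>(w, G)\<close> has to serve all \<open>\<kappa>\<close>, although the
  convex weights and the limit field depend on \<open>\<kappa>\<close>. This works because the
  strong limit \<open>w\<close> is fixed beforehand and the chain rule expresses every limit field
  through \<open>G\<close>.\<close>

lemma exists_weak_limit_of_minimizing_sequence:
  obtains w G I where "sobolev0 2 \<Omega> w G" "I \<ge> 0" "\<And>\<psi>. \<psi> \<in> test_functions \<Omega> \<Longrightarrow> ennreal I \<le> K \<psi> (grad \<psi>)"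
    "\<And>\<kappa>. \<kappa> \<ge> 1 \<Longrightarrow> K (\<lambda>x. sinh (w x)) (\<lambda>x. (soft_trunc_deriv \<kappa> (sinh (w x)) * cosh (w x)) *\<^sub>R G x) \<le> ennreal I"
proof -
  define I0 where "I0 = (INF \<psi>\<in>test_functions \<Omega>. K \<psi> (grad \<psi>))"
  define I where "I = enn2real I0"
  \<comment> \<open>The zero function has a finite value, so the infimum is a real number.\<close>
  have zero: "K (\<lambda>x. 0) (grad (\<lambda>x. 0)) < top"
  proof -
    have eq: "density (\<lambda>x. 0) (grad (\<lambda>x. 0)) x = (f x)\<^sup>2 / 2" for x by (simp add: density_def j_zero)
    have "integrable M (\<lambda>x. (f x)\<^sup>2 / 2)" using f_sq by (simp add: power_integrable_2)
    then have "(\<integral>\<^sup>+x. ennreal ((f x)\<^sup>2 / 2) \<partial>M) < \<infinity>"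
      by (simp add: nn_integral_eq_integral)
    then show ?thesis unfolding K_def eq by simp
  qed
  have "I0 \<le> K (\<lambda>x. 0) (grad (\<lambda>x. 0))" unfolding I0_def by (rule INF_lower[OF test_functions_zero])
  then have "I0 < top" using zero by (rule le_less_trans)
  then have II0: "ennreal I = I0" by (simp add: I_def)
  have I: "I \<ge> 0" by (simp add: I_def)
  have lower: "ennreal I \<le> K \<psi> (grad \<psi>)" if "\<psi> \<in> test_functions \<Omega>" for \<psi>
    unfolding II0 I0_def by (rule INF_lower[OF that])
  define e where "e n = 1 / real (Suc n)" for n
  have e: "e \<longlonglongrightarrow> 0" "\<And>n. e n > 0" "\<And>n m. n \<le> m \<Longrightarrow> e m \<le> e n"
    unfolding e_def by (rule LIMSEQ_inverse_real_of_nat[unfolded inverse_eq_divide]) (auto intro!: divide_left_mono)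
  have "\<exists>\<psi>. \<psi> \<in> test_functions \<Omega> \<and> K \<psi> (grad \<psi>) \<le> ennreal (I + e n)" for n
  proof -
    have "I0 < ennreal (I + e n)" unfolding II0[symmetric] using I e(2)[of n] by (simp add: ennreal_less_iff)
    then obtain \<psi> where "\<psi> \<in> test_functions \<Omega>" "K \<psi> (grad \<psi>) < ennreal (I + e n)"
      unfolding I0_def by (auto simp: INF_less_iff)
    then show ?thesis using less_imp_le by blast
  qed
  then obtain \<phi>0 where \<phi>0: "\<And>n. \<phi>0 n \<in> test_functions \<Omega>" "\<And>n. K (\<phi>0 n) (grad (\<phi>0 n)) \<le> ennreal (I + e n)" by metis
  \<comment> \<open>All values of the sequence are at most \<open>I + e 0\<close>, and
    \<open>e 0 = 1\<close>.\<close>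
  define C where "C = I + 1"
  have C: "C \<ge> 0" using I by (simp add: C_def)
  have KC: "K (\<phi>0 n) (grad (\<phi>0 n)) \<le> ennreal C" for n
  proof -
    have "e n \<le> e 0" by (rule e(3)) simp
    then have "I + e n \<le> C" by (simp add: C_def e_def)
    then show ?thesis using \<phi>0(2)[of n] order_trans ennreal_leI by blast
  qed
  have \<Omega>': "\<Omega> \<in> sets lebesgue" using open_\<Omega> by simp
  define W where "W n x = soft_trunc 1 (\<phi>0 n x)" for n x
  have Wt: "W n \<in> test_functions \<Omega>" for n
    unfolding W_def[abs_def] by (rule test_functions_compose[OF \<phi>0(1) smooth_soft_trunc soft_trunc_0])
  \<comment> \<open>One constant for both bounds in the Rellich theorem; the second entry is the
    gradient bound at \<open>\<kappa> = 1\<close>.\<close>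
  define C1 where "C1 = max (4 * C + 2 * (LINT x|M. (f x)\<^sup>2)) ((2 + 2 * B\<^sup>2 * 1\<^sup>2) * (C / \<alpha>))"
  have to_lborel: "(LINT x|M. F x) = (LINT x|lborel. F x)" if "F \<in> borel_measurable borel" "\<And>x. x \<notin> \<Omega> \<Longrightarrow> F x = 0" for F :: "'a \<Rightarrow> real"
    by (rule integral_lebesgue_on_eq_lborel[OF that(1) \<Omega>' that(2)])
  have meas: "\<psi> \<in> borel_measurable borel" "grad \<psi> \<in> borel_measurable borel" if "\<psi> \<in> test_functions \<Omega>" for \<psi>
    using smooth_borel_measurable grad_borel_measurable test_functions_smooth[OF that] by auto
  have b1: "(LINT x|lborel. (W n x)\<^sup>2) \<le> C1" for n
  proof -
    have [measurable]: "W n \<in> borel_measurable borel" by (rule meas(1)[OF Wt])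
    note kb = K_bounds[OF test_measurable[OF \<phi>0(1)] KC C, of n]
    have "(LINT x|lborel. (W n x)\<^sup>2) = (LINT x|M. (W n x)\<^sup>2)"
      by (rule to_lborel[symmetric]) (use test_functions_zero_outside[OF Wt] in auto)
    also have "\<dots> \<le> (LINT x|M. (\<phi>0 n x)\<^sup>2)"
    proof (rule integral_mono)
      show "integrable M (\<lambda>x. (W n x)\<^sup>2)"
        using test_functions_power_integrable(1)[OF open_\<Omega> bounded_\<Omega> Wt, of 2 n] by (simp add: power_integrable_2)
      show "integrable M (\<lambda>x. (\<phi>0 n x)\<^sup>2)" using kb(5) by (simp add: power_integrable_2)
      fix x
      have "\<bar>soft_trunc 1 (\<phi>0 n x) - soft_trunc 1 0\<bar> \<le> 1 * \<bar>\<phi>0 n x - 0\<bar>"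
      proof (rule real_Lipschitz[OF soft_trunc_has_derivative])
        show "\<bar>soft_trunc_deriv 1 t\<bar> \<le> 1" for t using soft_trunc_deriv_bounds[of 1 t] by simp
      qed simp
      then have "\<bar>W n x\<bar> \<le> \<bar>\<phi>0 n x\<bar>" by (simp add: W_def)
      then show "(W n x)\<^sup>2 \<le> (\<phi>0 n x)\<^sup>2" by (simp add: abs_le_square_iff)
    qed
    also have "\<dots> \<le> C1" using kb(6) by (simp add: C1_def)
    finally show ?thesis .
  qed
  have b2: "(LINT x|lborel. (norm (grad (W n) x))\<^sup>2) \<le> C1" for n
  proof -
    have [measurable]: "grad (W n) \<in> borel_measurable borel" by (rule meas(2)[OF Wt])
    have "(LINT x|lborel. (norm (grad (W n) x))\<^sup>2) = (LINT x|M. (norm (grad (W n) x))\<^sup>2)"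
      by (rule to_lborel[symmetric]) (use test_functions_grad_zero_outside[OF Wt] in auto)
    also have "\<dots> \<le> (2 + 2 * B\<^sup>2 * 1\<^sup>2) * (C / \<alpha>)"
      using grad_soft_trunc_bound[OF \<phi>0(1) _ KC C, of 1 n] unfolding W_def[abs_def] by simp
    also have "\<dots> \<le> C1" by (simp add: C1_def)
    finally show ?thesis .
  qed
  obtain r :: "nat \<Rightarrow> nat" where r: "strict_mono r"
    "\<And>n m. n \<le> m \<Longrightarrow> (LINT x|lborel. (W (r n) x - W (r m) x)\<^sup>2) \<le> (1/2)^n"
    by (rule Rellich_test_functions[OF bounded_\<Omega> Wt b1 b2]) (rule that)
  have Wi: "power_integrable M 2 (W n)" for n
    by (rule test_functions_power_integrable(1)[OF open_\<Omega> bounded_\<Omega> Wt]) simp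
  have cauchy: "(LINT x|M. (norm (W (r n) x - W (r m) x))\<^sup>2) \<le> (1/2)^n" if "n \<le> m" for n m
  proof -
    have [measurable]: "W i \<in> borel_measurable borel" for i by (rule meas(1)[OF Wt])
    have "(LINT x|M. (W (r n) x - W (r m) x)\<^sup>2) = (LINT x|lborel. (W (r n) x - W (r m) x)\<^sup>2)"
      by (rule to_lborel) (use test_functions_zero_outside[OF Wt] in auto)
    then show ?thesis using r(2)[OF that] by simp
  qed
  have half: "(\<lambda>n. (1/2::real)^n) \<longlonglongrightarrow> 0" by (rule LIMSEQ_realpow_zero) auto
  obtain w where w: "power_integrable M 2 w" "(\<lambda>n. LINT x|M. (norm (W (r n) x - w x))\<^sup>2) \<longlonglongrightarrow> 0"
    by (rule square_Cauchy_imp_convergent[OF Wi half finite_M cauchy])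
  have nw0: "power_null M 2 (\<lambda>n x. w x - W (r n) x)"
    unfolding power_null_def using power_integrable_diff[OF w(1) Wi] w(2)
    by (simp add: power2_commute[of "w _"])
  obtain s :: "nat \<Rightarrow> nat" where s: "strict_mono s" "AE x in M. (\<lambda>k. w x - W (r (s k)) x) \<longlonglongrightarrow> 0"
    by (rule power_null_imp_dominated_subseq[OF nw0]) (simp, rule that)
  define t where "t n = r (s n)" for n
  have t: "n \<le> t n" for n
    using strict_mono_imp_increasing[OF strict_mono_o[OF r(1) s(1)], of n] by (simp add: t_def)
  define \<phi> where "\<phi> n = \<phi>0 (t n)" for n
  have \<phi>: "\<phi> n \<in> test_functions \<Omega>" for n by (simp add: \<phi>_def \<phi>0(1))
  have K\<phi>: "K (\<phi> n) (grad (\<phi> n)) \<le> ennreal (I + e n)" for n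
  proof -
    have "ennreal (I + e (t n)) \<le> ennreal (I + e n)" using e(3)[OF t[of n]] by (intro ennreal_leI) simp
    then show ?thesis using \<phi>0(2)[of "t n"] unfolding \<phi>_def by (rule order_trans[rotated])
  qed
  have nw: "power_null M 2 (\<lambda>n x. w x - soft_trunc 1 (\<phi> n x))"
    using power_null_subseq[OF nw0 s(1)] by (simp add: W_def \<phi>_def t_def)
  have wm [measurable]: "w \<in> borel_measurable M" using w(1) by (simp add: power_integrable_def)
  have \<phi>u: "AE x in M. (\<lambda>n. \<phi> n x) \<longlonglongrightarrow> sinh (w x)"
    using s(2)
  proof eventually_elim
    case (elim x)
    from tendsto_diff[OF tendsto_const[of "w x"] elim] have "(\<lambda>k. W (r (s k)) x) \<longlonglongrightarrow> w x" by simp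
    then have "(\<lambda>k. sinh (W (r (s k)) x)) \<longlonglongrightarrow> sinh (w x)" by (rule tendsto_sinh)
    then show ?case by (simp add: W_def soft_trunc_def \<phi>_def t_def)
  qed
  have bnd: "(LINT x|M. (norm (grad (\<lambda>x. soft_trunc \<kappa> (\<phi> n x)) x))\<^sup>2) \<le> (2 + 2 * B\<^sup>2 * \<kappa>\<^sup>2) * (C / \<alpha>)" if "\<kappa> \<ge> 1" for \<kappa> n
    unfolding \<phi>_def by (rule grad_soft_trunc_bound[OF \<phi>0(1) _ KC C]) (use that in simp)
  have lim: "\<exists>c h. (\<forall>n. tail_weights n (c n)) \<and> sobolev0 2 \<Omega> (\<lambda>x. soft_trunc \<kappa> (sinh (w x))) h \<and>
      power_null M 2 (\<lambda>n x. h x - wavg (c n) (\<lambda>m. grad (\<lambda>x. soft_trunc \<kappa> (\<phi> m x)) x))" if "\<kappa> \<ge> 1" for \<kappa>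
    by (rule soft_trunc_limit[OF open_\<Omega> bounded_\<Omega> \<phi> bnd[OF that] w(1) nw that]) blast
  \<comment> \<open>For \<open>\<kappa> = 1\<close> the composition of \<open>soft_trunc 1\<close>
    with \<open>sinh\<close> is the identity, so the limit field is a gradient of \<open>w\<close>
    itself.\<close>
  obtain G where G: "sobolev0 2 \<Omega> w G"
    using lim[of 1] by (auto simp: soft_trunc_1_sinh)
  have Gm [measurable]: "G \<in> borel_measurable M" using G by (simp add: sobolev0_def power_integrable_def)
  have main: "K (\<lambda>x. sinh (w x)) (\<lambda>x. (soft_trunc_deriv \<kappa> (sinh (w x)) * cosh (w x)) *\<^sub>R G x) \<le> ennreal I" if \<kappa>: "\<kappa> \<ge> 1" for \<kappa>
  proof -
    obtain c h where c: "\<And>n. tail_weights n (c n)" and h: "sobolev0 2 \<Omega> (\<lambda>x. soft_trunc \<kappa> (sinh (w x))) h"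
      and nh: "power_null M 2 (\<lambda>n x. h x - wavg (c n) (\<lambda>m. grad (\<lambda>x. soft_trunc \<kappa> (\<phi> m x)) x))"
      using lim[OF \<kappa>] by blast
    have \<kappa>0: "\<kappa> > 0" using \<kappa> by linarith
    have hm: "h \<in> borel_measurable M" using h by (simp add: sobolev0_def power_integrable_def)
    have um: "(\<lambda>x. sinh (w x)) \<in> borel_measurable M"
      by (rule measurable_compose[OF wm smooth_borel_measurable[OF smooth_sinh]])
    \<comment> \<open>The same function has two gradients, one from the chain rule applied to
      \<open>w\<close>, the other the limit \<open>h\<close>; they must agree almost
      everywhere.\<close>
    have "sobolev0 2 \<Omega> (\<lambda>x. soft_trunc \<kappa> (sinh (w x))) (\<lambda>x. (soft_trunc_deriv \<kappa> (sinh (w x)) * cosh (w x)) *\<^sub>R G x)"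
      by (rule sobolev0_compose_smooth[OF open_\<Omega> bounded_\<Omega> _ G soft_trunc_sinh(3)[OF \<kappa>] _ soft_trunc_sinh(1,2)[OF \<kappa>]]) auto
    then have "has_weak_grad \<Omega> (\<lambda>x. soft_trunc \<kappa> (sinh (w x))) (\<lambda>x. (soft_trunc_deriv \<kappa> (sinh (w x)) * cosh (w x)) *\<^sub>R G x)"
      by (rule sobolev0_has_weak_grad[OF open_\<Omega> bounded_\<Omega>, rotated]) simp
    moreover have "has_weak_grad \<Omega> (\<lambda>x. soft_trunc \<kappa> (sinh (w x))) h"
      by (rule sobolev0_has_weak_grad[OF open_\<Omega> bounded_\<Omega> _ h]) simp
    ultimately have ae: "AE x in M. (soft_trunc_deriv \<kappa> (sinh (w x)) * cosh (w x)) *\<^sub>R G x = h x"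
      using has_weak_grad_unique[OF _ _ open_\<Omega>] by blast
    have "K (\<lambda>x. sinh (w x)) (\<lambda>x. (soft_trunc_deriv \<kappa> (sinh (w x)) * cosh (w x)) *\<^sub>R G x) = K (\<lambda>x. sinh (w x)) h"
      unfolding K_def density_def by (rule nn_integral_cong_AE) (use ae in eventually_elim, simp)
    also have "\<dots> \<le> ennreal I"
      by (rule K_lower_semicontinuous[OF \<phi> K\<phi> I less_imp_le[OF e(2)] e(1,3) um hm \<phi>u c \<kappa>0 nh])
    finally show ?thesis .
  qed
  show ?thesis by (rule that[OF G I lower main])
qed

text \<open>As \<open>\<kappa>\<close> runs through the positive integers,
  \<open>soft_trunc_deriv \<kappa>\<close> tends to 1 everywhere, and Fatou's lemma keeps the bound
  \<open>I\<close>, which is independent of \<open>\<kappa>\<close>. The field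
  \<open>cosh w * G\<close> is what the chain rule predicts for \<open>sinh w\<close>; that it is a
  weak gradient is settled in \<open>exists_minimizer\<close>.\<close>

lemma exists_minimizer_over_test_functions:
  obtains w G I where "sobolev0 2 \<Omega> w G" "I \<ge> 0" "\<And>\<psi>. \<psi> \<in> test_functions \<Omega> \<Longrightarrow> ennreal I \<le> K \<psi> (grad \<psi>)"
    "K (\<lambda>x. sinh (w x)) (\<lambda>x. cosh (w x) *\<^sub>R G x) \<le> ennreal I"
proof -
  obtain w G I where G: "sobolev0 2 \<Omega> w G" and I: "I \<ge> 0" "\<And>\<psi>. \<psi> \<in> test_functions \<Omega> \<Longrightarrow> ennreal I \<le> K \<psi> (grad \<psi>)"
    and le: "\<And>\<kappa>. \<kappa> \<ge> 1 \<Longrightarrow> K (\<lambda>x. sinh (w x)) (\<lambda>x. (soft_trunc_deriv \<kappa> (sinh (w x)) * cosh (w x)) *\<^sub>R G x) \<le> ennreal I"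
    by (rule exists_weak_limit_of_minimizing_sequence) (rule that)
  let ?u = "\<lambda>x. sinh (w x)"
  define g where "g n x = (soft_trunc_deriv (real (Suc n)) (?u x) * cosh (w x)) *\<^sub>R G x" for n x
  have wm: "w \<in> borel_measurable M" and Gm: "G \<in> borel_measurable M"
    using G by (auto simp: sobolev0_def power_integrable_def)
  have um: "?u \<in> borel_measurable M" and cm: "(\<lambda>x. cosh (w x)) \<in> borel_measurable M"
    by (rule measurable_compose[OF wm smooth_borel_measurable[OF smooth_sinh]],
        rule measurable_compose[OF wm smooth_borel_measurable[OF smooth_cosh]])
  have gm: "g n \<in> borel_measurable M" for n
  proof -
    have "(\<lambda>s. soft_trunc_deriv (real (Suc n)) s) \<in> borel_measurable borel"
      unfolding soft_trunc_deriv_def by measurable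
    from measurable_compose[OF um this] show ?thesis
      unfolding g_def[abs_def] using cm Gm by measurable
  qed
  have "K ?u (\<lambda>x. cosh (w x) *\<^sub>R G x) = (\<integral>\<^sup>+x. liminf (\<lambda>n. ennreal (density ?u (g n) x)) \<partial>M)"
    unfolding K_def
  proof (rule nn_integral_cong)
    fix x
    have "(\<lambda>n. g n x) \<longlonglongrightarrow> (1 * cosh (w x)) *\<^sub>R G x"
      unfolding g_def by (intro tendsto_intros soft_trunc_deriv_tendsto)
    then have "(\<lambda>n. j x (g n x)) \<longlonglongrightarrow> j x (cosh (w x) *\<^sub>R G x)"
      using j_cont by (auto intro: continuous_on_tendsto_compose[of UNIV "j x"])
    moreover have "(1 + b x * \<bar>?u x\<bar>)\<^sup>2 \<noteq> 0" using weight(1)[of x "?u x"] by simp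
    ultimately have "(\<lambda>n. ennreal (density ?u (g n) x)) \<longlonglongrightarrow> ennreal (density ?u (\<lambda>x. cosh (w x) *\<^sub>R G x) x)"
      unfolding density_def by (intro tendsto_ennrealI tendsto_intros) auto
    then show "ennreal (density ?u (\<lambda>x. cosh (w x) *\<^sub>R G x) x) = liminf (\<lambda>n. ennreal (density ?u (g n) x))"
      by (rule lim_imp_Liminf[OF sequentially_bot, symmetric])
  qed
  also have "\<dots> \<le> liminf (\<lambda>n. \<integral>\<^sup>+x. ennreal (density ?u (g n) x) \<partial>M)"
    by (rule nn_integral_liminf) (use density_measurable[OF um gm] in measurable)
  also have "\<dots> \<le> liminf (\<lambda>n. ennreal I)"
  proof (rule Liminf_mono, rule always_eventually, rule allI)
    fix n
    have "real (Suc n) \<ge> 1" by simp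
    from le[OF this] show "(\<integral>\<^sup>+x. ennreal (density ?u (g n) x) \<partial>M) \<le> ennreal I"
      unfolding K_def g_def .
  qed
  also have "\<dots> = ennreal I" by (rule Liminf_const) simp
  finally have "K ?u (\<lambda>x. cosh (w x) *\<^sub>R G x) \<le> ennreal I" .
  from that[OF G I this] show ?thesis .
qed

text \<open>The shift is the constant from completing the square. It is added to the energy rather
  than subtracted from \<open>K\<close>, and it is the same for all competitors, so minimizing
  either quantity is equivalent.\<close>

lemma energy_eq_K:
  assumes u: "power_integrable M 2 u" and g: "g \<in> borel_measurable M" and ae: "AE x in M. weak_grad \<Omega> u x = g x"
  shows "energy j b f \<Omega> u + ereal ((LINT x|M. (f x)\<^sup>2) / 2) = enn2ereal (K u g)"
proof -
  have um [measurable]: "u \<in> borel_measurable M" using u by (simp add: power_integrable_def)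
  note [measurable] = g b_meas caratheodory_measurable[OF j_meas j_cont g]
  define E where "E = (\<integral>\<^sup>+x. ennreal (j x (g x) / (1 + b x * \<bar>u x\<bar>)\<^sup>2) \<partial>M)"
  have E: "(\<integral>\<^sup>+x. ennreal (j x (weak_grad \<Omega> u x) / (1 + b x * \<bar>u x\<bar>)\<^sup>2) \<partial>M) = E"
    unfolding E_def by (rule nn_integral_cong_AE) (use ae in eventually_elim, simp)
  have ui: "integrable M (\<lambda>x. (u x)\<^sup>2)" and fi: "integrable M (\<lambda>x. (f x)\<^sup>2)"
    using u f_sq by (simp_all add: power_integrable_2)
  have fu: "integrable M (\<lambda>x. f x * u x)"
  proof (rule Bochner_Integration.integrable_bound[where f = "\<lambda>x. (f x)\<^sup>2 + (u x)\<^sup>2"])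
    show "AE x in M. norm (f x * u x) \<le> norm ((f x)\<^sup>2 + (u x)\<^sup>2)"
    proof (rule AE_I2)
      fix x
      have "0 \<le> (\<bar>f x\<bar> - \<bar>u x\<bar>)\<^sup>2" by simp
      then have "2 * (\<bar>f x\<bar> * \<bar>u x\<bar>) \<le> (f x)\<^sup>2 + (u x)\<^sup>2" by (simp add: power2_diff)
      moreover have "0 \<le> \<bar>f x\<bar> * \<bar>u x\<bar>" by simp
      ultimately have "\<bar>f x\<bar> * \<bar>u x\<bar> \<le> (f x)\<^sup>2 + (u x)\<^sup>2" by linarith
      then show "norm (f x * u x) \<le> norm ((f x)\<^sup>2 + (u x)\<^sup>2)" by (simp add: abs_mult)
    qed
  qed (use ui fi in auto)
  define a where "a = (LINT x|M. (u x - f x)\<^sup>2 / 2)"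
  have a0: "a \<ge> 0" unfolding a_def by (simp add: Bochner_Integration.integral_nonneg)
  have exp_eq: "(u x - f x)\<^sup>2 / 2 = (1/2) * (u x)\<^sup>2 - f x * u x + (1/2) * (f x)\<^sup>2" for x
    by (simp add: power2_diff field_simps)
  have a_eq: "a = 1 / 2 * (LINT x|M. \<bar>u x\<bar>\<^sup>2) - (LINT x|M. f x * u x) + (LINT x|M. (f x)\<^sup>2) / 2"
    unfolding a_def exp_eq using ui fi fu by simp
  have ai: "integrable M (\<lambda>x. (u x - f x)\<^sup>2 / 2)" unfolding exp_eq using ui fi fu by simp
  have "K u g = (\<integral>\<^sup>+x. ennreal (j x (g x) / (1 + b x * \<bar>u x\<bar>)\<^sup>2) + ennreal ((u x - f x)\<^sup>2 / 2) \<partial>M)"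
    unfolding K_def density_def
    by (intro nn_integral_cong ennreal_plus divide_nonneg_nonneg j_nonneg) auto
  also have "\<dots> = E + (\<integral>\<^sup>+x. ennreal ((u x - f x)\<^sup>2 / 2) \<partial>M)"
    unfolding E_def by (rule nn_integral_add) measurable
  also have "(\<integral>\<^sup>+x. ennreal ((u x - f x)\<^sup>2 / 2) \<partial>M) = ennreal a"
    unfolding a_def by (rule nn_integral_eq_integral[OF ai]) simp
  finally have "enn2ereal (K u g) = enn2ereal E + ereal a"
    using a0 by (simp add: plus_ennreal.rep_eq enn2ereal_ennreal)
  then show ?thesis
    unfolding energy_def E a_eq by (simp add: add.assoc)
qed

theorem exists_minimizer:
  "\<exists>u \<in> W1_0 1 \<Omega> \<inter> Lp 2 \<Omega>.
     (\<forall>v \<in> H1_0 \<Omega>. energy j b f \<Omega> u \<le> energy j b f \<Omega> v) \<and> (\<forall>k>0. (\<lambda>x. trunc k (u x)) \<in> H1_0 \<Omega>)"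
proof -
  obtain w G I where G: "sobolev0 2 \<Omega> w G" and I: "I \<ge> 0" "\<And>\<psi>. \<psi> \<in> test_functions \<Omega> \<Longrightarrow> ennreal I \<le> K \<psi> (grad \<psi>)"
    and KI: "K (\<lambda>x. sinh (w x)) (\<lambda>x. cosh (w x) *\<^sub>R G x) \<le> ennreal I"
    by (rule exists_minimizer_over_test_functions) (rule that)
  define u where "u x = sinh (w x)" for x
  define g where "g x = cosh (w x) *\<^sub>R G x" for x
  have Kug: "K u g \<le> ennreal I" using KI by (simp add: u_def[abs_def] g_def[abs_def])
  have wm: "w \<in> borel_measurable M" and Gm: "G \<in> borel_measurable M"
    using G by (auto simp: sobolev0_def power_integrable_def)
  have um [measurable]: "u \<in> borel_measurable M"
    unfolding u_def[abs_def] by (rule measurable_compose[OF wm smooth_borel_measurable[OF smooth_sinh]])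
  have cm: "(\<lambda>x. cosh (w x)) \<in> borel_measurable M"
    by (rule measurable_compose[OF wm smooth_borel_measurable[OF smooth_cosh]])
  have gm [measurable]: "g \<in> borel_measurable M" unfolding g_def[abs_def] using cm Gm by measurable
  note kb = K_bounds[OF um gm Kug I(1)]
  have u2: "power_integrable M 2 u" by (rule kb(5))
  have u1: "power_integrable M 1 u" by (rule power_integrable_imp_1(1)[OF finite_M u2]) simp
  interpret fm: finite_measure M by (rule finite_M)
  have gi: "integrable M g"
  proof (rule Bochner_Integration.integrable_bound[where f = "\<lambda>x. (norm (g x))\<^sup>2 / (1 + B * \<bar>u x\<bar>)\<^sup>2 + (2 + 2 * B\<^sup>2 * (u x)\<^sup>2)"])
    show "integrable M (\<lambda>x. (norm (g x))\<^sup>2 / (1 + B * \<bar>u x\<bar>)\<^sup>2 + (2 + 2 * B\<^sup>2 * (u x)\<^sup>2))"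
      using kb(3) u2 by (simp add: power_integrable_2)
    show "AE x in M. norm (g x) \<le> norm ((norm (g x))\<^sup>2 / (1 + B * \<bar>u x\<bar>)\<^sup>2 + (2 + 2 * B\<^sup>2 * (u x)\<^sup>2))"
    proof (rule AE_I2)
      fix x
      define y where "y = 1 + B * \<bar>u x\<bar>"
      have y: "y > 0" using weight[of x "u x"] unfolding y_def by linarith
      have "0 \<le> (norm (g x) / y - y)\<^sup>2" by simp
      then have "2 * norm (g x) \<le> (norm (g x))\<^sup>2 / y\<^sup>2 + y\<^sup>2" using y by (simp add: power2_diff power_divide)
      moreover have "0 \<le> (1 - B * \<bar>u x\<bar>)\<^sup>2" by simp
      then have "y\<^sup>2 \<le> 2 + 2 * B\<^sup>2 * (u x)\<^sup>2" by (simp add: y_def power2_sum power2_diff power_mult_distrib)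
      ultimately have "2 * norm (g x) \<le> (norm (g x))\<^sup>2 / y\<^sup>2 + (2 + 2 * B\<^sup>2 * (u x)\<^sup>2)" by linarith
      then have "norm (g x) \<le> (norm (g x))\<^sup>2 / y\<^sup>2 + (2 + 2 * B\<^sup>2 * (u x)\<^sup>2)" using norm_ge_zero[of "g x"] by linarith
      then show "norm (g x) \<le> norm ((norm (g x))\<^sup>2 / (1 + B * \<bar>u x\<bar>)\<^sup>2 + (2 + 2 * B\<^sup>2 * (u x)\<^sup>2))"
        by (simp add: y_def)
    qed
  qed (rule gm)
  then have g1: "power_integrable M 1 g" by (simp add: power_integrable_def)
  have Tk: "\<exists>\<rho>. sobolev0 2 \<Omega> (\<lambda>x. trunc k (u x)) (\<lambda>x. \<rho> (w x) *\<^sub>R G x) \<and>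
      (\<forall>t. \<bar>\<rho> t\<bar> \<le> cosh t) \<and> (\<forall>t. \<bar>sinh t\<bar> < k \<longrightarrow> \<rho> t = cosh t)" if k: "k > 0" for k
  proof -
    obtain \<rho> where "sobolev0 2 \<Omega> (\<lambda>x. trunc k (sinh (w x))) (\<lambda>x. \<rho> (w x) *\<^sub>R G x)"
      "\<And>t. \<bar>\<rho> t\<bar> \<le> cosh t" "\<And>t. \<bar>sinh t\<bar> < k \<Longrightarrow> \<rho> t = cosh t"
      by (rule sobolev0_trunc_sinh[OF open_\<Omega> bounded_\<Omega> _ G k]) (simp, rule that)
    then show ?thesis unfolding u_def by blast
  qed
  have T: "(\<lambda>x. trunc k (u x)) \<in> H1_0 \<Omega>" if "k > 0" for k
    using Tk[OF that] sobolev0_imp_W1_0[OF open_\<Omega> bounded_\<Omega>, of 2] by force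
  have "\<exists>\<rho>. sobolev0 2 \<Omega> (\<lambda>x. trunc (real (Suc n)) (u x)) (\<lambda>x. \<rho> (w x) *\<^sub>R G x) \<and>
      (\<forall>t. \<bar>\<rho> t\<bar> \<le> cosh t) \<and> (\<forall>t. \<bar>sinh t\<bar> < real (Suc n) \<longrightarrow> \<rho> t = cosh t)" for n
    by (rule Tk) simp
  then obtain \<rho> where \<rho>: "\<And>n. sobolev0 2 \<Omega> (\<lambda>x. trunc (real (Suc n)) (u x)) (\<lambda>x. \<rho> n (w x) *\<^sub>R G x)"
    "\<And>n t. \<bar>\<rho> n t\<bar> \<le> cosh t" "\<And>n t. \<bar>sinh t\<bar> < real (Suc n) \<Longrightarrow> \<rho> n t = cosh t"
    by metis
  have \<rho>1: "sobolev0 1 \<Omega> (\<lambda>x. trunc (real (Suc n)) (u x)) (\<lambda>x. \<rho> n (w x) *\<^sub>R G x)" for n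
    by (rule sobolev0_imp_sobolev0_1[OF open_\<Omega> bounded_\<Omega> _ \<rho>(1)]) simp
  \<comment> \<open>At each point the truncations and their gradient fields become stationary once
    the level exceeds \<open>|u x|\<close>, so both pointwise limits below are eventual
    equalities.\<close>
  have ev: "\<forall>\<^sub>F n in sequentially. \<bar>u x\<bar> < real (Suc n)" for x
  proof -
    obtain N where "\<bar>u x\<bar> < real N" using reals_Archimedean2 by blast
    then have "\<bar>u x\<bar> < real (Suc n)" if "n \<ge> N" for n using that by simp
    then show ?thesis by (auto simp: eventually_sequentially)
  qed
  \<comment> \<open>Only the truncations are known to be Sobolev functions, so \<open>u\<close> is
    reached by closure in \<open>W_0^{1,1}\<close>, with domination by \<open>2 * |u|\<close> and
    \<open>2 * |g|\<close>. This also identifies \<open>g\<close> as a weak gradient of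
    \<open>u\<close>.\<close>
  have s1: "sobolev0 1 \<Omega> u g"
  proof (rule sobolev0_closed[OF open_\<Omega> bounded_\<Omega> _ \<rho>1 u1 g1])
    have tm: "(\<lambda>x. trunc (real (Suc n)) (u x)) \<in> borel_measurable M" "(\<lambda>x. \<rho> n (w x) *\<^sub>R G x) \<in> borel_measurable M" for n
      using \<rho>1[of n] by (simp_all add: sobolev0_def power_integrable_def)
    show "power_null M 1 (\<lambda>n x. u x - trunc (real (Suc n)) (u x))"
    proof (rule power_null_dominated[OF _ u1, where C = 2])
      show "(\<lambda>x. u x - trunc (real (Suc n)) (u x)) \<in> borel_measurable M" for n using tm(1)[of n] um by measurable
      show "AE x in M. (\<lambda>n. u x - trunc (real (Suc n)) (u x)) \<longlonglongrightarrow> 0"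
      proof (rule AE_I2)
        fix x
        show "(\<lambda>n. u x - trunc (real (Suc n)) (u x)) \<longlonglongrightarrow> 0"
        proof (rule tendsto_eventually)
          show "\<forall>\<^sub>F n in sequentially. u x - trunc (real (Suc n)) (u x) = 0"
            using ev[of x] by eventually_elim (auto simp: trunc_def)
        qed
      qed
      show "AE x in M. norm (u x - trunc (real (Suc n)) (u x)) \<le> 2 * norm (u x)" for n
      proof (rule AE_I2)
        fix x
        have "\<bar>trunc (real (Suc n)) (u x)\<bar> \<le> \<bar>u x\<bar>" by (rule abs_trunc_le) simp
        then show "norm (u x - trunc (real (Suc n)) (u x)) \<le> 2 * norm (u x)" unfolding real_norm_def by linarith
      qed
    qed simp
    show "power_null M 1 (\<lambda>n x. g x - \<rho> n (w x) *\<^sub>R G x)"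
    proof (rule power_null_dominated[OF _ g1, where C = 2])
      show "(\<lambda>x. g x - \<rho> n (w x) *\<^sub>R G x) \<in> borel_measurable M" for n using tm(2)[of n] gm by measurable
      show "AE x in M. (\<lambda>n. g x - \<rho> n (w x) *\<^sub>R G x) \<longlonglongrightarrow> 0"
      proof (rule AE_I2)
        fix x
        show "(\<lambda>n. g x - \<rho> n (w x) *\<^sub>R G x) \<longlonglongrightarrow> 0"
        proof (rule tendsto_eventually)
          show "\<forall>\<^sub>F n in sequentially. g x - \<rho> n (w x) *\<^sub>R G x = 0"
            using ev[of x] by eventually_elim (use \<rho>(3) in \<open>simp add: u_def g_def\<close>)
        qed
      qed
      show "AE x in M. norm (g x - \<rho> n (w x) *\<^sub>R G x) \<le> 2 * norm (g x)" for n
      proof (rule AE_I2)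
        fix x
        have "norm (\<rho> n (w x) *\<^sub>R G x) \<le> norm (g x)"
          using \<rho>(2)[of n "w x"] by (simp add: g_def mult_right_mono)
        then show "norm (g x - \<rho> n (w x) *\<^sub>R G x) \<le> 2 * norm (g x)"
          using norm_triangle_ineq4[of "g x" "\<rho> n (w x) *\<^sub>R G x"] by linarith
      qed
    qed simp
  qed simp
  have uW: "u \<in> W1_0 1 \<Omega> \<inter> Lp 2 \<Omega>"
    using sobolev0_imp_W1_0[OF open_\<Omega> bounded_\<Omega> _ s1] u2 by (simp add: Lp_eq_power_integrable)
  have "energy j b f \<Omega> u \<le> energy j b f \<Omega> v" if v: "v \<in> H1_0 \<Omega>" for v
  proof -
    obtain h where h: "sobolev0 2 \<Omega> v h"
      by (rule W1_0_imp_sobolev0[OF open_\<Omega> bounded_\<Omega> _ v]) (simp, rule that)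
    have hp: "power_integrable M 2 v" "h \<in> borel_measurable M" using h by (simp_all add: sobolev0_def power_integrable_def)
    have wv: "has_weak_grad \<Omega> v h" by (rule sobolev0_has_weak_grad[OF open_\<Omega> bounded_\<Omega> _ h]) simp
    have wu: "has_weak_grad \<Omega> u g" by (rule sobolev0_has_weak_grad[OF open_\<Omega> bounded_\<Omega> _ s1]) simp
    have "K u g \<le> K v h" using Kug K_le_of_test_functions[OF h I(2)] by (rule order_trans)
    then have "enn2ereal (K u g) \<le> enn2ereal (K v h)" by (simp add: less_eq_ennreal.rep_eq)
    then have "energy j b f \<Omega> u + ereal ((LINT x|M. (f x)\<^sup>2) / 2) \<le> energy j b f \<Omega> v + ereal ((LINT x|M. (f x)\<^sup>2) / 2)"
      unfolding energy_eq_K[OF u2 gm weak_grad_AE_eq[OF wu open_\<Omega>]]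
        energy_eq_K[OF hp weak_grad_AE_eq[OF wv open_\<Omega>]] .
    \<comment> \<open>The shift is a real number and cancels, also when an energy is
      infinite.\<close>
    then show ?thesis
      by (cases "energy j b f \<Omega> u"; cases "energy j b f \<Omega> v") auto
  qed
  with uW T show ?thesis by blast
qed

end

section \<open>From hypotheses almost everywhere to hypotheses everywhere\<close>

theorem theorem1:
  fixes \<Omega> :: "(real ^ 'n) set"
    and j :: "real ^ 'n \<Rightarrow> real ^ 'n \<Rightarrow> real"
    and b f :: "real ^ 'n \<Rightarrow> real"
    and \<alpha> \<beta> \<gamma> B :: real
  assumes "CARD('n) > 2"
    and "open \<Omega>" "bounded \<Omega>"
    and "\<And>\<xi>. (\<lambda>x. j x \<xi>) \<in> borel_measurable (lebesgue_on \<Omega>)"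
    and "AE x in lebesgue_on \<Omega>. convex_on UNIV (j x) \<and> Ck 1 (j x)"
    and "\<alpha> > 0" "\<beta> > 0" "\<gamma> > 0"
    and "AE x in lebesgue_on \<Omega>. \<forall>\<xi>.
           \<alpha> * (norm \<xi>)\<^sup>2 \<le> j x \<xi> \<and> j x \<xi> \<le> \<beta> * (norm \<xi>)\<^sup>2 \<and> norm (grad (j x) \<xi>) \<le> \<gamma> * norm \<xi>"
    and "b \<in> borel_measurable (lebesgue_on \<Omega>)"
    and "B > 0"
    and "AE x in lebesgue_on \<Omega>. 0 \<le> b x \<and> b x \<le> B"
    and "f \<in> Lp 2 \<Omega>"
  shows "\<exists>u \<in> W1_0 1 \<Omega> \<inter> Lp 2 \<Omega>.
           (\<forall>v \<in> H1_0 \<Omega>. energy j b f \<Omega> u \<le> energy j b f \<Omega> v) \<and>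
           (\<forall>k>0. (\<lambda>x. trunc k (u x)) \<in> H1_0 \<Omega>)"
proof -
  let ?M = "lebesgue_on \<Omega>"
  define P where "P x \<longleftrightarrow> convex_on UNIV (j x) \<and> continuous_on UNIV (j x) \<and>
      (\<forall>\<xi>. \<alpha> * (norm \<xi>)\<^sup>2 \<le> j x \<xi> \<and> j x \<xi> \<le> \<beta> * (norm \<xi>)\<^sup>2) \<and> 0 \<le> b x \<and> b x \<le> B" for x
  have P: "AE x in ?M. P x"
    using assms(5,9,12)
  proof eventually_elim
    case (elim x)
    then show ?case using Ck_continuous[of 1 "j x"] by (auto simp: P_def)
  qed
  \<comment> \<open>The exceptional set is null, hence measurable by completeness of Lebesgue
    measure; the measurability of the modified \<open>j\<close> and \<open>b\<close> rests on
    this.\<close>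
  have Pm: "{x \<in> space ?M. P x} \<in> sets ?M"
  proof -
    have \<Omega>': "\<Omega> \<in> sets lebesgue" using assms(2) by simp
    have "negligible {x \<in> \<Omega>. \<not> P x}" using P AE_lebesgue_on_iff_negligible[OF \<Omega>'] by blast
    then have "{x \<in> \<Omega>. \<not> P x} \<in> sets lebesgue" by (rule negligible_imp_sets)
    then have "\<Omega> - {x \<in> \<Omega>. \<not> P x} \<in> sets lebesgue" using \<Omega>' by blast
    moreover have "\<Omega> - {x \<in> \<Omega>. \<not> P x} = {x \<in> \<Omega>. P x}" by blast
    ultimately have "{x \<in> \<Omega>. P x} \<in> sets lebesgue" by simp
    moreover have "{x \<in> \<Omega>. P x} \<in> sets ?M \<longleftrightarrow> {x \<in> \<Omega>. P x} \<subseteq> \<Omega> \<and> {x \<in> \<Omega>. P x} \<in> sets lebesgue"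
      by (rule sets_restrict_space_iff) (use \<Omega>' in simp)
    ultimately show ?thesis by auto
  qed
  \<comment> \<open>At exceptional points \<open>j\<close> is replaced by the model integrand
    \<open>\<alpha> |\<xi>|^2\<close> and \<open>b\<close> by 0, which meet all structural
    conditions. The change concerns a null set, so every energy keeps its value.\<close>
  define j' where "j' x \<xi> = (if P x then j x \<xi> else \<alpha> * (norm \<xi>)\<^sup>2)" for x \<xi>
  define b' where "b' x = (if P x then b x else 0)" for x
  have j'_P: "j' x = j x" if "P x" for x using that by (simp add: j'_def fun_eq_iff)
  have j'_not_P: "j' x = (\<lambda>\<xi>. \<alpha> * (norm \<xi>)\<^sup>2)" if "\<not> P x" for x using that by (simp add: j'_def fun_eq_iff)
  \<comment> \<open>The model integrand has upper constant \<open>\<alpha>\<close> and the original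
    one \<open>\<beta>\<close>, hence the maximum.\<close>
  have "degenerate_functional \<Omega> j' b' f \<alpha> (max \<alpha> \<beta>) B"
  proof
    show "(\<lambda>x. j' x \<xi>) \<in> borel_measurable ?M" for \<xi>
      unfolding j'_def by (rule measurable_If[OF assms(4) _ Pm]) simp
    show "b' \<in> borel_measurable ?M"
      unfolding b'_def[abs_def] by (rule measurable_If[OF assms(10) _ Pm]) simp
    have sq: "continuous_on UNIV (\<lambda>\<xi> :: real ^ 'n. \<alpha> * (norm \<xi>)\<^sup>2)" by (intro continuous_intros)
    show "continuous_on UNIV (j' x)" for x
      using sq by (cases "P x") (simp_all add: j'_P j'_not_P, simp add: P_def)
    show "convex_on UNIV (j' x)" for x
      using convex_on_cmul[OF _ convex_on_norm_square, of \<alpha>] assms(6)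
      by (cases "P x") (simp_all add: j'_P j'_not_P, simp add: P_def)
    show "\<alpha> * (norm \<xi>)\<^sup>2 \<le> j' x \<xi>" for x \<xi> by (auto simp: j'_def P_def)
    show "j' x \<xi> \<le> max \<alpha> \<beta> * (norm \<xi>)\<^sup>2" for x \<xi>
    proof -
      have "\<alpha> * (norm \<xi>)\<^sup>2 \<le> max \<alpha> \<beta> * (norm \<xi>)\<^sup>2" "\<beta> * (norm \<xi>)\<^sup>2 \<le> max \<alpha> \<beta> * (norm \<xi>)\<^sup>2"
        by (rule mult_right_mono; simp)+
      then show ?thesis by (auto simp: j'_def P_def intro: order_trans)
    qed
    show "0 \<le> b' x" "b' x \<le> B" for x using assms(11) by (auto simp: b'_def P_def)
    show "power_integrable ?M 2 f" using assms(13) by (simp add: Lp_eq_power_integrable)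
  qed (use assms in auto)
  then interpret degenerate_functional \<Omega> j' b' f \<alpha> "max \<alpha> \<beta>" B .
  have "energy j' b' f \<Omega> v = energy j b f \<Omega> v" for v
  proof -
    have "(\<integral>\<^sup>+x. ennreal (j' x (weak_grad \<Omega> v x) / (1 + b' x * \<bar>v x\<bar>)\<^sup>2) \<partial>?M) =
        (\<integral>\<^sup>+x. ennreal (j x (weak_grad \<Omega> v x) / (1 + b x * \<bar>v x\<bar>)\<^sup>2) \<partial>?M)"
      by (rule nn_integral_cong_AE) (use P in eventually_elim, simp add: j'_def b'_def)
    then show ?thesis by (simp add: energy_def)
  qed
  with exists_minimizer show ?thesis by simp
qed

end
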